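(* Let $R$ be a skew invertible R-matrix of $GL_q(n)$ type and $\gamma\in\mathbb C\setminus0$. Let $\mathcal A$ be either the $GL_q(n)$ type Heisenberg double algebra, or (when $O_R\propto I$ and $\gamma^n=q$) the $SL_q(n)$ type Heisenberg double algebra, and adjoin to it pairwise commuting elements $\mu_\alpha^{\pm1}$, $(\mu_\alpha-\mu_\beta)^{\pm1}$ ($\alpha\ne\beta$) commuting with all $L^i_j$, with $a_i=e_i(\mu_1,\dots,\mu_n)$ $(1\le i\le n)$ (and $\prod_\alpha\mu_\alpha=q^{-1}$ in the $SL_q(n)$ case), together with $$\gamma^2(P^\beta T)\mu_\alpha=q^{2\delta_{\alpha\beta}}\mu_\alpha(P^\beta T)\qquad\forall\,\alpha,\beta=1,\dots,n,\qquad ( * )$$ where $P^\alpha=\prod_{\beta\ne\alpha}\frac{L-q\mu_\beta I}{q(\mu_\alpha-\mu_\beta)}$. Then: (a) relations $( * )$ are equivalent to $\gamma^2T\mu_\alpha=\mu_\alpha T+(q^2-1)\mu_\alpha(P^\alpha T)$ for all $\alpha$; and (b) relations $( * )$ are consistent with the identifications $a_i=e_i(\mu)$, namely they imply $\gamma^{2i}Te_i(\mu)=e_i(\mu)T-(q^2-1)\sum_{j=1}^i(-q)^{-j}e_{i-j}(\mu)(L^jT)$ for $0\le i\le n$, which are the relations $\gamma^{2i}Ta_i=a_iT-(q^2-1)\sum_{j=1}^i(-q)^{-j}a_{i-j}(L^jT)$ holding in $\mathcal A$. The resulting algebra is the spectral completion $\overline{\mathfrak D}GL_q(n)[R,\gamma]$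 (resp. $\overline{\mathfrak D}SL_q(n)[R]$).
   Context: Notation: $V$ finite-dimensional complex vector space, $I=\mathrm{id}_V$, $P$ the flip; $X_i$ is $X\in\mathrm{End}(V\otimes V)$ in factors $i,i+1$, $X_{ij}$ in factors $i,j$; $Y_i$ is a matrix $Y$ in factor $i$; $\mathrm{Tr}_{(i)}$ partial trace. R-matrix: invertible $R$ with $R_1R_2R_1=R_2R_1R_2$; skew invertible if some $\Psi$ has $\mathrm{Tr}_{(2)}(R_{12}\Psi_{23})=\mathrm{Tr}_{(2)}(\Psi_{12}R_{23})=P_{13}$, then $(D_R)_1=\mathrm{Tr}_{(2)}\Psi_{12}$ and R-trace $\mathrm{Tr}_R(Y)=\mathrm{Tr}(D_RY)$. $i_q=(q^i-q^{-i})/(q-q^{-1})$; antisymmetrizers $A^{(1)}=I$, $A^{(j)}=\frac{(j-1)_q}{j_q}A^{(j-1)}(\frac{q^{j-1}}{(j-1)_q}I-R_{j-1})A^{(j-1)}$. $GL_q(n)$ type: $(R-qI)(R+q^{-1}I)=0$, $i_q\ne0$ ($2\le i\le n$), $A^{(n)}(\frac{q^n}{n_q}I-R_n)A^{(n)}=0$, $\mathrm{rank}A^{(n)}=1$. Heisenberg double $\mathfrak D\mathfrak G[R,\gamma]$: generated by entries of $T,L$ with $R_{12}T_1T_2=T_1T_2R_{12}$, $L_1R_{12}L_1R_{12}=R_{12}L_1R_{12}L_1$, $\gamma^2T_1L_2=R_{12}L_1R_{12}T_1$. $L_{\overline1}=L_1$, $L_{\overline{j+1}}=R_jL_{\overline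 j}R_j^{-1}$, $a_0=1$, $a_i=\mathrm{Tr}_{R(1..i)}(A^{(i)}L_{\overline1}\cdots L_{\overline i})$. $\det_RT=\mathrm{Tr}_{(1..n)}(A^{(n)}T_1\cdots T_n)$, $(O_R)_1=n_q\mathrm{Tr}_{(2..n+1)}(P_1\cdots P_nA^{(n)})$. The $GL_q(n)$ type HD algebra is $\mathfrak D\mathfrak G[R,\gamma]$ extended by two-sided inverses $(\det_RT)^{-1}$, $a_n^{-1}$ with $(\det_RT)^{-1}T=(O_R^{-1}TO_R)(\det_RT)^{-1}$, $\gamma^{2n}L(\det_RT)^{-1}=q^2(\det_RT)^{-1}(O_RLO_R^{-1})$, $\gamma^{2n}a_n^{-1}T=q^2Ta_n^{-1}$. The $SL_q(n)$ type HD algebra (for $O_R$ a scalar multiple of $I$ and $\gamma^n=q$) is the quotient of $\mathfrak D\mathfrak G[R,\gamma]$ by $\det_RT=1$, $a_n=q^{-1}$. $e_i$ is the $i$-th elementary symmetric polynomial. *)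

theory Defs
  imports Complex_Main "Jordan_Normal_Form.DL_Rank"
begin

text \<open>An operator on the k-th tensor power of V (dim V = N) with entries in a ring 'b
  is represented by its matrix entries indexed by multi-indices (lists of length k with
  entries < N): X out in.  Only entries on multi-indices in hd_midx N k are meaningful.
  Tensor positions are 0-based: factor number p (1-based, as in the paper) is position p-1.\<close>

type_synonym 'b hd_op = "nat list \<Rightarrow> nat list \<Rightarrow> 'b"

definition hd_midx :: "nat \<Rightarrow> nat \<Rightarrow> nat list set" where
  "hd_midx N k = {xs. length xs = k \<and> (\<forall>x\<in>set xs. x < N)}"

definition hd_op_eq :: "nat \<Rightarrow> nat \<Rightarrow> 'b hd_op \<Rightarrow> 'b hd_op \<Rightarrow> bool" where
  "hd_op_eq N k X Y \<longleftrightarrow> (\<forall>a\<in>hd_midx N k. \<forall>b\<in>hd_midx N k. X a b = Y a b)"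

definition hd_id :: "'b::zero_neq_one hd_op" where
  "hd_id = (\<lambda>a b. if a = b then 1 else 0)"

definition hd_zero :: "'b::zero hd_op" where
  "hd_zero = (\<lambda>a b. 0)"

definition hd_mul :: "nat \<Rightarrow> nat \<Rightarrow> 'b::semiring_0 hd_op \<Rightarrow> 'b hd_op \<Rightarrow> 'b hd_op" where
  "hd_mul N k X Y = (\<lambda>a b. \<Sum>c\<in>hd_midx N k. X a c * Y c b)"

definition hd_add :: "'b::plus hd_op \<Rightarrow> 'b hd_op \<Rightarrow> 'b hd_op" where
  "hd_add X Y = (\<lambda>a b. X a b + Y a b)"

definition hd_sub :: "'b::minus hd_op \<Rightarrow> 'b hd_op \<Rightarrow> 'b hd_op" where
  "hd_sub X Y = (\<lambda>a b. X a b - Y a b)"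

definition hd_scale :: "'b::times \<Rightarrow> 'b hd_op \<Rightarrow> 'b hd_op" where
  "hd_scale c X = (\<lambda>a b. c * X a b)"

definition hd_lift :: "nat \<Rightarrow> nat \<Rightarrow> 'b::zero hd_op \<Rightarrow> 'b hd_op" where
  "hd_lift i m X = (\<lambda>a b.
     if take i a = take i b \<and> drop (i + m) a = drop (i + m) b
     then X (take m (drop i a)) (take m (drop i b)) else 0)"

definition hd_ptr :: "nat \<Rightarrow> nat \<Rightarrow> 'b::comm_monoid_add hd_op \<Rightarrow> 'b hd_op" where
  "hd_ptr N i X = (\<lambda>a b. \<Sum>x<N. X (take i a @ x # drop i a) (take i b @ x # drop i b))"

text \<open>Partial trace taken c times at position i (e.g. Tr over factors 2..n+1 is
  hd_ptrs N 1 n).\<close>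
fun hd_ptrs :: "nat \<Rightarrow> nat \<Rightarrow> nat \<Rightarrow> 'b::comm_monoid_add hd_op \<Rightarrow> 'b hd_op" where
  "hd_ptrs N i 0 X = X"
| "hd_ptrs N i (Suc c) X = hd_ptrs N i c (hd_ptr N i X)"

definition hd_trace :: "nat \<Rightarrow> nat \<Rightarrow> 'b::comm_monoid_add hd_op \<Rightarrow> 'b" where
  "hd_trace N k X = (\<Sum>a\<in>hd_midx N k. X a a)"

definition hd_flip :: "nat \<Rightarrow> nat \<Rightarrow> 'b::zero_neq_one hd_op" where
  "hd_flip i j = (\<lambda>a b. if a = b[i := b ! j, j := b ! i] then 1 else 0)"

definition hd_vop :: "(nat \<Rightarrow> nat \<Rightarrow> 'b) \<Rightarrow> 'b hd_op" where
  "hd_vop X = (\<lambda>a b. X (hd a) (hd b))"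

definition hd_cop :: "(complex \<Rightarrow> 'a) \<Rightarrow> complex hd_op \<Rightarrow> 'a hd_op" where
  "hd_cop sc X = (\<lambda>a b. sc (X a b))"

definition hd_is_inverse :: "nat \<Rightarrow> nat \<Rightarrow> 'b::semiring_1 hd_op \<Rightarrow> 'b hd_op \<Rightarrow> bool" where
  "hd_is_inverse N k X Y \<longleftrightarrow> hd_op_eq N k (hd_mul N k X Y) hd_id \<and> hd_op_eq N k (hd_mul N k Y X) hd_id"

definition hd_inv :: "nat \<Rightarrow> nat \<Rightarrow> 'b::semiring_1 hd_op \<Rightarrow> 'b hd_op" where
  "hd_inv N k X = (SOME Y. hd_is_inverse N k X Y)"

definition is_Rmatrix :: "nat \<Rightarrow> complex hd_op \<Rightarrow> bool" where
  "is_Rmatrix N R \<longleftrightarrow> (\<exists>S. hd_is_inverse N 2 R S) \<and>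
     hd_op_eq N 3 (hd_mul N 3 (hd_lift 0 2 R) (hd_mul N 3 (hd_lift 1 2 R) (hd_lift 0 2 R)))
                  (hd_mul N 3 (hd_lift 1 2 R) (hd_mul N 3 (hd_lift 0 2 R) (hd_lift 1 2 R)))"

text \<open>Tr_(2)(R_12 Psi_23) = Tr_(2)(Psi_12 R_23) = P_13 (the result lives on factors 1,3).\<close>
definition is_skew_inverse :: "nat \<Rightarrow> complex hd_op \<Rightarrow> complex hd_op \<Rightarrow> bool" where
  "is_skew_inverse N R Psi \<longleftrightarrow>
     hd_op_eq N 2 (hd_ptr N 1 (hd_mul N 3 (hd_lift 0 2 R) (hd_lift 1 2 Psi))) (hd_flip 0 1) \<and>
     hd_op_eq N 2 (hd_ptr N 1 (hd_mul N 3 (hd_lift 0 2 Psi) (hd_lift 1 2 R))) (hd_flip 0 1)"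

definition hd_DR :: "nat \<Rightarrow> complex hd_op \<Rightarrow> complex hd_op" where
  "hd_DR N Psi = hd_ptr N 1 Psi"

definition hd_Dprod :: "nat \<Rightarrow> complex hd_op \<Rightarrow> nat \<Rightarrow> complex hd_op" where
  "hd_Dprod N Psi i = foldr (\<lambda>j acc. hd_mul N i (hd_lift j 1 (hd_DR N Psi)) acc) [0..<i] hd_id"

definition hd_rtrace :: "(complex \<Rightarrow> 'a::ring_1) \<Rightarrow> nat \<Rightarrow> complex hd_op \<Rightarrow> nat \<Rightarrow> 'a hd_op \<Rightarrow> 'a" where
  "hd_rtrace sc N Psi i X = hd_trace N i (hd_mul N i (hd_cop sc (hd_Dprod N Psi i)) X)"

text \<open>q-number i_q = (q^i - q^-i)/(q - q^-1), written as the Laurent polynomial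
  q^(i-1) + q^(i-3) + ... + q^(1-i) (this is its value also at q = +-1).\<close>
definition qnum :: "complex \<Rightarrow> nat \<Rightarrow> complex" where
  "qnum q i = (\<Sum>k<i. q powi (int i - 1 - 2 * int k))"

fun asym :: "nat \<Rightarrow> complex \<Rightarrow> complex hd_op \<Rightarrow> nat \<Rightarrow> complex hd_op" where
  "asym N q R 0 = hd_id"
| "asym N q R (Suc 0) = hd_id"
| "asym N q R (Suc (Suc k)) =
    (let j = Suc (Suc k); Aj = hd_lift 0 (Suc k) (asym N q R (Suc k)) in
      hd_scale (qnum q (Suc k) / qnum q j)
        (hd_mul N j Aj (hd_mul N j (hd_sub (hd_scale (q ^ Suc k / qnum q (Suc k)) hd_id) (hd_lift k 2 R)) Aj)))"

definition hd_enc :: "nat \<Rightarrow> nat \<Rightarrow> nat \<Rightarrow> nat list" where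
  "hd_enc N k i = map (\<lambda>p. i div N ^ p mod N) [0..<k]"

definition hd_to_mat :: "nat \<Rightarrow> nat \<Rightarrow> complex hd_op \<Rightarrow> complex mat" where
  "hd_to_mat N k X = mat (N ^ k) (N ^ k) (\<lambda>(i, j). X (hd_enc N k i) (hd_enc N k j))"

definition GLq_type :: "nat \<Rightarrow> nat \<Rightarrow> complex \<Rightarrow> complex hd_op \<Rightarrow> bool" where
  "GLq_type N n q R \<longleftrightarrow>
     hd_op_eq N 2 (hd_mul N 2 (hd_sub R (hd_scale q hd_id)) (hd_add R (hd_scale (inverse q) hd_id))) hd_zero \<and>
     (\<forall>i. 2 \<le> i \<and> i \<le> n \<longrightarrow> qnum q i \<noteq> 0) \<and>
     hd_op_eq N (Suc n)
       (hd_mul N (Suc n) (hd_lift 0 n (asym N q R n))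
          (hd_mul N (Suc n) (hd_sub (hd_scale (q ^ n / qnum q n) hd_id) (hd_lift (n - 1) 2 R))
             (hd_lift 0 n (asym N q R n)))) hd_zero \<and>
     vec_space.rank (N ^ n) (hd_to_mat N n (asym N q R n)) = 1"

definition hd_OR :: "nat \<Rightarrow> nat \<Rightarrow> complex \<Rightarrow> complex hd_op \<Rightarrow> complex hd_op" where
  "hd_OR N n q R = hd_scale (qnum q n)
     (hd_ptrs N 1 n (hd_mul N (Suc n)
        (foldr (\<lambda>j acc. hd_mul N (Suc n) (hd_lift j 2 (hd_flip 0 1)) acc) [0..<n] hd_id)
        (hd_lift 0 n (asym N q R n))))"

text \<open>The algebra is a unital ring 'a together with a central unital ring map sc from C,
  i.e. a C-algebra.\<close>
definition central_scalars :: "(complex \<Rightarrow> 'a::ring_1) \<Rightarrow> bool" where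
  "central_scalars sc \<longleftrightarrow> sc 0 = 0 \<and> sc 1 = 1 \<and> (\<forall>x y. sc (x + y) = sc x + sc y) \<and>
     (\<forall>x y. sc (x * y) = sc x * sc y) \<and> (\<forall>x y. sc x * y = y * sc x)"

definition mmul :: "nat \<Rightarrow> (nat \<Rightarrow> nat \<Rightarrow> 'a::semiring_0) \<Rightarrow> (nat \<Rightarrow> nat \<Rightarrow> 'a) \<Rightarrow> nat \<Rightarrow> nat \<Rightarrow> 'a" where
  "mmul N X Y = (\<lambda>i k. \<Sum>l<N. X i l * Y l k)"

definition mid :: "nat \<Rightarrow> nat \<Rightarrow> 'a::zero_neq_one" where
  "mid = (\<lambda>i j. if i = j then 1 else 0)"

fun mpow :: "nat \<Rightarrow> (nat \<Rightarrow> nat \<Rightarrow> 'a::semiring_1) \<Rightarrow> nat \<Rightarrow> nat \<Rightarrow> nat \<Rightarrow> 'a" where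
  "mpow N X 0 = mid"
| "mpow N X (Suc k) = mmul N X (mpow N X k)"

definition cmat :: "(complex \<Rightarrow> 'a) \<Rightarrow> complex hd_op \<Rightarrow> nat \<Rightarrow> nat \<Rightarrow> 'a" where
  "cmat sc X = (\<lambda>i j. sc (X [i] [j]))"

definition Rinv :: "nat \<Rightarrow> complex hd_op \<Rightarrow> complex hd_op" where
  "Rinv N R = hd_inv N 2 R"

definition HD_rel :: "(complex \<Rightarrow> 'a::ring_1) \<Rightarrow> nat \<Rightarrow> complex hd_op \<Rightarrow> complex \<Rightarrow>
    (nat \<Rightarrow> nat \<Rightarrow> 'a) \<Rightarrow> (nat \<Rightarrow> nat \<Rightarrow> 'a) \<Rightarrow> bool" where
  "HD_rel sc N R \<gamma> T L \<longleftrightarrow>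
    (let R' = hd_cop sc R; T1 = hd_lift 0 1 (hd_vop T); T2 = hd_lift 1 1 (hd_vop T);
         L1 = hd_lift 0 1 (hd_vop L); L2 = hd_lift 1 1 (hd_vop L); m = hd_mul N 2 in
       hd_op_eq N 2 (m R' (m T1 T2)) (m T1 (m T2 R')) \<and>
       hd_op_eq N 2 (m L1 (m R' (m L1 R'))) (m R' (m L1 (m R' L1))) \<and>
       hd_op_eq N 2 (hd_scale (sc (\<gamma>^2)) (m T1 L2)) (m R' (m L1 (m R' T1))))"

text \<open>L_{bar j} on the k-th tensor power (j 1-based).\<close>
fun Lbar :: "(complex \<Rightarrow> 'a::ring_1) \<Rightarrow> nat \<Rightarrow> complex hd_op \<Rightarrow> (nat \<Rightarrow> nat \<Rightarrow> 'a) \<Rightarrow> nat \<Rightarrow> nat \<Rightarrow> 'a hd_op" where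
  "Lbar sc N R L k 0 = hd_id"
| "Lbar sc N R L k (Suc 0) = hd_lift 0 1 (hd_vop L)"
| "Lbar sc N R L k (Suc (Suc j)) =
     hd_mul N k (hd_lift j 2 (hd_cop sc R)) (hd_mul N k (Lbar sc N R L k (Suc j)) (hd_lift j 2 (hd_cop sc (Rinv N R))))"

definition acoef :: "(complex \<Rightarrow> 'a::ring_1) \<Rightarrow> nat \<Rightarrow> complex \<Rightarrow> complex hd_op \<Rightarrow> complex hd_op \<Rightarrow>
    (nat \<Rightarrow> nat \<Rightarrow> 'a) \<Rightarrow> nat \<Rightarrow> 'a" where
  "acoef sc N q R Psi L i = (if i = 0 then 1 else
     hd_rtrace sc N Psi i (hd_mul N i (hd_cop sc (asym N q R i))
        (foldr (\<lambda>j acc. hd_mul N i (Lbar sc N R L i j) acc) [1..<Suc i] hd_id)))"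

definition detR :: "(complex \<Rightarrow> 'a::ring_1) \<Rightarrow> nat \<Rightarrow> nat \<Rightarrow> complex \<Rightarrow> complex hd_op \<Rightarrow>
    (nat \<Rightarrow> nat \<Rightarrow> 'a) \<Rightarrow> 'a" where
  "detR sc N n q R T = hd_trace N n (hd_mul N n (hd_cop sc (asym N q R n))
      (foldr (\<lambda>j acc. hd_mul N n (hd_lift j 1 (hd_vop T)) acc) [0..<n] hd_id))"

definition GL_ext :: "(complex \<Rightarrow> 'a::ring_1) \<Rightarrow> nat \<Rightarrow> nat \<Rightarrow> complex \<Rightarrow> complex \<Rightarrow> complex hd_op \<Rightarrow>
    complex hd_op \<Rightarrow> (nat \<Rightarrow> nat \<Rightarrow> 'a) \<Rightarrow> (nat \<Rightarrow> nat \<Rightarrow> 'a) \<Rightarrow> 'a \<Rightarrow> 'a \<Rightarrow> bool" where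
  "GL_ext sc N n q \<gamma> R Psi T L dinv ainv \<longleftrightarrow>
    (let d = detR sc N n q R T; an = acoef sc N q R Psi L n;
         Om = cmat sc (hd_OR N n q R); Oi = cmat sc (hd_inv N 1 (hd_OR N n q R)) in
      dinv * d = 1 \<and> d * dinv = 1 \<and> ainv * an = 1 \<and> an * ainv = 1 \<and>
      (\<forall>i<N. \<forall>j<N. dinv * T i j = mmul N (mmul N Oi T) Om i j * dinv) \<and>
      (\<forall>i<N. \<forall>j<N. sc (\<gamma> ^ (2 * n)) * L i j * dinv = sc (q^2) * dinv * mmul N (mmul N Om L) Oi i j) \<and>
      (\<forall>i<N. \<forall>j<N. sc (\<gamma> ^ (2 * n)) * ainv * T i j = sc (q^2) * T i j * ainv))"

definition SL_cond :: "(complex \<Rightarrow> 'a::ring_1) \<Rightarrow> nat \<Rightarrow> nat \<Rightarrow> complex \<Rightarrow> complex \<Rightarrow> complex hd_op \<Rightarrow>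
    complex hd_op \<Rightarrow> (nat \<Rightarrow> nat \<Rightarrow> 'a) \<Rightarrow> (nat \<Rightarrow> nat \<Rightarrow> 'a) \<Rightarrow> bool" where
  "SL_cond sc N n q \<gamma> R Psi T L \<longleftrightarrow>
     (\<exists>c. hd_op_eq N 1 (hd_OR N n q R) (hd_scale c hd_id)) \<and> \<gamma> ^ n = q \<and>
     detR sc N n q R T = 1 \<and> acoef sc N q R Psi L n = sc (inverse q)"

definition ring_invertible :: "'a::ring_1 \<Rightarrow> bool" where
  "ring_invertible x \<longleftrightarrow> (\<exists>y. x * y = 1 \<and> y * x = 1)"

definition ring_inv :: "'a::ring_1 \<Rightarrow> 'a" where
  "ring_inv x = (SOME y. x * y = 1 \<and> y * x = 1)"

text \<open>Elementary symmetric polynomial e_i(mu_0,...,mu_{n-1}) (the mu commute).\<close>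
definition esym :: "nat \<Rightarrow> (nat \<Rightarrow> 'a::ring_1) \<Rightarrow> nat \<Rightarrow> 'a" where
  "esym n \<mu> i = (\<Sum>S\<in>{S. S \<subseteq> {..<n} \<and> card S = i}. prod_list (map \<mu> (sorted_list_of_set S)))"

definition Pproj :: "(complex \<Rightarrow> 'a::ring_1) \<Rightarrow> nat \<Rightarrow> nat \<Rightarrow> complex \<Rightarrow> (nat \<Rightarrow> nat \<Rightarrow> 'a) \<Rightarrow>
    (nat \<Rightarrow> 'a) \<Rightarrow> nat \<Rightarrow> nat \<Rightarrow> nat \<Rightarrow> 'a" where
  "Pproj sc N n q L \<mu> \<alpha> = foldr (\<lambda>\<beta> acc. mmul N
       (\<lambda>i j. (L i j - (if i = j then sc q * \<mu> \<beta> else 0)) * ring_inv (sc q * (\<mu> \<alpha> - \<mu> \<beta>))) acc)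
     (filter (\<lambda>\<beta>. \<beta> \<noteq> \<alpha>) [0..<n]) mid"

end

theory Submission
  imports Defs
begin

text \<open>All operators are put in one ring: matrices over the algebra, tensored with infinitely many copies
  of matrix units. The heart of the matter is the relation between \<open>T\<close> and \<open>a\<^sub>k\<close>. By the defining relations,
  \<open>\<gamma>\<^sup>2\<^sup>k T\<^sub>1 (L\<dots>L)\<close> with the product of copies of \<open>L\<close> in the factors \<open>2, \<dots>, k + 1\<close> equals
  \<open>R\<^sub>1\<dots>R\<^sub>k (L\<dots>L) R\<^sub>k\<dots>R\<^sub>1 T\<^sub>1\<close> with the product in the factors \<open>1, \<dots>, k\<close>. Multiplying by the antisymmetrizer and
  taking the R-trace over all factors but the first one, the Hecke relation and the invariance
  \<open>Tr\<^sub>R (R\<^sup>-\<^sup>1 X R) = Tr\<^sub>R X\<close> give \<open>a\<^sub>k T\<close> plus a multiple of the partial R-trace \<open>B\<^sub>k\<close> of \<open>A L\<dots>L\<close>, and the same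
  technique yields the Newton-type recursion \<open>k\<^sub>q B\<^sub>k = (q\<^sup>k\<^sup>-\<^sup>1 a\<^sub>k\<^sub>-\<^sub>1 - (k-1)\<^sub>q B\<^sub>k\<^sub>-\<^sub>1) L\<close>.

  Comparing the case \<open>k = n\<close> with \<open>\<gamma>\<^sup>2\<^sup>n T a\<^sub>n = q\<^sup>2 a\<^sub>n T\<close>, which both extensions provide, shows
  \<open>\<Prod>(L - q\<mu>\<^sub>\<beta>) T = 0\<close> unless \<open>q\<^sup>2 = 1\<close>. Hence \<open>P\<^sup>\<beta> P\<^sup>\<alpha> T = \<delta>\<^sub>\<alpha>\<^sub>\<beta> P\<^sup>\<alpha> T\<close>, and together with \<open>\<Sum> P\<^sup>\<beta> = 1\<close> this gives
  the equivalence of the two forms of the relations between \<open>T\<close> and \<open>\<mu>\<^sub>\<alpha>\<close>.\<close>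

section \<open>Antisymmetrizers and R-traces of Hecke type\<close>

text \<open>The Cayley-Hamilton identity is proved only multiplied by T. Removing T would call for
  an inverse matrix, whereas every P in the relations to be compared stands directly to the left of
  T, so the weaker form suffices. The orthogonality of the P on T enters only with the coefficient
  q^2 - 1, so the case q^2 = 1, where one cannot divide by that number, is harmless.

  The number of factors changes in every induction, and antisymmetrizers and traces are needed at
  shifted positions. With infinitely many factors in one ring, a lift is a shift of an index, and a
  partial trace maps the ring to itself. The inductions then see factors only through commutants and
  traces, never through multi-indices. Since the entries do not commute, traces are not cyclic; each
  move across a trace has to be justified by a commutant or by the invariance under conjugation with
  R, which is derived from skew invertibility.\<close>

lemma qnum_0 [simp]: "qnum q 0 = 0"
  by (simp add: qnum_def)

lemma qnum_1 [simp]: "qnum q (Suc 0) = 1"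
  by (simp add: qnum_def)

lemma qnum_Suc:
  assumes "q \<noteq> 0"
  shows "qnum q (Suc k) = q * qnum q k + inverse (q ^ k)"
proof -
  have "qnum q (Suc k) = (\<Sum>i<k. q powi (int k - 2 * int i)) + q powi (- int k)"
    by (simp add: qnum_def)
  also have "(\<Sum>i<k. q powi (int k - 2 * int i)) = q * qnum q k"
    unfolding qnum_def sum_distrib_left
    by (intro sum.cong refl) (use assms in \<open>simp flip: power_int_add_1' \<close>)
  finally show ?thesis by (simp add: power_int_minus)
qed

lemma qnum_Suc':
  assumes "q \<noteq> 0"
  shows "qnum q (Suc k) = inverse q * qnum q k + q ^ k"
proof -
  have "qnum q (Suc k) = q powi (int k) + (\<Sum>i<k. q powi (int k - 2 - 2 * int i))"
    by (simp add: qnum_def sum.lessThan_Suc_shift algebra_simps del: sum.lessThan_Suc)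
  also have "(\<Sum>i<k. q powi (int k - 2 - 2 * int i)) = inverse q * qnum q k"
    unfolding qnum_def sum_distrib_left
  proof (intro sum.cong refl)
    fix i
    show "q powi (int k - 2 - 2 * int i) = inverse q * q powi (int k - 1 - 2 * int i)"
      using assms power_int_add[of q "-1" "int k - 1 - 2 * int i"]
      by (simp add: power_int_minus algebra_simps)
  qed
  finally show ?thesis by (simp add: add.commute)
qed

text \<open>Comparing the two recursions gives the closed form with its denominator cleared, which
  stays meaningful at q = 1 and q = -1.\<close>

lemma qnum_diff:
  assumes "q \<noteq> 0"
  shows "qnum q k * (q - inverse q) = q ^ k - inverse (q ^ k)"
  using qnum_Suc[OF assms, of k] qnum_Suc'[OF assms, of k] by (simp add: algebra_simps)

section \<open>Rings with a central copy of the complex numbers\<close>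

locale scalar_action =
  fixes K :: "complex \<Rightarrow> 'r::ring_1"
  assumes K_1: "K 1 = 1"
    and K_add: "K (x + y) = K x + K y"
    and K_mult: "K (x * y) = K x * K y"
    and K_central: "K x * r = r * K x"
begin

definition sm :: "complex \<Rightarrow> 'r \<Rightarrow> 'r" (infixr "\<cdot>" 75) where
  "c \<cdot> X = K c * X"

lemma K_0: "K 0 = 0"
  using K_add[of 0 0] by simp

lemma sm_mult_right: "X * (c \<cdot> Y) = c \<cdot> (X * Y)"
  unfolding sm_def by (metis K_central mult.assoc)

lemma sm_mult_left: "(c \<cdot> X) * Y = c \<cdot> (X * Y)"
  unfolding sm_def by (simp add: mult.assoc)

lemma sm_sm: "c \<cdot> d \<cdot> X = (c * d) \<cdot> X"
  unfolding sm_def by (simp add: mult.assoc K_mult)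

lemma sm_add: "c \<cdot> (X + Y) = c \<cdot> X + c \<cdot> Y"
  unfolding sm_def by (simp add: algebra_simps)

lemma sm_diff: "c \<cdot> (X - Y) = c \<cdot> X - c \<cdot> Y"
  unfolding sm_def by (simp add: algebra_simps)

lemma sm_add_left: "(c + d) \<cdot> X = c \<cdot> X + d \<cdot> X"
  unfolding sm_def by (simp add: algebra_simps K_add)

lemma K_minus: "K (- c) = - K c"
  using K_add[of c "- c"] K_0 by (simp add: eq_neg_iff_add_eq_0 add.commute)

lemma sm_minus_left: "(- c) \<cdot> X = - (c \<cdot> X)"
  unfolding sm_def by (simp add: K_minus)

lemma sm_minus: "c \<cdot> (- X) = - (c \<cdot> X)"
  unfolding sm_def by simp

lemma sm_diff_left: "(c - d) \<cdot> X = c \<cdot> X - d \<cdot> X"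
  using sm_add_left[of c "-d" X] by (simp add: sm_minus_left)

lemma sm_1 [simp]: "1 \<cdot> X = X"
  unfolding sm_def by (simp add: K_1)

lemma sm_0 [simp]: "0 \<cdot> X = 0" "c \<cdot> 0 = 0"
  unfolding sm_def by (simp_all add: K_0)

lemma sm_sum: "c \<cdot> (\<Sum>i\<in>I. f i) = (\<Sum>i\<in>I. c \<cdot> f i)"
  unfolding sm_def by (simp add: sum_distrib_left)

lemma sm_sum_left: "(\<Sum>i\<in>I. c i) \<cdot> X = (\<Sum>i\<in>I. c i \<cdot> X)"
  by (induction I rule: infinite_finite_induct) (simp_all add: sm_add_left)

lemma sm_cancel:
  assumes "c \<cdot> X = c \<cdot> Y" "c \<noteq> 0"
  shows "X = Y"
proof -
  have "inverse c \<cdot> c \<cdot> X = inverse c \<cdot> c \<cdot> Y" using assms by simp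
  then show ?thesis using assms(2) by (simp add: sm_sm)
qed

lemmas sm_mult = sm_mult_left sm_mult_right sm_sm

end

text \<open>\<open>C p\<close> plays the role of the commutant of the matrix units in factor \<open>p\<close>, and \<open>\<theta> p\<close> that of the
  R-trace over factor \<open>p\<close>, with the identity left in that factor; \<open>S i\<close> is the inverse of \<open>R i\<close>.\<close>

locale hecke_tower = scalar_action K for K :: "complex \<Rightarrow> 'r::ring_1" +
  fixes q :: complex and n :: nat and R S :: "nat \<Rightarrow> 'r"
    and C :: "nat \<Rightarrow> 'r set" and \<theta> :: "nat \<Rightarrow> 'r \<Rightarrow> 'r"
  assumes q_nz: "q \<noteq> 0"
    and qnum_nz_ge2: "2 \<le> i \<Longrightarrow> i \<le> n \<Longrightarrow> qnum q i \<noteq> 0"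
    and RS [simp]: "R i * S i = 1"
    and SR [simp]: "S i * R i = 1"
    and hecke: "R i = S i + K (q - inverse q)"
    and braid: "R i * R (Suc i) * R i = R (Suc i) * R i * R (Suc i)"
    and far: "Suc i < j \<Longrightarrow> R i * R j = R j * R i"
    and C_1: "1 \<in> C p"
    and C_K: "K c \<in> C p"
    and C_diff: "X \<in> C p \<Longrightarrow> Y \<in> C p \<Longrightarrow> X - Y \<in> C p"
    and C_mult: "X \<in> C p \<Longrightarrow> Y \<in> C p \<Longrightarrow> X * Y \<in> C p"
    and C_R: "p \<noteq> i \<Longrightarrow> p \<noteq> Suc i \<Longrightarrow> R i \<in> C p"
    and theta_add: "\<theta> p (X + Y) = \<theta> p X + \<theta> p Y"
    and theta_left: "X \<in> C p \<Longrightarrow> \<theta> p (X * Y) = X * \<theta> p Y"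
    and theta_right: "Y \<in> C p \<Longrightarrow> \<theta> p (X * Y) = \<theta> p X * Y"
    and theta_C: "\<theta> p X \<in> C p"
    and theta_C': "X \<in> C p' \<Longrightarrow> \<theta> p X \<in> C p'"
    and theta_R: "\<theta> (Suc p) (R p) = 1"
    and theta_conj: "X \<in> C (Suc p) \<Longrightarrow> \<theta> (Suc p) (S p * X * R p) = \<theta> p X"
begin

abbreviation \<kappa> :: complex where "\<kappa> \<equiv> - inverse q"

lemma qnum_nz: "1 \<le> i \<Longrightarrow> i \<le> n \<Longrightarrow> qnum q i \<noteq> 0"
  using qnum_nz_ge2[of i] by (cases "i = 1") auto

lemma R_cancel [simp]: "R i * (S i * X) = X" "S i * (R i * X) = X"
  by (simp_all flip: mult.assoc)

lemma hecke_sm: "R i = S i + (q - inverse q) \<cdot> 1"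
  by (simp add: hecke sm_def)

lemma R_square: "R i * R i = 1 + (q - inverse q) \<cdot> R i"
proof -
  have "R i * R i = (S i + (q - inverse q) \<cdot> 1) * R i" using hecke_sm by metis
  then show ?thesis by (simp add: algebra_simps sm_mult)
qed

lemma far': "Suc i < j \<or> Suc j < i \<Longrightarrow> R i * R j = R j * R i"
  using far by metis

lemma S_commute:
  assumes "R i * X = X * R i"
  shows "S i * X = X * S i"
proof -
  have "S i * X * (R i * S i) = S i * (X * R i) * S i" by (simp only: mult.assoc)
  also have "\<dots> = S i * (R i * X) * S i" using assms by simp
  finally show ?thesis by (simp add: mult.assoc)
qed

lemma theta_sm: "\<theta> p (c \<cdot> X) = c \<cdot> \<theta> p X"
  unfolding sm_def by (simp add: theta_left C_K)

lemma theta_diff: "\<theta> p (X - Y) = \<theta> p X - \<theta> p Y"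
  using theta_add[of p "X - Y" Y] by (simp add: eq_diff_eq)

lemma C_sm: "X \<in> C p \<Longrightarrow> c \<cdot> X \<in> C p"
  unfolding sm_def by (intro C_mult C_K)

lemma C_S: "p \<noteq> i \<Longrightarrow> p \<noteq> Suc i \<Longrightarrow> S i \<in> C p"
proof -
  have "S i = R i - K (q - inverse q)" using hecke[of i] by simp
  moreover assume "p \<noteq> i" "p \<noteq> Suc i"
  ultimately show ?thesis by (simp add: C_diff C_R C_K)
qed

text \<open>The antisymmetrizer in the factors \<open>s, \<dots>, s + k - 1\<close>.\<close>

fun Asy :: "nat \<Rightarrow> nat \<Rightarrow> 'r" where
  "Asy s 0 = 1"
| "Asy s (Suc 0) = 1"
| "Asy s (Suc (Suc k)) = (qnum q (Suc k) / qnum q (Suc (Suc k))) \<cdot>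
     (Asy s (Suc k) * (((q ^ Suc k / qnum q (Suc k)) \<cdot> 1 - R (s + k)) * Asy s (Suc k)))"

section \<open>Commutation and eigenvalues of the antisymmetrizers\<close>

lemma comm_mult: "X * A = A * X \<Longrightarrow> X * B = B * X \<Longrightarrow> X * (A * B) = A * B * (X :: 'r)"
  by (metis mult.assoc)

lemma comm_diff: "X * A = A * X \<Longrightarrow> X * B = B * X \<Longrightarrow> X * (A - B) = (A - B) * (X :: 'r)"
  by (simp add: algebra_simps)

lemma comm_sm: "X * A = A * X \<Longrightarrow> X * (c \<cdot> A) = (c \<cdot> A) * X"
  by (simp add: sm_mult)

lemma Asy_far: "s + k \<le> j \<Longrightarrow> R j * Asy s k = Asy s k * R j"
proof (induction s k rule: Asy.induct)
  case (3 s k)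
  have "R j * Asy s (Suc k) = Asy s (Suc k) * R j" "R j * R (s + k) = R (s + k) * R j"
    using 3 far'[of j "s + k"] by simp_all
  then show ?case by (auto intro!: comm_sm comm_mult comm_diff)
qed auto

lemma Asy_C: "p < s \<or> s + k \<le> p \<Longrightarrow> Asy s k \<in> C p"
proof (induction s k rule: Asy.induct)
  case (3 s k)
  then have "Asy s (Suc k) \<in> C p" "R (s + k) \<in> C p" by (auto intro!: C_R)
  then show ?case by (auto intro!: C_sm C_mult C_diff C_1)
qed (auto intro: C_1)

text \<open>The six facts feed each other, hence one induction. The crux is that the newest
  generator has eigenvalue \<open>\<kappa>\<close> on both sides; this uses the second fact one
  level below. The bound by n keeps the q-numbers in the denominators away from 0.\<close>

lemma Asy_props:
  assumes "Suc k \<le> n"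
  shows "Asy s (Suc k) * Asy s (Suc k) = Asy s (Suc k)"
    and "k \<ge> 1 \<Longrightarrow> qnum q (Suc k) \<cdot> Asy s (Suc k) =
      q ^ k \<cdot> Asy s k - qnum q k \<cdot> (Asy s k * R (s + k - 1) * Asy s k)"
    and "i < k \<Longrightarrow> R (s + i) * Asy s (Suc k) = \<kappa> \<cdot> Asy s (Suc k)"
    and "i < k \<Longrightarrow> Asy s (Suc k) * R (s + i) = \<kappa> \<cdot> Asy s (Suc k)"
    and "Asy s k * Asy s (Suc k) = Asy s (Suc k)"
    and "Asy s (Suc k) * Asy s k = Asy s (Suc k)"
  using assms
proof (induction k arbitrary: i)
  case 0
  { case 1 then show ?case by simp }
  { case 2 then show ?case by simp }
  { case 3 then show ?case by simp }
  { case 4 then show ?case by simp }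
  { case 5 then show ?case by simp }
  { case 6 then show ?case by simp }
next
  case (Suc k)
  define A where "A = Asy s (Suc k)"
  define B where "B = Asy s (Suc (Suc k))"
  define e where "e = Asy s k"
  define r where "r = R (s + k)"
  have main: "B * B = B \<and> qnum q (Suc (Suc k)) \<cdot> B = q ^ Suc k \<cdot> A - qnum q (Suc k) \<cdot> (A * r * A)
     \<and> (\<forall>i<Suc k. R (s + i) * B = \<kappa> \<cdot> B) \<and> (\<forall>i<Suc k. B * R (s + i) = \<kappa> \<cdot> B) \<and> A * B = B \<and> B * A = B"
    if n: "Suc (Suc k) \<le> n"
  proof -
    have n': "Suc k \<le> n" using n by simp
    have nz1: "qnum q (Suc k) \<noteq> 0" and nz2: "qnum q (Suc (Suc k)) \<noteq> 0"
      using n qnum_nz by simp_all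
    have AA: "A * A = A" and eA: "e * A = A" and Ae: "A * e = A"
      using Suc.IH(1,5,6)[OF n'] unfolding A_def e_def by simp_all
    have AA': "A * (A * X) = A * X" for X using AA by (simp flip: mult.assoc)
    have eA': "e * (A * X) = A * X" for X using eA by (simp flip: mult.assoc)
    have Ae': "A * (e * X) = A * X" for X using Ae by (simp flip: mult.assoc)
    have RA: "R (s + i) * A = \<kappa> \<cdot> A" and AR: "A * R (s + i) = \<kappa> \<cdot> A" if "i < k" for i
      using Suc.IH(3,4)[of i, OF that n'] unfolding A_def by simp_all
    have Bdef: "B = (qnum q (Suc k) / qnum q (Suc (Suc k))) \<cdot>
       (A * (((q ^ Suc k / qnum q (Suc k)) \<cdot> 1 - r) * A))"
      unfolding B_def A_def r_def by simp
    have qB: "qnum q (Suc (Suc k)) \<cdot> B = q ^ Suc k \<cdot> A - qnum q (Suc k) \<cdot> (A * r * A)"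
      unfolding Bdef using nz1 nz2 by (simp add: algebra_simps sm_mult sm_diff AA)
    have AB: "A * B = B" and BA: "B * A = B"
      unfolding Bdef by (simp_all add: sm_mult mult.assoc AA AA')
    have er: "e * r = r * e" unfolding e_def r_def by (simp add: Asy_far)
    have er': "e * (r * X) = r * (e * X)" for X using er by (metis mult.assoc)
    have rr: "r * r = 1 + (q - inverse q) \<cdot> r"
      unfolding r_def by (rule R_square)
    have rr': "r * (r * X) = X + (q - inverse q) \<cdot> (r * X)" for X
    proof -
      have "r * (r * X) = (1 + (q - inverse q) \<cdot> r) * X" by (simp only: rr flip: mult.assoc)
      then show ?thesis by (simp add: algebra_simps sm_mult)
    qed
    have qq: "q * (inverse q * x) = x" for x using q_nz by simp
    have RB: "r * B = \<kappa> \<cdot> B" and BR: "B * r = \<kappa> \<cdot> B"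
    proof -
      have "r * (qnum q (Suc (Suc k)) \<cdot> B) = \<kappa> \<cdot> (qnum q (Suc (Suc k)) \<cdot> B) \<and>
            (qnum q (Suc (Suc k)) \<cdot> B) * r = \<kappa> \<cdot> (qnum q (Suc (Suc k)) \<cdot> B)"
      proof (cases k)
        case 0
        then have "A = 1" unfolding A_def by simp
        then show ?thesis unfolding qB using 0 q_nz
          by (simp add: algebra_simps sm_mult sm_diff sm_add rr sm_minus_left sm_add_left sm_diff_left)
      next
        case (Suc k')
        define r' where "r' = R (s + k')"
        have qA: "qnum q (Suc k) \<cdot> A = q ^ k \<cdot> e - qnum q k \<cdot> (e * r' * e)"
          using Suc.IH(2)[OF _ n'] Suc unfolding A_def e_def r'_def by simp
        have r'A: "r' * A = \<kappa> \<cdot> A" and Ar': "A * r' = \<kappa> \<cdot> A"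
          using RA[of k'] AR[of k'] Suc unfolding r'_def by simp_all
        have Ar'': "A * (r' * X) = \<kappa> \<cdot> (A * X)" for X using Ar' by (metis mult.assoc sm_mult_left)
        have br: "r' * (r * r') = r * (r' * r)"
          using braid[of "s + k'"] Suc unfolding r_def r'_def by (simp add: mult.assoc)
        have br': "r' * (r * (r' * X)) = r * (r' * (r * X))" for X
          using br by (metis mult.assoc)
        \<comment> \<open>Expanding only the left factor A leaves the word e r' r A. Since r
          commutes with e, the braid relation turns r r' r A into r' r r' A, and r' A is
          \<open>\<kappa>\<close> times A. Expanding the right factor gives the mirror
          image.\<close>
        have l: "qnum q (Suc k) \<cdot> (A * r * A) = q ^ k \<cdot> (r * A) - qnum q k \<cdot> (e * (r' * (r * A)))"
        proof -
          have "qnum q (Suc k) \<cdot> (A * r * A) = (qnum q (Suc k) \<cdot> A) * (r * A)"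
            by (simp add: sm_mult mult.assoc)
          also have "\<dots> = q ^ k \<cdot> (r * A) - qnum q k \<cdot> (e * (r' * (r * A)))"
            unfolding qA by (simp add: algebra_simps sm_mult er' eA)
          finally show ?thesis .
        qed
        have r: "qnum q (Suc k) \<cdot> (A * r * A) = q ^ k \<cdot> (A * r) - qnum q k \<cdot> (A * (r * (r' * e)))"
        proof -
          have "qnum q (Suc k) \<cdot> (A * r * A) = (A * r) * (qnum q (Suc k) \<cdot> A)"
            by (simp add: sm_mult mult.assoc)
          also have "\<dots> = q ^ k \<cdot> (A * r) - qnum q k \<cdot> (A * (r * (r' * e)))"
            unfolding qA by (simp add: algebra_simps sm_mult er'[symmetric] er[symmetric] Ae Ae')
          finally show ?thesis .
        qed
        have l2: "r * (e * (r' * (r * A))) = \<kappa> \<cdot> (e * (r' * (r * A)))"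
          by (simp add: er'[symmetric] br'[symmetric] r'A sm_mult)
        have r2: "A * (r * (r' * e)) * r = \<kappa> \<cdot> (A * (r * (r' * e)))"
          by (simp add: mult.assoc er br'[symmetric] Ar'' sm_mult)
        have "r * (qnum q (Suc (Suc k)) \<cdot> B) = \<kappa> \<cdot> (qnum q (Suc (Suc k)) \<cdot> B)"
          unfolding qB l using l2
          by (simp add: qq sm_minus algebra_simps sm_mult sm_diff sm_add rr' sm_minus_left sm_add_left sm_diff_left)
        moreover have "(qnum q (Suc (Suc k)) \<cdot> B) * r = \<kappa> \<cdot> (qnum q (Suc (Suc k)) \<cdot> B)"
          unfolding qB r using r2
          by (simp add: qq sm_minus algebra_simps sm_mult sm_diff sm_add rr sm_minus_left sm_add_left sm_diff_left)
        ultimately show ?thesis by simp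
      qed
      then have "qnum q (Suc (Suc k)) \<cdot> (r * B) = qnum q (Suc (Suc k)) \<cdot> (\<kappa> \<cdot> B)"
        "qnum q (Suc (Suc k)) \<cdot> (B * r) = qnum q (Suc (Suc k)) \<cdot> (\<kappa> \<cdot> B)"
        by (simp_all add: sm_mult mult.commute)
      then show "r * B = \<kappa> \<cdot> B" "B * r = \<kappa> \<cdot> B"
        using nz2 by (auto intro: sm_cancel)
    qed
    \<comment> \<open>One factor is expanded: B absorbs A and takes the value
      \<open>\<kappa>\<close> on r, so the coefficient is q^(k+1) + [k+1]/q = [k+2].\<close>
    have qBB: "B * B = B"
    proof -
      have "qnum q (Suc (Suc k)) \<cdot> (B * B) = B * (qnum q (Suc (Suc k)) \<cdot> B)"
        by (simp add: sm_mult)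
      also have "\<dots> = (q ^ Suc k + qnum q (Suc k) * inverse q) \<cdot> B"
        unfolding qB by (simp add: algebra_simps sm_mult BA sm_add_left BR sm_minus_left sm_minus flip: mult.assoc)
      also have "\<dots> = qnum q (Suc (Suc k)) \<cdot> B"
        using qnum_Suc'[OF q_nz, of "Suc k"] by (simp add: algebra_simps)
      finally show ?thesis using nz2 by (rule sm_cancel)
    qed
    have "R (s + i) * B = \<kappa> \<cdot> B \<and> B * R (s + i) = \<kappa> \<cdot> B" if "i < Suc k" for i
    proof (cases "i = k")
      case True
      then show ?thesis using RB BR unfolding r_def by simp
    next
      case False
      then have "i < k" using that by simp
      have "R (s + i) * (A * B) = \<kappa> \<cdot> (A * B)" "(B * A) * R (s + i) = \<kappa> \<cdot> (B * A)"
        using RA[OF \<open>i < k\<close>] AR[OF \<open>i < k\<close>] by (simp_all add: sm_mult mult.assoc) (simp add: sm_mult flip: mult.assoc)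
      then show ?thesis by (simp add: AB BA)
    qed
    then show ?thesis using qB AB BA qBB by blast
  qed
  { case 1 then show ?case using main unfolding B_def by blast }
  { case 2 then show ?case using main unfolding B_def A_def r_def by simp }
  { case 3 then show ?case using main unfolding B_def by blast }
  { case 4 then show ?case using main unfolding B_def by blast }
  { case 5 then show ?case using main unfolding B_def A_def by blast }
  { case 6 then show ?case using main unfolding B_def A_def by blast }
qed

lemma S_comm: "A * R i = R i * A \<Longrightarrow> A * S i = S i * A"
  using S_commute[of i A] by simp

section \<open>The braids R_0 ... R_(k-1) (\<open>up k\<close>) and R_(s+k-1) ... R_s
  (\<open>dn s k\<close>)\<close>

primrec up :: "nat \<Rightarrow> 'r" where
  "up 0 = 1"
| "up (Suc k) = up k * R k"

primrec dn :: "nat \<Rightarrow> nat \<Rightarrow> 'r" where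
  "dn s 0 = 1"
| "dn s (Suc k) = R (s + k) * dn s k"

lemma up_C: "k < p \<Longrightarrow> up k \<in> C p"
  by (induction k) (auto intro!: C_mult C_1 C_R)

lemma dn_C: "s + k < p \<or> p < s \<Longrightarrow> dn s k \<in> C p"
  by (induction k) (auto intro!: C_mult C_1 C_R)

lemma up_far: "k < i \<Longrightarrow> R i * up k = up k * R i"
  by (induction k) (auto intro!: comm_mult far')

lemma dn_far: "s + k < i \<Longrightarrow> R i * dn s k = dn s k * R i"
  by (induction k) (auto intro!: comm_mult far')

lemma up_shift: "Suc i < k \<Longrightarrow> R (Suc i) * up k = up k * R i"
proof (induction k)
  case (Suc k)
  show ?case
  proof (cases "Suc i = k")
    case True
    have far: "R k * up i = up i * R k" using True by (intro up_far) simp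
    have "R k * up (Suc k) = (R k * up i) * (R i * R k)"
      by (simp add: mult.assoc flip: True)
    also have "\<dots> = up i * (R k * R i * R k)" by (simp add: far mult.assoc)
    also have "\<dots> = up (Suc k) * R i"
      using braid[of i] by (simp add: mult.assoc flip: True)
    finally show ?thesis by (simp only: True)
  next
    case False
    then have IH: "R (Suc i) * up k = up k * R i" and far: "R i * R k = R k * R i"
      using Suc by (auto intro: far)
    have "R (Suc i) * up (Suc k) = (R (Suc i) * up k) * R k" by (simp add: mult.assoc)
    also have "\<dots> = up k * (R i * R k)" by (simp add: IH mult.assoc)
    also have "\<dots> = up (Suc k) * R i" by (simp add: far mult.assoc)
    finally show ?thesis .
  qed
qed simp

text \<open>All factors of the product commute with one of the two generators except the adjacent
  pair R_(i+1) R_i, where the braid relation raises the index. \<open>up_shift\<close> is the mirror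
  image.\<close>

lemma dn_shift: "Suc i < k \<Longrightarrow> R i * dn 0 k = dn 0 k * R (Suc i)"
proof (induction k)
  case (Suc k)
  show ?case
  proof (cases "Suc i = k")
    case True
    have far: "R k * dn 0 i = dn 0 i * R k" using True by (intro dn_far) simp
    have "R i * dn 0 (Suc k) = (R i * R k * R i) * dn 0 i"
      by (simp add: mult.assoc flip: True)
    also have "\<dots> = R k * R i * (R k * dn 0 i)"
      using braid[of i] by (simp add: mult.assoc True)
    also have "\<dots> = dn 0 (Suc k) * R k"
      unfolding far by (simp add: mult.assoc flip: True)
    finally show ?thesis by (simp only: True)
  next
    case False
    then have IH: "R i * dn 0 k = dn 0 k * R (Suc i)" and far: "R i * R k = R k * R i"
      using Suc by (auto intro: far)
    have "R i * dn 0 (Suc k) = (R i * R k) * dn 0 k" by (simp add: mult.assoc)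
    also have "\<dots> = R k * (R i * dn 0 k)" by (simp add: far mult.assoc)
    also have "\<dots> = dn 0 (Suc k) * R (Suc i)" by (simp add: IH mult.assoc)
    finally show ?thesis .
  qed
qed simp

lemma dn_dn: "j \<le> k \<Longrightarrow> dn 0 j * dn 0 (Suc k) = dn 0 (Suc k) * dn 1 j"
proof (induction j)
  case (Suc j)
  have "dn 0 (Suc j) * dn 0 (Suc k) = R j * dn 0 (Suc k) * dn 1 j"
    using Suc by (simp add: mult.assoc)
  also have "R j * dn 0 (Suc k) = dn 0 (Suc k) * R (Suc j)"
    using Suc.prems by (intro dn_shift) simp
  finally show ?case by (simp only: dn.simps mult.assoc plus_1_eq_Suc)
qed simp

lemma dn_1_R0: "dn 1 k * R 0 = dn 0 (Suc k)"
  by (induction k) (simp_all add: mult.assoc)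

text \<open>Permits cancelling \<open>dn 1 k\<close> on the right at the end of
  \<open>T_LL\<close>.\<close>

lemma dn_right_inverse: "\<exists>Y. dn s k * Y = 1"
proof (induction k)
  case (Suc k)
  then obtain Y where "dn s k * Y = 1" by blast
  then have "dn s (Suc k) * (Y * S (s + k)) = 1"
    by simp (metis RS mult.assoc mult_1)
  then show ?case by blast
qed auto

lemma intertwine_mult:
  "X * U = U * X' \<Longrightarrow> Y * U = U * Y' \<Longrightarrow> (X * Y) * U = U * (X' * (Y' :: 'r))"
  by (metis mult.assoc)

lemma intertwine_diff:
  "X * U = U * X' \<Longrightarrow> Y * U = U * Y' \<Longrightarrow> (X - Y) * U = U * (X' - (Y' :: 'r))"
  by (simp add: algebra_simps)

lemma intertwine_sm: "X * U = U * X' \<Longrightarrow> (c \<cdot> X) * U = U * (c \<cdot> X')"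
  by (simp add: sm_mult)

lemma Asy_up: "m \<le> k \<Longrightarrow> Asy 1 m * up k = up k * Asy 0 m"
proof (induction m rule: less_induct)
  case (less m)
  consider "m = 0" | "m = 1" | i where "m = Suc (Suc i)" by (metis One_nat_def not0_implies_Suc)
  then show ?case
  proof cases
    case 3
    have A: "Asy 1 (Suc i) * up k = up k * Asy 0 (Suc i)" using less 3 by simp
    have B: "R (1 + i) * up k = up k * R (0 + i)" using less.prems 3 up_shift[of i k] by simp
    show ?thesis unfolding 3 Asy.simps
      by (intro intertwine_sm intertwine_mult intertwine_diff A B) simp
  qed auto
qed

text \<open>The R-trace over the factors \<open>j, \<dots>, j + c - 1\<close>.\<close>

primrec Th :: "nat \<Rightarrow> nat \<Rightarrow> 'r \<Rightarrow> 'r" where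
  "Th j 0 X = X"
| "Th j (Suc c) X = Th j c (\<theta> (j + c) X)"

section \<open>R-traces over several factors\<close>

lemma Th_add: "Th j c (X + Y) = Th j c X + Th j c Y"
  by (induction c arbitrary: X Y) (simp_all add: theta_add)

lemma Th_sm: "Th j c (a \<cdot> X) = a \<cdot> Th j c X"
  by (induction c arbitrary: X) (simp_all add: theta_sm)

lemma Th_diff: "Th j c (X - Y) = Th j c X - Th j c Y"
  by (induction c arbitrary: X Y) (simp_all add: theta_diff)

lemma Th_left: "(\<And>p. j \<le> p \<Longrightarrow> X \<in> C p) \<Longrightarrow> Th j c (X * Y) = X * Th j c Y"
  by (induction c arbitrary: Y) (simp_all add: theta_left)

lemma Th_right: "(\<And>p. j \<le> p \<Longrightarrow> Y \<in> C p) \<Longrightarrow> Th j c (X * Y) = Th j c X * Y"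
  by (induction c arbitrary: X) (simp_all add: theta_right)

text \<open>These are the properties of A L...L that survive a partial R-trace. The trace formulas
  below are inductions that replace M by its trace over the last factor, so they have to be stated
  for a class of elements closed under this operation.\<close>

definition antisym_at :: "nat \<Rightarrow> 'r \<Rightarrow> bool" where
  "antisym_at j M \<longleftrightarrow> (\<forall>p\<ge>j. M \<in> C p) \<and>
     (\<forall>i. Suc i < j \<longrightarrow> R i * M = \<kappa> \<cdot> M \<and> M * R i = \<kappa> \<cdot> M)"

lemma antisym_at_theta:
  assumes "antisym_at (Suc j) M"
  shows "antisym_at j (\<theta> j M)"
  unfolding antisym_at_def
proof (intro conjI allI impI)
  fix p assume "j \<le> p"
  then show "\<theta> j M \<in> C p"
    using assms theta_C theta_C' unfolding antisym_at_def by (cases "p = j") auto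
next
  fix i assume i: "Suc i < j"
  then have "R i \<in> C j" by (intro C_R) auto
  then have "R i * \<theta> j M = \<theta> j (R i * M)" "\<theta> j M * R i = \<theta> j (M * R i)"
    by (simp_all add: theta_left theta_right)
  then show "R i * \<theta> j M = \<kappa> \<cdot> \<theta> j M" "\<theta> j M * R i = \<kappa> \<cdot> \<theta> j M"
    using assms i unfolding antisym_at_def by (simp_all add: theta_sm)
qed

lemma antisym_up:
  assumes "antisym_at (Suc j) M" "i \<le> j"
  shows "up i * M = \<kappa> ^ i \<cdot> M"
  using assms(2)
proof (induction i)
  case (Suc i)
  then have "R i * M = \<kappa> \<cdot> M" using assms(1) unfolding antisym_at_def by simp
  then show ?case using Suc by (simp add: mult.assoc sm_mult)
qed simp

lemma antisym_dn:
  assumes "antisym_at (Suc j) M" "i \<le> j"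
  shows "M * dn 0 i = \<kappa> ^ i \<cdot> M"
  using assms(2)
proof (induction i)
  case (Suc i)
  then have "M * R i = \<kappa> \<cdot> M" using assms(1) unfolding antisym_at_def by simp
  then show ?case using Suc by (simp add: sm_mult flip: mult.assoc)
qed simp

text \<open>In each step of the recursion the smaller antisymmetrizer acts by 1 and the generator by
  \<open>\<kappa>\<close>; \<open>qnum_Suc'\<close> makes the resulting scalar equal to 1.\<close>

lemma antisym_Asy:
  assumes "antisym_at j M" "j \<le> n" "i \<le> j"
  shows "Asy 0 i * M = M"
  using assms(3)
proof (induction i rule: less_induct)
  case (less i)
  consider "i = 0" | "i = 1" | k where "i = Suc (Suc k)" by (metis One_nat_def not0_implies_Suc)
  then show ?case
  proof cases
    case 3
    then have nz: "qnum q (Suc k) \<noteq> 0" "qnum q (Suc (Suc k)) \<noteq> 0"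
      using less.prems assms(2) qnum_nz by simp_all
    have 1: "Asy 0 (Suc k) * M = M" using less 3 by simp
    have 2: "R k * M = \<kappa> \<cdot> M" using assms(1) less.prems 3 unfolding antisym_at_def by simp
    have "Asy 0 i * M = (qnum q (Suc k) / qnum q (Suc (Suc k)) * (q ^ Suc k / qnum q (Suc k) + inverse q)) \<cdot> M"
      unfolding 3 by (simp add: mult.assoc sm_mult 1 2 left_diff_distrib right_diff_distrib sm_diff
          sm_add_left sm_minus_left sm_minus ring_distribs)
    also have "qnum q (Suc k) / qnum q (Suc (Suc k)) * (q ^ Suc k / qnum q (Suc k) + inverse q) = 1"
    proof -
      have "q ^ Suc k / qnum q (Suc k) + inverse q = qnum q (Suc (Suc k)) / qnum q (Suc k)"
        unfolding qnum_Suc'[OF q_nz, of "Suc k"] add_divide_distrib using nz by simp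
      then show ?thesis using nz by simp
    qed
    finally show ?thesis by simp
  qed auto
qed

text \<open>The Hecke relation replaces the left R by its inverse plus a scalar. The first term is a
  conjugation, under which the R-trace is invariant; in the second one M comes out and the R-trace
  of R is 1.\<close>

lemma theta_sandwich:
  assumes "M \<in> C (Suc j)"
  shows "\<theta> (Suc j) (R j * M * R j) = \<theta> j M + (q - inverse q) \<cdot> M"
proof -
  have "R j * M * R j = S j * M * R j + (q - inverse q) \<cdot> (M * R j)"
    by (subst hecke_sm) (simp add: algebra_simps sm_mult)
  then show ?thesis using assms
    by (simp add: theta_add theta_conj theta_sm theta_left theta_R)
qed

text \<open>The trace over the last factor meets only the innermost sandwich R M R. In its scalar
  correction the remaining braids act on M directly, each by \<open>\<kappa> ^ j\<close>. The
  coefficient is the geometric sum of (q - 1/q) q^(-2i) over i < j.\<close>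

lemma trace_up_dn:
  assumes "antisym_at j M"
  shows "Th 1 j (up j * M * dn 0 j) = Th 0 j M + (q - q * inverse q ^ (2 * j)) \<cdot> Th 1 (j - 1) M"
  using assms
proof (induction j arbitrary: M)
  case (Suc j)
  have M: "M \<in> C (Suc j)" using Suc.prems unfolding antisym_at_def by simp
  note IH = Suc.IH[OF antisym_at_theta[OF Suc.prems]]
  have "Th 1 (Suc j) (up (Suc j) * M * dn 0 (Suc j)) =
      Th 1 j (\<theta> (Suc j) (up j * ((R j * M * R j) * dn 0 j)))"
    by (simp add: mult.assoc)
  also have "\<theta> (Suc j) (up j * ((R j * M * R j) * dn 0 j)) = up j * \<theta> (Suc j) (R j * M * R j) * dn 0 j"
    using theta_left[OF up_C[of j "Suc j"], of "R j * M * R j * dn 0 j"]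
      theta_right[OF dn_C[of 0 j "Suc j"], of "R j * M * R j"] by (simp add: mult.assoc)
  also have "\<dots> = up j * (\<theta> j M + (q - inverse q) \<cdot> M) * dn 0 j"
    by (simp only: theta_sandwich[OF M])
  also have "\<dots> = up j * \<theta> j M * dn 0 j + ((q - inverse q) * (\<kappa> ^ j * \<kappa> ^ j)) \<cdot> M"
    using antisym_up[OF Suc.prems, of j] antisym_dn[OF Suc.prems, of j]
    by (simp add: algebra_simps sm_mult)
  also have "Th 1 j \<dots> = Th 0 (Suc j) M + (q - q * inverse q ^ (2 * j)) \<cdot> Th 1 (j - 1) (\<theta> j M)
      + ((q - inverse q) * (\<kappa> ^ j * \<kappa> ^ j)) \<cdot> Th 1 j M"
    using IH by (simp add: Th_add Th_sm)
  \<comment> \<open>For j = 0 the index j - 1 truncates and the two traces differ, but the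
    coefficient is then 0.\<close>
  also have "(q - q * inverse q ^ (2 * j)) \<cdot> Th 1 (j - 1) (\<theta> j M) = (q - q * inverse q ^ (2 * j)) \<cdot> Th 1 j M"
    by (cases j) simp_all
  also have "Th 0 (Suc j) M + (q - q * inverse q ^ (2 * j)) \<cdot> Th 1 j M
      + ((q - inverse q) * (\<kappa> ^ j * \<kappa> ^ j)) \<cdot> Th 1 j M =
      Th 0 (Suc j) M + ((q - q * inverse q ^ (2 * j)) + (q - inverse q) * (\<kappa> ^ j * \<kappa> ^ j)) \<cdot> Th 1 j M"
    by (simp add: sm_add_left add.assoc)
  also have "(q - q * inverse q ^ (2 * j)) + (q - inverse q) * (\<kappa> ^ j * \<kappa> ^ j) = q - q * inverse q ^ (2 * Suc j)"
  proof -
    have "\<kappa> ^ j * \<kappa> ^ j = inverse q ^ (2 * j)"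
      by (simp add: mult_2 power_add flip: power_mult_distrib)
    then show ?thesis using q_nz by (simp add: field_simps)
  qed
  finally show ?case by simp
qed simp

text \<open>The recursion of the antisymmetrizer splits the trace in two. One part is linear in R
  and traces to M, the other is a sandwich; the terms without a trace of M combine by
  \<open>qnum_diff\<close>, and what remains is the same statement for the traced M.\<close>

lemma trace_Asy_dn:
  assumes "antisym_at j M" "Suc j \<le> n"
  shows "qnum q (Suc j) \<cdot> Th 1 j (Asy 0 (Suc j) * M * dn 0 j) =
    (-1) ^ j \<cdot> (Th 0 j M - (qnum q j * inverse q ^ j) \<cdot> Th 1 (j - 1) M)"
  using assms
proof (induction j arbitrary: M)
  case (Suc j)
  have M: "M \<in> C (Suc j)" using Suc.prems unfolding antisym_at_def by simp
  have n': "Suc j \<le> n" using Suc.prems by simp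
  note IH = Suc.IH[OF antisym_at_theta[OF Suc.prems(1)] n']
  define a where "a = Asy 0 (Suc j)"
  define d where "d = dn 0 j"
  have aM: "a * M = M"
    unfolding a_def using Suc.prems n' by (intro antisym_Asy[of "Suc j"]) auto
  have aM': "a * (M * X) = M * X" for X using aM by (metis mult.assoc)
  have aC: "a \<in> C (Suc j)" unfolding a_def by (intro Asy_C) auto
  have dC: "d \<in> C (Suc j)" unfolding d_def by (intro dn_C) auto
  have qA: "qnum q (Suc (Suc j)) \<cdot> Asy 0 (Suc (Suc j)) =
     q ^ Suc j \<cdot> a - qnum q (Suc j) \<cdot> (a * R j * a)"
    unfolding a_def using Asy_props(2)[of "Suc j" 0] Suc.prems by simp
  have "qnum q (Suc (Suc j)) \<cdot> Th 1 (Suc j) (Asy 0 (Suc (Suc j)) * M * dn 0 (Suc j)) =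
      Th 1 (Suc j) ((qnum q (Suc (Suc j)) \<cdot> Asy 0 (Suc (Suc j))) * M * dn 0 (Suc j))"
    by (simp only: Th_sm sm_mult)
  also have "(qnum q (Suc (Suc j)) \<cdot> Asy 0 (Suc (Suc j))) * M * dn 0 (Suc j) =
      q ^ Suc j \<cdot> (M * R j * d) - qnum q (Suc j) \<cdot> (a * (R j * M * R j) * d)"
    unfolding qA d_def by (simp add: left_diff_distrib sm_mult mult.assoc aM aM')
  also have "Th 1 (Suc j) \<dots> =
     Th 1 j (q ^ Suc j \<cdot> (M * d) - qnum q (Suc j) \<cdot> (a * (\<theta> j M + (q - inverse q) \<cdot> M) * d))"
    using M aC dC theta_sandwich[OF M]
    by (simp add: theta_diff theta_sm theta_left theta_right theta_R Th_diff Th_sm)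
  also have "q ^ Suc j \<cdot> (M * d) - qnum q (Suc j) \<cdot> (a * (\<theta> j M + (q - inverse q) \<cdot> M) * d) =
     (q ^ Suc j - qnum q (Suc j) * (q - inverse q)) \<cdot> (M * d) - qnum q (Suc j) \<cdot> (a * \<theta> j M * d)"
  proof -
    have "a * (\<theta> j M + (q - inverse q) \<cdot> M) * d = a * \<theta> j M * d + (q - inverse q) \<cdot> (M * d)"
      by (simp add: distrib_left distrib_right sm_mult_left sm_mult_right aM)
    then show ?thesis by (simp add: sm_add sm_sm sm_diff sm_diff_left right_diff_distrib)
  qed
  also have "\<dots> = (inverse (q ^ Suc j) * \<kappa> ^ j) \<cdot> M - qnum q (Suc j) \<cdot> (a * \<theta> j M * d)"
    using qnum_diff[OF q_nz, of "Suc j"] antisym_dn[OF Suc.prems(1), of j]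
    unfolding d_def by (simp add: sm_sm)
  also have "Th 1 j \<dots> = (inverse (q ^ Suc j) * \<kappa> ^ j) \<cdot> Th 1 j M -
       (-1) ^ j \<cdot> (Th 0 (Suc j) M - (qnum q j * inverse q ^ j) \<cdot> Th 1 (j - 1) (\<theta> j M))"
    using IH unfolding a_def d_def by (simp add: Th_diff Th_sm)
  \<comment> \<open>At j = 0 the truncated index is again harmless, since \<open>qnum q 0\<close>
    vanishes.\<close>
  also have "(qnum q j * inverse q ^ j) \<cdot> Th 1 (j - 1) (\<theta> j M) = (qnum q j * inverse q ^ j) \<cdot> Th 1 j M"
    by (cases j) simp_all
  also have "(inverse (q ^ Suc j) * \<kappa> ^ j) \<cdot> Th 1 j M -
       (-1) ^ j \<cdot> (Th 0 (Suc j) M - (qnum q j * inverse q ^ j) \<cdot> Th 1 j M) =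
     (-1) ^ Suc j \<cdot> Th 0 (Suc j) M +
       (inverse (q ^ Suc j) * \<kappa> ^ j + (-1) ^ j * (qnum q j * inverse q ^ j)) \<cdot> Th 1 j M"
    by (simp add: sm_diff sm_sm sm_add_left sm_minus_left)
  also have "inverse (q ^ Suc j) * \<kappa> ^ j + (-1) ^ j * (qnum q j * inverse q ^ j) =
      - ((-1) ^ Suc j * (qnum q (Suc j) * inverse q ^ Suc j))"
  proof -
    have "\<kappa> ^ j = (-1) ^ j * inverse q ^ j" by (metis mult_minus1 power_mult_distrib)
    then show ?thesis using q_nz
      by (simp add: qnum_Suc[OF q_nz] algebra_simps flip: power_inverse)
  qed
  finally show ?case by (simp add: sm_diff sm_sm sm_minus_left)
qed simp

section \<open>The barred copies of L, counted from 0 and starting in factor s\<close>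

primrec Lb :: "'r \<Rightarrow> nat \<Rightarrow> nat \<Rightarrow> 'r" where
  "Lb X s 0 = X"
| "Lb X s (Suc j) = R (s + j) * Lb X s j * S (s + j)"

primrec LL :: "'r \<Rightarrow> nat \<Rightarrow> nat \<Rightarrow> 'r" where
  "LL X s 0 = 1"
| "LL X s (Suc k) = LL X s k * Lb X s k"

text \<open>The inverse R-matrices telescope: the barred copy is X conjugated by
  \<open>dn s j\<close>.\<close>

lemma Lb_dn: "Lb X s j * dn s j = dn s j * X"
proof (induction j)
  case (Suc j)
  have "Lb X s (Suc j) * dn s (Suc j) = R (s + j) * (Lb X s j * dn s j)"
    by (simp add: mult.assoc)
  then show ?case using Suc by (simp add: mult.assoc)
qed simp

end

text \<open>\<open>L'\<close> is the copy of L in the second factor, tied to L by \<open>TL\<close>,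
  and g stands for \<gamma>^2.\<close>

locale heisenberg_tower = hecke_tower K q n R S C \<theta>
  for K :: "complex \<Rightarrow> 'r::ring_1" and q n R S C \<theta> +
  fixes L L' T :: 'r and g :: complex
  assumes L_C: "1 \<le> p \<Longrightarrow> L \<in> C p" and L_R: "1 \<le> i \<Longrightarrow> R i * L = L * R i"
    and RE: "L * R 0 * L * R 0 = R 0 * L * R 0 * L"
    and T_C: "1 \<le> p \<Longrightarrow> T \<in> C p" and T_R: "1 \<le> i \<Longrightarrow> R i * T = T * R i"
    and TL: "g \<cdot> (T * L') = R 0 * L * R 0 * T"
begin

lemma Lb_far: "j < i \<Longrightarrow> R i * Lb L 0 j = Lb L 0 j * R i"
  by (induction j) (auto intro!: comm_mult far' L_R S_comm)

lemma Lb_C: "j < p \<Longrightarrow> Lb L 0 j \<in> C p"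
  by (induction j) (auto intro!: C_mult C_R C_S L_C)

lemma braid_S: "R (Suc i) * S i * S (Suc i) = S i * S (Suc i) * R i"
proof -
  have "R (Suc i) * S i * S (Suc i) = S i * S (Suc i) * (R (Suc i) * R i * R (Suc i)) * S i * S (Suc i)"
    by (simp add: mult.assoc)
  also have "\<dots> = S i * S (Suc i) * (R i * R (Suc i) * R i) * S i * S (Suc i)"
    by (simp only: braid)
  also have "\<dots> = S i * S (Suc i) * R i"
    by (simp add: mult.assoc)
  finally show ?thesis .
qed

lemma braid_S': "S i * R (Suc i) * R i = R (Suc i) * R i * S (Suc i)"
proof -
  have "S i * R (Suc i) * R i = S i * (R (Suc i) * R i * R (Suc i)) * S (Suc i)"
    by (simp add: mult.assoc)
  also have "\<dots> = S i * (R i * R (Suc i) * R i) * S (Suc i)" by (simp only: braid)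
  also have "\<dots> = R (Suc i) * R i * S (Suc i)" by (simp add: mult.assoc)
  finally show ?thesis .
qed

text \<open>The critical case is j = i + 2. There R_i crosses R_(i+1) R_i by the braid relation,
  continues as R_(i+1) past the inner copy, which lives further left, and returns to R_i on the
  other side.\<close>

lemma Lb_near: "Suc i < j \<Longrightarrow> R i * Lb L 0 j = Lb L 0 j * R i"
proof (induction j)
  case (Suc j)
  show ?case
  proof (cases "Suc i = j")
    case True
    define X where "X = Lb L 0 i"
    have X: "R (Suc i) * X = X * R (Suc i)" unfolding X_def by (rule Lb_far) simp
    have "R i * Lb L 0 (Suc (Suc i)) = (R i * R (Suc i) * R i) * X * S i * S (Suc i)"
      by (simp add: X_def mult.assoc)
    also have "\<dots> = R (Suc i) * R i * (R (Suc i) * X) * S i * S (Suc i)"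
      unfolding braid by (simp only: mult.assoc)
    also have "\<dots> = R (Suc i) * R i * X * (R (Suc i) * S i * S (Suc i))"
      unfolding X by (simp only: mult.assoc)
    also have "\<dots> = Lb L 0 (Suc (Suc i)) * R i"
      unfolding braid_S by (simp add: X_def mult.assoc)
    finally show ?thesis using True by simp
  next
    case False
    then show ?thesis using Suc by (auto intro!: comm_mult far S_comm)
  qed
qed simp

text \<open>The reflection equation moves one factor to the right under conjugation by R_j: braid
  relations bring the two inner copies of X together, the old equation is applied, and the same
  moves are undone.\<close>

lemma Lb_RE: "Lb L 0 j * R j * Lb L 0 j * R j = R j * Lb L 0 j * R j * Lb L 0 j"
proof (induction j)
  case 0
  show ?case using RE by simp
next
  case (Suc j)
  define X a b a' b' where "X = Lb L 0 j" and "a = R j" and "b = R (Suc j)" and "a' = S j" and "b' = S (Suc j)"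
  have Xb: "b * X = X * b" unfolding X_def b_def by (rule Lb_far) simp
  have Xb': "b' * X = X * b'" using S_comm[of X "Suc j"] Xb unfolding b_def b'_def by simp
  have re: "X * a * X * a = a * X * a * X" using Suc unfolding X_def a_def .
  have br: "a * b * a = b * a * b" unfolding a_def b_def by (rule braid)
  have br': "a' * b * a = b * a * b'" unfolding a_def b_def a'_def b'_def by (rule braid_S')
  have L: "Lb L 0 (Suc j) = a * X * a'" by (simp add: X_def a_def a'_def)
  have br3: "b' * a' * b = a * b' * a'"
  proof -
    have "b' * a' * b = b' * a' * b * a * a'" by (simp add: mult.assoc a_def a'_def)
    also have "\<dots> = b' * (a' * b * a) * a'" by (simp only: mult.assoc)
    also have "\<dots> = b' * b * a * b' * a'" unfolding br' by (simp only: mult.assoc)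
    finally show ?thesis by (simp add: b_def b'_def)
  qed
  have "(a * X * a') * b * (a * X * a') * b = a * X * (a' * b * a) * X * a' * b"
    by (simp only: mult.assoc)
  also have "\<dots> = a * (X * b) * a * (b' * X) * a' * b" unfolding br' by (simp only: mult.assoc)
  also have "\<dots> = a * b * X * a * X * (b' * a' * b)"
    unfolding Xb[symmetric] Xb' by (simp only: mult.assoc)
  also have "\<dots> = a * b * (X * a * X * a) * b' * a'"
    unfolding br3 by (simp only: mult.assoc)
  also have "\<dots> = (a * b * a) * X * a * X * b' * a'" unfolding re by (simp only: mult.assoc)
  also have "\<dots> = b * a * (b * X) * a * (X * b') * a'" unfolding br by (simp only: mult.assoc)
  also have "\<dots> = b * a * X * (b * a * b') * X * a'" unfolding Xb Xb'[symmetric] by (simp only: mult.assoc)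
  also have "\<dots> = b * (a * X * a') * b * (a * X * a')" unfolding br'[symmetric] by (simp only: mult.assoc)
  finally show ?case unfolding L b_def .
qed

lemma LL_far: "k \<le> i \<Longrightarrow> R i * LL L 0 k = LL L 0 k * R i"
  by (induction k) (auto intro!: comm_mult Lb_far)

lemma LL_C: "k \<le> p \<Longrightarrow> LL L 0 k \<in> C p"
  by (induction k) (auto intro!: C_mult C_1 Lb_C)

text \<open>R_i passes the early copies because they are far and the late ones by
  \<open>Lb_near\<close>; the two copies in its own factors it passes only as a pair, by the
  reflection equation.\<close>

lemma LL_comm: "Suc i < k \<Longrightarrow> R i * LL L 0 k = LL L 0 k * R i"
proof (induction k)
  case (Suc k)
  show ?case
  proof (cases "Suc i = k")
    case True
    define X where "X = Lb L 0 i"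
    have P: "LL L 0 (Suc k) = LL L 0 i * (X * (R i * X * S i))"
      by (simp add: X_def mult.assoc flip: True)
    have "R i * (X * (R i * X * S i)) = (R i * X * R i * X) * S i" by (simp only: mult.assoc)
    also have "\<dots> = (X * (R i * X * S i)) * R i"
      unfolding X_def Lb_RE[symmetric] by (simp add: mult.assoc)
    finally have pair: "R i * (X * (R i * X * S i)) = (X * (R i * X * S i)) * R i" .
    show ?thesis unfolding P by (rule comm_mult[OF LL_far pair]) simp
  next
    case False
    then have "R i * LL L 0 k = LL L 0 k * R i" "R i * Lb L 0 k = Lb L 0 k * R i"
      using Suc by (auto intro: Lb_near)
    then show ?thesis unfolding LL.simps by (rule comm_mult)
  qed
qed simp

abbreviation M :: "nat \<Rightarrow> 'r" where "M k \<equiv> Asy 0 k * LL L 0 k"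

lemma antisym_M:
  assumes "k \<le> n"
  shows "antisym_at k (M k)"
  unfolding antisym_at_def
proof (intro conjI allI impI)
  fix p assume "k \<le> p"
  then show "M k \<in> C p" by (intro C_mult Asy_C LL_C) auto
next
  fix i assume i: "Suc i < k"
  then obtain k' where k: "k = Suc k'" "i < k'" by (cases k) auto
  have "R i * Asy 0 k = \<kappa> \<cdot> Asy 0 k" "Asy 0 k * R i = \<kappa> \<cdot> Asy 0 k"
    using Asy_props(3,4)[of k' i 0] k assms by simp_all
  then show "R i * M k = \<kappa> \<cdot> M k" "M k * R i = \<kappa> \<cdot> M k"
    using LL_comm[OF i] by (simp_all add: sm_mult mult.assoc flip: LL_comm[OF i])
      (simp_all add: sm_mult flip: mult.assoc)
qed

definition a :: "nat \<Rightarrow> 'r" where "a k = Th 0 k (M k)"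

lemma T_LL: "g ^ k \<cdot> (T * LL L' 1 k) = up k * LL L 0 k * dn 0 k * T"
proof (induction k)
  case (Suc k)
  have dn1_T: "T * dn 1 k = dn 1 k * T"
    by (induction k) (simp_all add: T_R mult.assoc, metis T_R le_add1 mult.assoc plus_1_eq_Suc)
  have dn1_L: "L * dn 1 k = dn 1 k * L"
    by (induction k) (simp_all add: L_R mult.assoc, metis L_R le_add1 mult.assoc plus_1_eq_Suc)
  have dd: "dn 0 k * dn 0 (Suc k) = dn 0 (Suc k) * dn 1 k" by (intro dn_dn) simp
  \<comment> \<open>Multiplying by \<open>dn 1 k\<close> on the right clears the inverse R-matrices
    of the last copy, so that T can be brought next to \<open>L'\<close> and \<open>TL\<close>
    applies. The multiplier is cancelled at the end.\<close>
  have "(g ^ Suc k \<cdot> (T * LL L' 1 (Suc k))) * dn 1 k =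
      (g ^ k \<cdot> (T * LL L' 1 k)) * (g \<cdot> (Lb L' 1 k * dn 1 k))"
    by (simp add: sm_mult mult.assoc mult.commute)
  also have "\<dots> = up k * LL L 0 k * dn 0 k * (g \<cdot> (T * dn 1 k * L'))"
    unfolding Suc Lb_dn by (simp add: sm_mult mult.assoc)
  also have "\<dots> = up k * LL L 0 k * dn 0 k * dn 1 k * (g \<cdot> (T * L'))"
    unfolding dn1_T by (simp add: sm_mult mult.assoc)
  also have "\<dots> = up k * LL L 0 k * (dn 0 k * (dn 1 k * R 0)) * L * R 0 * T"
    unfolding TL by (simp only: mult.assoc)
  also have "\<dots> = up k * LL L 0 k * dn 0 (Suc k) * (dn 1 k * L) * R 0 * T"
    unfolding dn_1_R0 dd by (simp only: mult.assoc)
  also have "\<dots> = up k * LL L 0 k * dn 0 (Suc k) * L * (dn 1 k * R 0) * T"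
    unfolding dn1_L[symmetric] by (simp only: mult.assoc)
  also have "\<dots> = up k * (LL L 0 k * R k) * (dn 0 k * L) * dn 0 (Suc k) * T"
    unfolding dn_1_R0 by (simp add: mult.assoc)
  also have "\<dots> = up (Suc k) * LL L 0 k * (Lb L 0 k * dn 0 k) * dn 0 (Suc k) * T"
    unfolding Lb_dn LL_far[OF order.refl, symmetric] by (simp add: mult.assoc)
  also have "\<dots> = up (Suc k) * LL L 0 (Suc k) * (dn 0 k * dn 0 (Suc k)) * T"
    by (simp only: LL.simps mult.assoc)
  also have "\<dots> = (up (Suc k) * LL L 0 (Suc k) * dn 0 (Suc k) * T) * dn 1 k"
    unfolding dd by (simp only: mult.assoc dn1_T)
  finally have eq: "(g ^ Suc k \<cdot> (T * LL L' 1 (Suc k))) * dn 1 k =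
    (up (Suc k) * LL L 0 (Suc k) * dn 0 (Suc k) * T) * dn 1 k" .
  obtain Y where Y: "dn 1 k * Y = 1" using dn_right_inverse by blast
  have "X * dn 1 k * Y = X" for X using Y by (simp add: mult.assoc)
  then show ?case using eq by metis
qed simp

text \<open>T lives in factor 0 and hence commutes with traces over the other factors. The
  antisymmetrizer in the factors from 1 on passes \<open>up k\<close> and arrives in the factors
  from 0 on.\<close>

lemma T_trace:
  assumes "k \<le> n"
  shows "g ^ k \<cdot> (T * Th 1 k (Asy 1 k * LL L' 1 k)) = Th 1 k (up k * M k * dn 0 k) * T"
proof -
  have AT: "Asy 1 k * T = T * Asy 1 k"
  proof (induction k rule: less_induct)
    case (less k)
    consider "k = 0" | "k = 1" | i where "k = Suc (Suc i)" by (metis One_nat_def not0_implies_Suc)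
    then show ?case
    proof cases
      case 3
      have A: "Asy 1 (Suc i) * T = T * Asy 1 (Suc i)" using less 3 by simp
      show ?thesis unfolding 3 Asy.simps
        by (intro intertwine_sm intertwine_mult intertwine_diff A T_R) simp_all
    qed auto
  qed
  have "g ^ k \<cdot> (T * Th 1 k (Asy 1 k * LL L' 1 k)) = Th 1 k (Asy 1 k * (g ^ k \<cdot> (T * LL L' 1 k)))"
    using AT by (simp add: Th_left[OF T_C, symmetric] Th_sm sm_mult flip: mult.assoc)
  also have "\<dots> = Th 1 k (up k * M k * dn 0 k * T)"
    unfolding T_LL using Asy_up[of k k] by (simp flip: mult.assoc)
  finally show ?thesis by (simp add: Th_right[OF T_C])
qed

text \<open>The R-trace over all factors but the first. At k = 0 it is 1, but below it always comes
  with the coefficient \<open>qnum q k\<close>, which is then 0.\<close>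

definition B :: "nat \<Rightarrow> 'r" where "B k = Th 1 (k - 1) (M k)"

lemma B_Suc:
  assumes "Suc j \<le> n"
  shows "qnum q (Suc j) \<cdot> B (Suc j) = (q ^ j \<cdot> a j - qnum q j \<cdot> B j) * L"
proof -
  \<comment> \<open>\<open>M (Suc j)\<close> absorbs \<open>dn 0 j\<close> up to
    \<open>\<kappa> ^ j\<close>, so the braid can be inserted at the price of (-q)^j. It then turns
    the last barred copy into L in factor 0, which leaves the trace on the right.\<close>
  have s: "(- q) ^ j * \<kappa> ^ j = 1" using q_nz by (simp flip: power_mult_distrib)
  have "M (Suc j) = ((- q) ^ j * \<kappa> ^ j) \<cdot> M (Suc j)" unfolding s by simp
  also have "\<dots> = (- q) ^ j \<cdot> (M (Suc j) * dn 0 j)"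
    using antisym_dn[OF antisym_M[OF assms], of j] by (simp add: sm_sm)
  also have "M (Suc j) * dn 0 j = Asy 0 (Suc j) * LL L 0 j * (Lb L 0 j * dn 0 j)"
    by (simp add: mult.assoc)
  also have "\<dots> = (Asy 0 (Suc j) * M j * dn 0 j) * L"
    unfolding Lb_dn using Asy_props(6)[of j 0] assms by (simp flip: mult.assoc)
  finally have MS: "M (Suc j) = (- q) ^ j \<cdot> ((Asy 0 (Suc j) * M j * dn 0 j) * L)" .
  have "qnum q (Suc j) \<cdot> B (Suc j) =
      (- q) ^ j \<cdot> ((qnum q (Suc j) \<cdot> Th 1 j (Asy 0 (Suc j) * M j * dn 0 j)) * L)"
    unfolding B_def MS by (simp add: Th_sm Th_right[OF L_C] sm_mult mult.commute)
  also have "\<dots> = (- q) ^ j \<cdot> (((-1) ^ j \<cdot> (a j - (qnum q j * inverse q ^ j) \<cdot> B j)) * L)"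
    using antisym_M[of j] assms by (subst trace_Asy_dn) (simp_all add: a_def B_def)
  also have "\<dots> = (((- q) ^ j * (-1) ^ j) \<cdot> a j - ((- q) ^ j * (-1) ^ j * (qnum q j * inverse q ^ j)) \<cdot> B j) * L"
    by (simp add: sm_mult sm_diff left_diff_distrib mult.assoc)
  also have "(- q) ^ j * (-1) ^ j = q ^ j" by (simp flip: power_mult_distrib)
  also have "q ^ j * (qnum q j * inverse q ^ j) = qnum q j"
    using q_nz by (simp add: field_simps)
  finally show ?thesis .
qed

text \<open>With this weight the recursion becomes x_(k+1) = (a_k - x_k) L / q, whose solution is
  the alternating sum.\<close>

lemma B_eq:
  assumes "k \<le> n"
  shows "(inverse q ^ k * qnum q k) \<cdot> B k = - (\<Sum>m=1..k. inverse ((- q) ^ m) \<cdot> (a (k - m) * L ^ m))"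
  using assms
proof (induction k)
  case (Suc k)
  have "(inverse q ^ Suc k * qnum q (Suc k)) \<cdot> B (Suc k) = inverse q ^ Suc k \<cdot> (q ^ k \<cdot> a k - qnum q k \<cdot> B k) * L"
    using B_Suc[OF Suc.prems] by (simp add: sm_mult flip: sm_sm)
  also have "\<dots> = (inverse q ^ Suc k * q ^ k) \<cdot> (a k * L) - inverse q \<cdot> (((inverse q ^ k * qnum q k) \<cdot> B k) * L)"
    by (simp add: sm_diff sm_sm sm_mult left_diff_distrib mult.assoc)
  also have "inverse q ^ Suc k * q ^ k = inverse q"
    using q_nz by (simp add: field_simps)
  also have "(inverse q ^ k * qnum q k) \<cdot> B k = - (\<Sum>m=1..k. inverse ((- q) ^ m) \<cdot> (a (k - m) * L ^ m))"
    using Suc by simp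
  also have "inverse q \<cdot> (- (\<Sum>m=1..k. inverse ((- q) ^ m) \<cdot> (a (k - m) * L ^ m)) * L) =
     (\<Sum>m=1..k. inverse ((- q) ^ Suc m) \<cdot> (a (k - m) * L ^ Suc m))"
    by (simp add: sum_distrib_right sm_sum sm_mult sm_minus power_Suc2 mult.assoc sum_negf[symmetric] sm_minus_left
        del: power_Suc) (simp add: sm_minus_left sum_negf mult.commute)
  also have "\<dots> = (\<Sum>m=2..Suc k. inverse ((- q) ^ m) \<cdot> (a (Suc k - m) * L ^ m))"
    by (rule sum.reindex_bij_witness[of _ "\<lambda>m. m - 1" Suc]) (auto simp del: power_Suc)
  also have "inverse q \<cdot> (a k * L) - \<dots> = - (\<Sum>m=1..Suc k. inverse ((- q) ^ m) \<cdot> (a (Suc k - m) * L ^ m))"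
    by (subst (2) sum.atLeast_Suc_atMost) (simp_all add: sm_minus_left numeral_2_eq_2)
  finally show ?case .
qed simp

text \<open>The hypothesis on \<open>a k\<close> says that this trace does not depend on where the
  factors start. It holds in the model, where both traces are the same element of the
  algebra.\<close>

lemma T_a:
  assumes k: "k \<le> n" and a': "Th 1 k (Asy 1 k * LL L' 1 k) = a k"
  shows "g ^ k \<cdot> (T * a k) =
    a k * T - (q\<^sup>2 - 1) \<cdot> (\<Sum>m=1..k. inverse ((- q) ^ m) \<cdot> (a (k - m) * L ^ m * T))"
proof -
  \<comment> \<open>Matches the coefficient of \<open>trace_up_dn\<close> with the weight of
    \<open>B_eq\<close>; this is the origin of the factor q^2 - 1.\<close>
  have c: "q - q * inverse q ^ (2 * k) = (q\<^sup>2 - 1) * (inverse q ^ k * qnum q k)"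
  proof -
    have "(q\<^sup>2 - 1) * (inverse q ^ k * qnum q k) = q * inverse q ^ k * (qnum q k * (q - inverse q))"
      using q_nz by (simp add: field_simps power2_eq_square)
    also have "\<dots> = q - q * inverse q ^ (2 * k)"
      unfolding qnum_diff[OF q_nz] using q_nz by (simp add: field_simps mult_2_right power_add)
    finally show ?thesis by simp
  qed
  have "g ^ k \<cdot> (T * a k) = Th 1 k (up k * M k * dn 0 k) * T"
    using T_trace[OF k] a' by simp
  also have "\<dots> = (a k + (q\<^sup>2 - 1) \<cdot> ((inverse q ^ k * qnum q k) \<cdot> B k)) * T"
    unfolding trace_up_dn[OF antisym_M[OF k]] c by (simp add: a_def B_def sm_sm)
  also have "\<dots> = a k * T - (q\<^sup>2 - 1) \<cdot> ((\<Sum>m=1..k. inverse ((- q) ^ m) \<cdot> (a (k - m) * L ^ m)) * T)"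
    unfolding B_eq[OF k] by (simp add: left_diff_distrib sm_mult sm_minus)
  finally show ?thesis by (simp add: sum_distrib_right sm_mult mult.assoc)
qed

end

section \<open>Matrix units over a noncommutative ring\<close>

text \<open>Only right linear maps are admitted, so that left multiplication by a central element is central.\<close>

typedef (overloaded) ('a::ring_1) endo =
  "{f :: ((nat \<Rightarrow> nat) \<Rightarrow> 'a) \<Rightarrow> (nat \<Rightarrow> nat) \<Rightarrow> 'a.
     (\<forall>u v. f (\<lambda>x. u x + v x) = (\<lambda>x. f u x + f v x)) \<and>
     (\<forall>u c. f (\<lambda>x. u x * c) = (\<lambda>x. f u x * c))}"
  by (rule exI[of _ "\<lambda>v. v"]) simp

setup_lifting type_definition_endo

instantiation endo :: (ring_1) ring_1
begin

lift_definition zero_endo :: "'a endo" is "\<lambda>v x. 0" by simp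
lift_definition one_endo :: "'a endo" is "\<lambda>v. v" by simp
lift_definition plus_endo :: "'a endo \<Rightarrow> 'a endo \<Rightarrow> 'a endo" is "\<lambda>f g v x. f v x + g v x"
  by (auto simp: algebra_simps fun_eq_iff)
lift_definition minus_endo :: "'a endo \<Rightarrow> 'a endo \<Rightarrow> 'a endo" is "\<lambda>f g v x. f v x - g v x"
  by (auto simp: algebra_simps fun_eq_iff)
lift_definition uminus_endo :: "'a endo \<Rightarrow> 'a endo" is "\<lambda>f v x. - f v x"
  by (auto simp: algebra_simps fun_eq_iff)
lift_definition times_endo :: "'a endo \<Rightarrow> 'a endo \<Rightarrow> 'a endo" is "\<lambda>f g v. f (g v)"
  by auto

instance
proof
  show "(0 :: 'a endo) \<noteq> 1"
    by transfer (auto simp: fun_eq_iff intro!: exI[of _ "\<lambda>_. 1"])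
qed (transfer; auto simp: algebra_simps fun_eq_iff)+

end

lemma Rep_endo_sum: "Rep_endo (\<Sum>i\<in>I. f i) v a = (\<Sum>i\<in>I. Rep_endo (f i) v a)"
  by (induction I rule: infinite_finite_induct) (simp_all add: zero_endo.rep_eq plus_endo.rep_eq)

lift_definition left_mult :: "'a::ring_1 \<Rightarrow> 'a endo" is "\<lambda>x v a. x * v a"
  by (auto simp: algebra_simps)

text \<open>The basis vectors are sequences of naturals, the basis index of factor \<open>p\<close> being \<open>a p mod N\<close>. The quotient
  \<open>a p div N\<close> is a spectator: it makes the diagonal units sum up to the identity although \<open>N\<close> is not
  encoded in a type.\<close>

lift_definition unit_endo :: "nat \<Rightarrow> nat \<Rightarrow> nat \<Rightarrow> nat \<Rightarrow> 'a::ring_1 endo" is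
  "\<lambda>N p x y v a. if a p mod N = x then v (a(p := a p - x + y)) else 0"
  by auto

text \<open>\<open>emb\<close> commutes with all units, but its image is as noncommutative as the
  algebra of T and L.\<close>

locale matrix_units =
  fixes N :: nat and E :: "nat \<Rightarrow> nat \<Rightarrow> nat \<Rightarrow> 'r::ring_1" and emb :: "'a::ring_1 \<Rightarrow> 'r"
  assumes E_mult: "x < N \<Longrightarrow> y < N \<Longrightarrow> z < N \<Longrightarrow> w < N \<Longrightarrow>
      E p x y * E p z w = (if y = z then E p x w else 0)"
    and E_comm: "p \<noteq> p' \<Longrightarrow> E p x y * E p' z w = E p' z w * E p x y"
    and E_sum: "(\<Sum>x<N. E p x x) = 1"
    and emb_1: "emb 1 = 1"
    and emb_add: "emb (c + d) = emb c + emb d"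
    and emb_mult: "emb (c * d) = emb c * emb d"
    and emb_E: "emb c * E p x y = E p x y * emb c"
    and emb_inj: "emb c = emb d \<Longrightarrow> c = d"

lemma matrix_units_endo:
  assumes "0 < N"
  shows "matrix_units N (unit_endo N) (left_mult :: 'a::ring_1 \<Rightarrow> _)"
proof
  fix x y z w p :: nat
  assume "x < N" "y < N" "z < N" "w < N"
  have *: "(m + y - m mod N) mod N = y" if "y < N" for m y
  proof -
    have "m + y - m mod N = N * (m div N) + y"
      by (metis Nat.add_diff_assoc2 minus_mod_eq_mult_div mod_less_eq_dividend)
    then show "(m + y - m mod N) mod N = y" using that by simp
  qed
  show "unit_endo N p x y * unit_endo N p z w = (if y = z then unit_endo N p x w else (0 :: 'a endo))"
    by (auto simp: Rep_endo_inject[symmetric] times_endo.rep_eq unit_endo.rep_eq zero_endo.rep_eq fun_eq_iff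
        *[OF \<open>y < N\<close>] *[OF \<open>z < N\<close>])
next
  fix x y z w p p' :: nat
  assume "p \<noteq> p'"
  then show "unit_endo N p x y * unit_endo N p' z w = unit_endo N p' z w * (unit_endo N p x y :: 'a endo)"
    by transfer (auto simp: fun_eq_iff fun_upd_twist)
next
  fix p
  show "(\<Sum>x<N. unit_endo N p x x) = (1 :: 'a endo)"
  proof (subst Rep_endo_inject[symmetric], intro ext)
    fix v :: "(nat \<Rightarrow> nat) \<Rightarrow> 'a" and a
    have "(\<Sum>x<N. if a p mod N = x then v (a(p := a p - x + x)) else 0) = v a"
      using assms by (simp add: sum.delta' )
    then show "Rep_endo (\<Sum>x<N. unit_endo N p x x) v a = Rep_endo 1 v a"
      by (simp add: Rep_endo_sum unit_endo.rep_eq one_endo.rep_eq)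
  qed
next
  fix c d :: 'a
  assume "left_mult c = left_mult d"
  then have "Rep_endo (left_mult c) (\<lambda>_. 1) (\<lambda>_. 0) = Rep_endo (left_mult d) (\<lambda>_. 1) (\<lambda>_. 0)" by simp
  then show "c = d" by (simp add: left_mult.rep_eq)
qed (transfer; auto simp: algebra_simps fun_eq_iff)+

lemma left_mult_central:
  assumes "\<And>x. c * x = x * c"
  shows "left_mult c * X = X * left_mult c"
  using assms by transfer simp

section \<open>Sums over multi-indices\<close>

lemma sum_midx_Suc: "(\<Sum>a\<in>hd_midx N (Suc k). f a) = (\<Sum>x<N. \<Sum>a\<in>hd_midx N k. f (x # a))"
proof -
  have "hd_midx N (Suc k) = (\<lambda>(x, a). x # a) ` ({..<N} \<times> hd_midx N k)"
    by (auto simp: hd_midx_def length_Suc_conv image_iff)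
  moreover have "inj_on (\<lambda>(x, a). x # a) ({..<N} \<times> hd_midx N k)"
    by (auto simp: inj_on_def)
  ultimately show ?thesis
    by (simp add: sum.reindex sum.cartesian_product comp_def case_prod_unfold)
qed

lemma midx_0: "hd_midx N 0 = {[]}"
  by (auto simp: hd_midx_def)

lemma finite_midx [simp]: "finite (hd_midx N k)"
  by (rule finite_subset[OF _ finite_lists_length_eq[of "{..<N}" k]]) (auto simp: hd_midx_def)

lemma sum_midx_append:
  "(\<Sum>a\<in>hd_midx N (m + r). f a) = (\<Sum>a\<in>hd_midx N m. \<Sum>b\<in>hd_midx N r. f (a @ b))"
  by (induction m arbitrary: f) (simp_all add: sum_midx_Suc midx_0)

context matrix_units
begin

lemma emb_0: "emb 0 = 0"
  using emb_add[of 0 0] by simp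

lemma emb_sum: "emb (\<Sum>i\<in>I. f i) = (\<Sum>i\<in>I. emb (f i))"
  by (induction I rule: infinite_finite_induct) (simp_all add: emb_0 emb_add)

lemma emb_minus: "emb (- c) = - emb c"
  using emb_add[of c "- c"] by (simp add: emb_0 eq_neg_iff_add_eq_0 add.commute)

lemma emb_diff: "emb (c - d) = emb c - emb d"
  using emb_add[of c "- d"] by (simp add: emb_minus)

definition C :: "nat \<Rightarrow> 'r set" where
  "C p = {X. \<forall>x<N. \<forall>y<N. X * E p x y = E p x y * X}"

lemma CD: "X \<in> C p \<Longrightarrow> x < N \<Longrightarrow> y < N \<Longrightarrow> X * E p x y = E p x y * X"
  unfolding C_def by blast

lemma C_emb: "emb c \<in> C p"
  unfolding C_def by (simp add: emb_E)

lemma C_E: "p \<noteq> p' \<Longrightarrow> E p x y \<in> C p'"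
  unfolding C_def by (simp add: E_comm)

lemma C_1: "1 \<in> C p" and C_0: "0 \<in> C p"
  unfolding C_def by simp_all

lemma C_diff: "X \<in> C p \<Longrightarrow> Y \<in> C p \<Longrightarrow> X - Y \<in> C p"
  unfolding C_def by (simp add: algebra_simps)

lemma C_add: "X \<in> C p \<Longrightarrow> Y \<in> C p \<Longrightarrow> X + Y \<in> C p"
  unfolding C_def by (simp add: algebra_simps)

lemma C_mult: "X \<in> C p \<Longrightarrow> Y \<in> C p \<Longrightarrow> X * Y \<in> C p"
  unfolding C_def by (simp add: mult.assoc) (simp flip: mult.assoc)

lemma C_sum: "(\<And>i. i \<in> I \<Longrightarrow> f i \<in> C p) \<Longrightarrow> (\<Sum>i\<in>I. f i) \<in> C p"
  by (induction I rule: infinite_finite_induct) (auto intro: C_0 C_add)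

text \<open>The partial trace over factor p with the identity put back into that factor: on a unit
  \<open>E p a b\<close> the sum gives 1 if a = b and 0 otherwise.\<close>

definition tau :: "nat \<Rightarrow> 'r \<Rightarrow> 'r" where
  "tau p X = (\<Sum>x<N. \<Sum>y<N. E p y x * X * E p x y)"

lemma tau_add: "tau p (X + Y) = tau p X + tau p Y"
  by (simp add: tau_def algebra_simps sum.distrib)

lemma tau_0: "tau p 0 = 0"
  by (simp add: tau_def)

lemma tau_sum: "tau p (\<Sum>i\<in>I. f i) = (\<Sum>i\<in>I. tau p (f i))"
  by (induction I rule: infinite_finite_induct) (simp_all add: tau_0 tau_add)

lemma tau_left: "X \<in> C p \<Longrightarrow> tau p (X * Y) = X * tau p Y"
  unfolding tau_def sum_distrib_left
  by (intro sum.cong refl) (simp add: CD flip: mult.assoc)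

lemma tau_right: "Y \<in> C p \<Longrightarrow> tau p (X * Y) = tau p X * Y"
  unfolding tau_def sum_distrib_right
  by (intro sum.cong refl) (simp add: CD mult.assoc)

lemma tau_C: "tau p X \<in> C p"
  unfolding C_def
proof (clarify)
  fix z w assume zw: "z < N" "w < N"
  have "tau p X * E p z w = (\<Sum>x<N. \<Sum>y<N. if y = z then E p z x * X * E p x w else 0)"
    unfolding tau_def sum_distrib_right
    by (intro sum.cong refl) (use zw in \<open>auto simp: mult.assoc E_mult\<close>)
  also have "\<dots> = (\<Sum>x<N. E p z x * X * E p x w)"
    using zw by simp
  also have "\<dots> = (\<Sum>x<N. \<Sum>y<N. if w = y then E p z x * X * E p x w else 0)"
    using zw by simp
  also have "\<dots> = E p z w * tau p X"
    unfolding tau_def sum_distrib_left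
    by (intro sum.cong refl) (use zw in \<open>auto simp: E_mult simp flip: mult.assoc\<close>)
  finally show "tau p X * E p z w = E p z w * tau p X" .
qed

lemma tau_C': "X \<in> C p' \<Longrightarrow> tau p X \<in> C p'"
  using tau_C[of p X] unfolding tau_def
  by (cases "p = p'") (auto intro!: C_sum C_mult C_E)

lemma tau_E:
  assumes "x < N" "y < N"
  shows "tau p (E p x y) = (if x = y then 1 else 0)"
proof -
  have "tau p (E p x y) = (\<Sum>z<N. if z = x then if x = y then 1 else 0 else 0)"
    unfolding tau_def
  proof (intro sum.cong refl, goal_cases)
    case (1 z)
    have "(\<Sum>w<N. E p w z * E p x y * E p z w) = (\<Sum>w<N. if z = x \<and> x = y then E p w w else 0)"
      using assms 1 by (intro sum.cong refl) (auto simp: E_mult)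
    then show ?case by (auto simp: E_sum)
  qed
  also have "\<dots> = (if x = y then 1 else 0)"
    using assms by simp
  finally show ?thesis .
qed

lemma tau_comm:
  assumes "p \<noteq> p'"
  shows "tau p (tau p' X) = tau p' (tau p X)"
proof -
  have "tau p (tau p' X) = (\<Sum>x<N. \<Sum>y<N. tau p' (E p y x * X * E p x y))"
    unfolding tau_def[of p] using assms by (simp add: tau_left tau_right C_E)
  also have "\<dots> = tau p' (tau p X)"
    unfolding tau_def[of p] by (simp add: tau_sum)
  finally show ?thesis .
qed

section \<open>Operators on finitely many factors inside the ring\<close>

fun Ew :: "nat \<Rightarrow> nat list \<Rightarrow> nat list \<Rightarrow> 'r" where
  "Ew s (x # a) (y # b) = E s x y * Ew (Suc s) a b"
| "Ew s _ _ = 1"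

lemma Ew_C: "p < s \<or> s + length a \<le> p \<Longrightarrow> Ew s a b \<in> C p"
  by (induction s a b rule: Ew.induct) (auto intro!: C_mult C_E C_1)

lemma Ew_append: "length a = length b \<Longrightarrow> Ew s (a @ a') (b @ b') = Ew s a b * Ew (s + length a) a' b'"
  by (induction s a b rule: Ew.induct) (auto simp: mult.assoc)

lemma Ew_mult:
  assumes "a \<in> hd_midx N k" "b \<in> hd_midx N k" "c \<in> hd_midx N k" "d \<in> hd_midx N k"
  shows "Ew s a b * Ew s c d = (if b = c then Ew s a d else 0)"
  using assms
proof (induction k arbitrary: s a b c d)
  case 0
  then show ?case by (simp add: midx_0)
next
  case (Suc k)
  obtain x a' y b' z c' w d' where eq: "a = x # a'" "b = y # b'" "c = z # c'" "d = w # d'"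
    and mem: "x < N" "y < N" "z < N" "w < N" "a' \<in> hd_midx N k" "b' \<in> hd_midx N k" "c' \<in> hd_midx N k" "d' \<in> hd_midx N k"
    using Suc.prems by (auto simp: hd_midx_def length_Suc_conv)
  have "Ew (Suc s) a' b' \<in> C s" by (intro Ew_C) simp
  then have "Ew s a b * Ew s c d = (E s x y * E s z w) * (Ew (Suc s) a' b' * Ew (Suc s) c' d')"
    using mem CD[of "Ew (Suc s) a' b'" s z w] by (simp add: eq mult.assoc) (simp flip: mult.assoc)
  then show ?case using Suc.IH[OF mem(5-8)] mem by (auto simp: eq E_mult)
qed

lemma Ew_sum: "(\<Sum>a\<in>hd_midx N k. Ew s a a) = 1"
  by (induction k arbitrary: s) (simp_all add: sum_midx_Suc midx_0 E_sum flip: sum_distrib_left sum_distrib_right)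

lemma E_emb: "E p x y * (emb c * X) = emb c * (E p x y * X)"
  by (metis emb_E mult.assoc)

lemma emb_Ew: "emb c * Ew s a b = Ew s a b * emb c"
  by (induction s a b rule: Ew.induct) (simp_all add: emb_E mult.assoc, metis emb_E mult.assoc)

text \<open>Reads an operator on k factors in the positions s, ..., s + k - 1, with the identity
  elsewhere.\<close>

definition rep :: "nat \<Rightarrow> nat \<Rightarrow> 'a hd_op \<Rightarrow> 'r" where
  "rep s k X = (\<Sum>a\<in>hd_midx N k. \<Sum>b\<in>hd_midx N k. emb (X a b) * Ew s a b)"

lemma rep_cong: "hd_op_eq N k X Y \<Longrightarrow> rep s k X = rep s k Y"
  unfolding rep_def hd_op_eq_def by (intro sum.cong) auto

lemma rep_C: "p < s \<or> s + k \<le> p \<Longrightarrow> rep s k X \<in> C p"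
  unfolding rep_def by (intro C_sum C_mult C_emb Ew_C) (auto simp: hd_midx_def)

lemma rep_id: "rep s k hd_id = 1"
proof -
  have "rep s k hd_id = (\<Sum>a\<in>hd_midx N k. \<Sum>b\<in>hd_midx N k. if a = b then Ew s a a else 0)"
    unfolding rep_def hd_id_def by (intro sum.cong refl) (simp add: emb_0 emb_1)
  then show ?thesis by (simp add: Ew_sum)
qed

lemma rep_add: "rep s k (hd_add X Y) = rep s k X + rep s k Y"
  by (simp add: rep_def hd_add_def emb_add algebra_simps sum.distrib)

lemma rep_sub: "rep s k (hd_sub X Y) = rep s k X - rep s k Y"
  by (simp add: rep_def hd_sub_def emb_diff algebra_simps sum_subtractf)

lemma rep_scale: "rep s k (hd_scale c X) = emb c * rep s k X"
  by (simp add: rep_def hd_scale_def emb_mult sum_distrib_left mult.assoc)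

lemma rep_zero: "rep s k hd_zero = 0"
  by (simp add: rep_def hd_zero_def emb_0)

lemma rep_mul: "rep s k (hd_mul N k X Y) = rep s k X * rep s k Y"
proof -
  let ?I = "hd_midx N k"
  have "rep s k X * rep s k Y =
      (\<Sum>a\<in>?I. \<Sum>b\<in>?I. \<Sum>c\<in>?I. \<Sum>d\<in>?I. emb (X a b) * Ew s a b * (emb (Y c d) * Ew s c d))"
    unfolding rep_def sum_distrib_right unfolding sum_distrib_left ..
  also have "\<dots> = (\<Sum>a\<in>?I. \<Sum>b\<in>?I. \<Sum>c\<in>?I. \<Sum>d\<in>?I. if b = c then emb (X a b * Y c d) * Ew s a d else 0)"
  proof (intro sum.cong refl, goal_cases)
    case (1 a b c d)
    have "emb (X a b) * Ew s a b * (emb (Y c d) * Ew s c d) = emb (X a b * Y c d) * (Ew s a b * Ew s c d)"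
      using emb_Ew by (metis emb_mult mult.assoc)
    then show ?case using Ew_mult[OF 1] by simp
  qed
  also have "\<dots> = (\<Sum>a\<in>?I. \<Sum>b\<in>?I. \<Sum>d\<in>?I. emb (X a b * Y b d) * Ew s a d)"
  proof -
    have "(\<Sum>c\<in>?I. \<Sum>d\<in>?I. if b = c then G c d else 0) = (\<Sum>d\<in>?I. G b d)"
      if "b \<in> ?I" for b and G :: "nat list \<Rightarrow> nat list \<Rightarrow> 'r"
      using that by (subst sum.swap) simp
    then show ?thesis by - (rule sum.cong[OF refl], rule sum.cong[OF refl])
  qed
  also have "\<dots> = (\<Sum>a\<in>?I. \<Sum>d\<in>?I. \<Sum>b\<in>?I. emb (X a b * Y b d) * Ew s a d)"
    by (intro sum.cong refl sum.swap)
  also have "\<dots> = rep s k (hd_mul N k X Y)"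
    by (simp add: rep_def hd_mul_def emb_sum sum_distrib_right)
  finally show ?thesis ..
qed

lemma rep_lift_0: "rep s (m + r) (hd_lift 0 m X) = rep s m X"
proof -
  let ?I = "hd_midx N m" and ?J = "hd_midx N r"
  have "rep s (m + r) (hd_lift 0 m X) =
      (\<Sum>a\<in>?I. \<Sum>a'\<in>?J. \<Sum>b\<in>?I. \<Sum>b'\<in>?J. if a' = b' then emb (X a b) * Ew s a b * Ew (s + m) a' b' else 0)"
    unfolding rep_def sum_midx_append
    by (intro sum.cong refl) (auto simp: hd_midx_def hd_lift_def Ew_append emb_0 mult.assoc)
  also have "\<dots> = (\<Sum>a\<in>?I. \<Sum>a'\<in>?J. \<Sum>b\<in>?I. emb (X a b) * Ew s a b * Ew (s + m) a' a')"
    by simp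
  also have "\<dots> = (\<Sum>a\<in>?I. \<Sum>b\<in>?I. \<Sum>a'\<in>?J. emb (X a b) * Ew s a b * Ew (s + m) a' a')"
    by (intro sum.cong refl sum.swap)
  also have "\<dots> = rep s m X"
    by (simp add: Ew_sum rep_def flip: sum_distrib_left)
  finally show ?thesis .
qed

text \<open>The identity in the remaining factors becomes a sum of diagonal units, which is 1; only
  the shift of the position survives.\<close>

lemma rep_lift: "j + m \<le> k \<Longrightarrow> rep s k (hd_lift j m X) = rep (s + j) m X"
proof (induction j arbitrary: s k)
  case 0
  then show ?case using rep_lift_0[of s m "k - m"] by simp
next
  case (Suc j)
  then obtain k' where k: "k = Suc k'" by (cases k) auto
  let ?I = "hd_midx N k'"
  have "rep s k (hd_lift (Suc j) m X) =
      (\<Sum>x<N. \<Sum>a\<in>?I. \<Sum>y<N. \<Sum>b\<in>?I. if x = y then E s x x * (emb (hd_lift j m X a b) * Ew (Suc s) a b) else 0)"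
    unfolding rep_def k sum_midx_Suc
    by (intro sum.cong refl) (auto simp: hd_lift_def emb_0 emb_E simp flip: mult.assoc)
  also have "\<dots> = (\<Sum>x<N. \<Sum>a\<in>?I. \<Sum>b\<in>?I. E s x x * (emb (hd_lift j m X a b) * Ew (Suc s) a b))"
    by (intro sum.cong refl, subst sum.swap) simp
  also have "\<dots> = rep (Suc s) k' (hd_lift j m X)"
    by (simp add: rep_def E_sum flip: sum_distrib_left sum_distrib_right)
  finally show ?case using Suc k by simp
qed

lemma rep_foldr:
  "rep s k (foldr (\<lambda>j acc. hd_mul N k (F j) acc) js hd_id) = prod_list (map (\<lambda>j. rep s k (F j)) js)"
  by (induction js) (simp_all add: rep_id rep_mul)

primrec tau_upto :: "nat \<Rightarrow> nat \<Rightarrow> 'r \<Rightarrow> 'r" where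
  "tau_upto s 0 X = X"
| "tau_upto s (Suc c) X = tau_upto s c (tau (s + c) X)"

lemma tau_upto_sum: "tau_upto s c (\<Sum>i\<in>I. f i) = (\<Sum>i\<in>I. tau_upto s c (f i))"
  by (induction c arbitrary: f) (simp_all add: tau_sum)

lemma tau_upto_emb: "tau_upto s c (emb x * Y) = emb x * tau_upto s c Y"
  by (induction c arbitrary: Y) (simp_all add: tau_left C_emb)

lemma tau_upto_0: "tau_upto s c 0 = 0"
  by (induction c) (simp_all add: tau_0)

lemma tau_upto_Ew:
  assumes "a \<in> hd_midx N k" "b \<in> hd_midx N k"
  shows "tau_upto s k (Ew s a b) = (if a = b then 1 else 0)"
  using assms
proof (induction k arbitrary: a b)
  case (Suc k)
  have "\<exists>a' x. a = a' @ [x] \<and> a' \<in> hd_midx N k \<and> x < N" if "a \<in> hd_midx N (Suc k)" for a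
    using that by (cases a rule: rev_cases) (auto simp: hd_midx_def)
  then obtain a' x b' y where eq: "a = a' @ [x]" "b = b' @ [y]"
    and mem: "a' \<in> hd_midx N k" "b' \<in> hd_midx N k" "x < N" "y < N"
    using Suc.prems by meson
  have l: "length a' = k" "length b' = k" using mem by (auto simp: hd_midx_def)
  have "Ew s a' b' \<in> C (s + k)" using l by (intro Ew_C) simp
  then show ?case using mem l Suc.IH[OF mem(1,2)]
    by (auto simp: eq Ew_append tau_left tau_E tau_upto_0)
qed (simp add: midx_0)

lemma emb_trace: "emb (hd_trace N k X) = tau_upto s k (rep s k X)"
proof -
  have "tau_upto s k (rep s k X) = (\<Sum>a\<in>hd_midx N k. \<Sum>b\<in>hd_midx N k. if a = b then emb (X a a) else 0)"
    unfolding rep_def tau_upto_sum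
    by (intro sum.cong refl) (auto simp: tau_upto_emb tau_upto_Ew)
  then show ?thesis by (simp add: hd_trace_def emb_sum)
qed

text \<open>Matrices over the algebra are placed in factor 1; factor 0 is kept free as an auxiliary
  space.\<close>

definition mat :: "(nat \<Rightarrow> nat \<Rightarrow> 'a) \<Rightarrow> 'r" where
  "mat X = rep 1 1 (hd_vop X)"

lemma rep_1: "rep s 1 X = (\<Sum>x<N. \<Sum>y<N. emb (X [x] [y]) * E s x y)"
  by (simp add: rep_def sum_midx_Suc midx_0)

lemma rep_2: "rep s 2 X = (\<Sum>a<N. \<Sum>b<N. \<Sum>c<N. \<Sum>d<N. emb (X [a,b] [c,d]) * (E s a c * E (Suc s) b d))"
  by (simp add: rep_def sum_midx_Suc midx_0 numeral_2_eq_2)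

lemma mat_eq: "mat X = (\<Sum>x<N. \<Sum>y<N. emb (X x y) * E 1 x y)"
  unfolding mat_def rep_1 by (simp add: hd_vop_def)

lemma mat_cong: "(\<And>i j. i < N \<Longrightarrow> j < N \<Longrightarrow> X i j = Y i j) \<Longrightarrow> mat X = mat Y"
  unfolding mat_eq by (intro sum.cong) auto

lemma mat_mmul: "mat (mmul N X Y) = mat X * mat Y"
proof -
  have "mat X * mat Y = rep 1 1 (hd_mul N 1 (hd_vop X) (hd_vop Y))"
    by (simp add: mat_def rep_mul)
  also have "\<dots> = mat (mmul N X Y)"
    unfolding mat_def by (rule rep_cong)
      (auto simp: hd_op_eq_def hd_mul_def hd_vop_def mmul_def sum_midx_Suc midx_0)
  finally show ?thesis ..
qed

lemma mat_diag: "mat (\<lambda>i j. if i = j then c else 0) = emb c"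
proof -
  have "mat (\<lambda>i j. if i = j then c else 0) = (\<Sum>x<N. \<Sum>y<N. if x = y then emb c * E 1 x x else 0)"
    unfolding mat_eq by (intro sum.cong refl) (auto simp: emb_0)
  then show ?thesis by (simp add: E_sum flip: sum_distrib_left)
qed

lemma mat_diff: "mat (\<lambda>i j. X i j - Y i j) = mat X - mat Y"
  by (simp add: mat_eq emb_diff algebra_simps sum_subtractf)

lemma mat_add: "mat (\<lambda>i j. X i j + Y i j) = mat X + mat Y"
  by (simp add: mat_eq emb_add algebra_simps sum.distrib)

lemma mat_left: "mat (\<lambda>i j. c * X i j) = emb c * mat X"
  by (simp add: mat_eq emb_mult sum_distrib_left mult.assoc)

lemma mat_right: "mat (\<lambda>i j. X i j * c) = mat X * emb c"
  by (simp add: mat_eq emb_mult sum_distrib_right mult.assoc emb_E[of c])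

lemma mat_sum: "mat (\<lambda>i j. \<Sum>m\<in>I. X m i j) = (\<Sum>m\<in>I. mat (X m))"
proof -
  have z: "mat (\<lambda>i j. 0) = 0" by (simp add: mat_eq emb_0)
  show ?thesis by (induction I rule: infinite_finite_induct) (simp_all add: mat_add z)
qed

text \<open>Sandwiching between the units with indices k, i and j, k isolates one entry, and summing
  over k removes the remaining unit.\<close>

lemma mat_inj:
  assumes "mat X = mat Y" "i < N" "j < N"
  shows "X i j = Y i j"
proof -
  have "(\<Sum>k<N. E 1 k i * mat Z * E 1 j k) = emb (Z i j)" for Z
  proof -
    have "E 1 k i * mat Z * E 1 j k = emb (Z i j) * E 1 k k" if "k < N" for k
    proof -
      have "E 1 k i * mat Z * E 1 j k = (\<Sum>x<N. \<Sum>y<N. emb (Z x y) * (E 1 k i * E 1 x y * E 1 j k))"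
        unfolding mat_eq sum_distrib_left sum_distrib_right
        by (intro sum.cong refl) (simp add: mult.assoc E_emb)
      also have "\<dots> = (\<Sum>x<N. \<Sum>y<N. if i = x then if j = y then emb (Z i j) * E 1 k k else 0 else 0)"
        using that assms by (intro sum.cong refl) (auto simp: E_mult)
      also have "\<dots> = (\<Sum>x<N. if i = x then (\<Sum>y<N. if j = y then emb (Z i j) * E 1 k k else 0) else 0)"
        by (intro sum.cong) auto
      finally show ?thesis using assms by simp
    qed
    then show ?thesis by (simp add: E_sum flip: sum_distrib_left)
  qed
  then have "emb (X i j) = emb (Y i j)" using assms(1) by metis
  then show ?thesis by (rule emb_inj)
qed

end

lemma sum4_collapse:
  fixes G :: "nat \<Rightarrow> nat \<Rightarrow> nat \<Rightarrow> nat \<Rightarrow> 'b::comm_monoid_add"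
  assumes "x < N" "y < N"
  shows "(\<Sum>a<N. \<Sum>b<N. \<Sum>c<N. \<Sum>d<N. if y = a \<and> x = c then G a b c d else 0) = (\<Sum>b<N. \<Sum>d<N. G y b x d)"
proof -
  have "(\<Sum>c<N. \<Sum>d<N. if y = a \<and> x = c then G a b c d else 0) = (if y = a then \<Sum>d<N. G a b x d else 0)" for a b
  proof -
    have "(\<Sum>d<N. if y = a \<and> x = c then G a b c d else 0) = (if x = c then if y = a then \<Sum>d<N. G a b c d else 0 else 0)" for c
      by simp
    then show ?thesis using assms by simp
  qed
  moreover have "(\<Sum>b<N. if y = a then \<Sum>d<N. G a b x d else 0) = (if y = a then \<Sum>b<N. \<Sum>d<N. G a b x d else 0)" for a
    by simp
  ultimately show ?thesis using assms by simp
qed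

lemma sum4_swap:
  fixes f :: "nat \<Rightarrow> nat \<Rightarrow> nat \<Rightarrow> nat \<Rightarrow> 'b::comm_monoid_add"
  shows "(\<Sum>a<N. \<Sum>b<N. \<Sum>c<N. \<Sum>d<N. f a b c d) = (\<Sum>c<N. \<Sum>d<N. \<Sum>a<N. \<Sum>b<N. f a b c d)"
proof -
  have rot: "(\<Sum>a<N. \<Sum>b<N. \<Sum>c<N. g a b c) = (\<Sum>c<N. \<Sum>a<N. \<Sum>b<N. g a b c)"
    for g :: "nat \<Rightarrow> nat \<Rightarrow> nat \<Rightarrow> 'b"
  proof -
    have "(\<Sum>a<N. \<Sum>b<N. \<Sum>c<N. g a b c) = (\<Sum>a<N. \<Sum>c<N. \<Sum>b<N. g a b c)"
      by (intro sum.cong[OF refl] sum.swap)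
    also have "\<dots> = (\<Sum>c<N. \<Sum>a<N. \<Sum>b<N. g a b c)" by (rule sum.swap)
    finally show ?thesis .
  qed
  have "(\<Sum>a<N. \<Sum>b<N. \<Sum>c<N. \<Sum>d<N. f a b c d) = (\<Sum>c<N. \<Sum>a<N. \<Sum>b<N. \<Sum>d<N. f a b c d)"
    by (rule rot)
  also have "\<dots> = (\<Sum>c<N. \<Sum>d<N. \<Sum>a<N. \<Sum>b<N. f a b c d)"
    by (intro sum.cong[OF refl] rot)
  finally show ?thesis .
qed

lemma sum_midx_3: "(\<Sum>e\<in>hd_midx N 3. f e) = (\<Sum>x<N. \<Sum>y<N. \<Sum>z<N. f [x, y, z])"
  by (simp add: sum_midx_Suc midx_0 numeral_3_eq_3)

lemma ptr_mul_lift: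
  fixes A B :: "complex hd_op"
  assumes "b < N" "c < N"
  shows "hd_ptr N 1 (hd_mul N 3 (hd_lift 0 2 A) (hd_lift 1 2 B)) [a, c] [b, d] =
    (\<Sum>x<N. \<Sum>y<N. A [a, x] [b, y] * B [y, c] [x, d])"
  unfolding hd_ptr_def
proof (intro sum.cong refl)
  fix x assume "x \<in> {..<N}"
  have "hd_mul N 3 (hd_lift 0 2 A) (hd_lift 1 2 B) [a, x, c] [b, x, d] =
      (\<Sum>e0<N. \<Sum>e1<N. \<Sum>e2<N. if b = e0 \<and> c = e2 then A [a, x] [e0, e1] * B [e1, e2] [x, d] else 0)"
    unfolding hd_mul_def sum_midx_3
    by (intro sum.cong refl) (auto simp: numeral_2_eq_2 hd_lift_def)
  also have "\<dots> = (\<Sum>e0<N. if b = e0 then \<Sum>e1<N. A [a, x] [e0, e1] * B [e1, c] [x, d] else 0)"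
  proof (intro sum.cong refl)
    fix e0
    have "(\<Sum>e2<N. if b = e0 \<and> c = e2 then A [a, x] [e0, e1] * B [e1, e2] [x, d] else 0) =
      (if b = e0 then A [a, x] [e0, e1] * B [e1, c] [x, d] else 0)" for e1
      using assms by (cases "b = e0") simp_all
    then show "(\<Sum>e1<N. \<Sum>e2<N. if b = e0 \<and> c = e2 then A [a, x] [e0, e1] * B [e1, e2] [x, d] else 0) =
      (if b = e0 then \<Sum>e1<N. A [a, x] [e0, e1] * B [e1, c] [x, d] else 0)"
      by simp
  qed
  also have "\<dots> = (\<Sum>y<N. A [a, x] [b, y] * B [y, c] [x, d])"
    using assms by simp
  finally show "hd_mul N 3 (hd_lift 0 2 A) (hd_lift 1 2 B) (take 1 [a, c] @ x # drop 1 [a, c])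
      (take 1 [b, d] @ x # drop 1 [b, d]) = (\<Sum>y<N. A [a, x] [b, y] * B [y, c] [x, d])"
    by simp
qed

section \<open>R-matrices acting in the tower of matrix units\<close>

locale R_matrix_rep = matrix_units N E emb
  for N :: nat and E :: "nat \<Rightarrow> nat \<Rightarrow> nat \<Rightarrow> 'r::ring_1" and emb :: "'a::ring_1 \<Rightarrow> 'r" +
  fixes sc :: "complex \<Rightarrow> 'a" and n :: nat and q :: complex and R Psi :: "complex hd_op"
  assumes scal: "central_scalars sc"
    and K_central: "emb (sc c) * X = X * emb (sc c)"
    and R_mat: "is_Rmatrix N R"
    and R_skew: "is_skew_inverse N R Psi"
    and R_GL: "GLq_type N n q R"
begin

lemma sc_simps: "sc 0 = 0" "sc 1 = 1" "sc (x + y) = sc x + sc y" "sc (x * y) = sc x * sc y"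
  using scal unfolding central_scalars_def by blast+

sublocale scalar_action "\<lambda>c. emb (sc c)"
  by (unfold_locales; (rule K_central)?) (simp_all only: sc_simps emb_1 emb_add emb_mult)

notation sm (infixr "\<cdot>" 75)

lemma sc_minus: "sc (- x) = - sc x"
  using sc_simps(3)[of x "- x"] by (simp add: sc_simps eq_neg_iff_add_eq_0 add.commute)

lemma sc_diff: "sc (x - y) = sc x - sc y"
  using sc_simps(3)[of x "- y"] by (simp add: sc_minus)

lemma sc_sum: "sc (\<Sum>i\<in>I. f i) = (\<Sum>i\<in>I. sc (f i))"
  by (induction I rule: infinite_finite_induct) (simp_all add: sc_simps)

lemma cop_mul: "hd_cop sc (hd_mul N k X Y) = hd_mul N k (hd_cop sc X) (hd_cop sc Y)"
  by (simp add: hd_cop_def hd_mul_def sc_sum sc_simps)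

lemma cop_lift: "hd_cop sc (hd_lift j m X) = hd_lift j m (hd_cop sc X)"
  by (auto simp: hd_cop_def hd_lift_def sc_simps fun_eq_iff)

lemma cop_id: "hd_cop sc hd_id = hd_id"
  by (auto simp: hd_cop_def hd_id_def sc_simps fun_eq_iff)

lemma cop_zero: "hd_cop sc hd_zero = hd_zero"
  by (auto simp: hd_cop_def hd_zero_def sc_simps fun_eq_iff)

lemma cop_add: "hd_cop sc (hd_add X Y) = hd_add (hd_cop sc X) (hd_cop sc Y)"
  by (auto simp: hd_cop_def hd_add_def sc_simps fun_eq_iff)

lemma cop_sub: "hd_cop sc (hd_sub X Y) = hd_sub (hd_cop sc X) (hd_cop sc Y)"
  by (auto simp: hd_cop_def hd_sub_def sc_diff fun_eq_iff)

lemma cop_scale: "hd_cop sc (hd_scale c X) = hd_scale (sc c) (hd_cop sc X)"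
  by (auto simp: hd_cop_def hd_scale_def sc_simps fun_eq_iff)

definition crep :: "nat \<Rightarrow> nat \<Rightarrow> complex hd_op \<Rightarrow> 'r" where
  "crep s k X = rep s k (hd_cop sc X)"

lemma crep_mul: "crep s k (hd_mul N k X Y) = crep s k X * crep s k Y"
  by (simp add: crep_def cop_mul rep_mul)

lemma crep_lift: "j + m \<le> k \<Longrightarrow> crep s k (hd_lift j m X) = crep (s + j) m X"
  by (simp add: crep_def cop_lift rep_lift)

lemma crep_id: "crep s k hd_id = 1"
  by (simp add: crep_def cop_id rep_id)

lemma crep_zero: "crep s k hd_zero = 0"
  by (simp add: crep_def cop_zero rep_zero)

lemma crep_add: "crep s k (hd_add X Y) = crep s k X + crep s k Y"
  by (simp add: crep_def cop_add rep_add)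

lemma crep_sub: "crep s k (hd_sub X Y) = crep s k X - crep s k Y"
  by (simp add: crep_def cop_sub rep_sub)

lemma crep_scale: "crep s k (hd_scale c X) = c \<cdot> crep s k X"
  by (simp add: crep_def cop_scale rep_scale sm_def)

lemma crep_cong: "hd_op_eq N k X Y \<Longrightarrow> crep s k X = crep s k Y"
  unfolding crep_def by (rule rep_cong) (auto simp: hd_op_eq_def hd_cop_def)

lemma crep_C: "p < s \<or> s + k \<le> p \<Longrightarrow> crep s k X \<in> C p"
  unfolding crep_def by (rule rep_C)

lemma crep_foldr:
  "crep s k (foldr (\<lambda>j acc. hd_mul N k (F j) acc) js hd_id) = prod_list (map (\<lambda>j. crep s k (F j)) js)"
  by (induction js) (simp_all add: crep_id crep_mul)

lemma Ew_comm:
  assumes "a \<in> hd_midx N k" "b \<in> hd_midx N k" "\<And>p. s \<le> p \<Longrightarrow> p < s + k \<Longrightarrow> X \<in> C p"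
  shows "X * Ew s a b = Ew s a b * X"
  using assms
proof (induction k arbitrary: s a b)
  case (Suc k)
  then obtain x a' y b' where eq: "a = x # a'" "b = y # b'"
    and mem: "x < N" "y < N" "a' \<in> hd_midx N k" "b' \<in> hd_midx N k"
    by (auto simp: hd_midx_def length_Suc_conv)
  have "X * E s x y = E s x y * X" using Suc.prems(3)[of s] mem by (simp add: CD)
  moreover have "X * Ew (Suc s) a' b' = Ew (Suc s) a' b' * X"
    using Suc.prems(3) by (intro Suc.IH mem) auto
  ultimately show ?case unfolding eq Ew.simps by (metis mult.assoc)
qed (simp add: midx_0)

lemma crep_comm:
  assumes "\<And>p. s \<le> p \<Longrightarrow> p < s + k \<Longrightarrow> X \<in> C p"
  shows "X * crep s k Y = crep s k Y * X"
proof -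
  have "X * (emb (sc c) * Ew s a b) = emb (sc c) * Ew s a b * X"
    if "a \<in> hd_midx N k" "b \<in> hd_midx N k" for c a b
    using Ew_comm[OF that assms] K_central[of c] by (metis mult.assoc)
  then show ?thesis
    unfolding crep_def rep_def hd_cop_def sum_distrib_left sum_distrib_right
    by (intro sum.cong refl) simp
qed

abbreviation "Ri \<equiv> Rinv N R"

lemma Rinv: "hd_is_inverse N 2 R Ri"
  unfolding Rinv_def hd_inv_def using R_mat unfolding is_Rmatrix_def by (metis someI_ex)

lemma crep_R_Ri: "crep s 2 R * crep s 2 Ri = 1" and crep_Ri_R: "crep s 2 Ri * crep s 2 R = 1"
  using Rinv unfolding hd_is_inverse_def
  by (auto dest!: crep_cong[where s = s] simp: crep_mul crep_id)

lemma crep_braid: "crep s 2 R * crep (Suc s) 2 R * crep s 2 R = crep (Suc s) 2 R * crep s 2 R * crep (Suc s) 2 R"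
proof -
  have "crep s 3 (hd_mul N 3 (hd_lift 0 2 R) (hd_mul N 3 (hd_lift 1 2 R) (hd_lift 0 2 R))) =
    crep s 3 (hd_mul N 3 (hd_lift 1 2 R) (hd_mul N 3 (hd_lift 0 2 R) (hd_lift 1 2 R)))"
    using R_mat unfolding is_Rmatrix_def by (intro crep_cong) simp
  then show ?thesis by (simp add: crep_mul crep_lift mult.assoc)
qed

lemma crep_quadratic: "(crep s 2 R - q \<cdot> 1) * (crep s 2 R + inverse q \<cdot> 1) = 0"
proof -
  have "crep s 2 (hd_mul N 2 (hd_sub R (hd_scale q hd_id)) (hd_add R (hd_scale (inverse q) hd_id))) = crep s 2 hd_zero"
    using R_GL unfolding GLq_type_def by (intro crep_cong) simp
  then show ?thesis by (simp add: crep_mul crep_sub crep_add crep_scale crep_id crep_zero)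
qed

text \<open>As \<open>inverse 0\<close> is 0, the quadratic relation at q = 0 would read R^2 = 0,
  contradicting invertibility.\<close>

lemma q_nz: "q \<noteq> 0"
proof
  assume "q = 0"
  then have "crep 0 2 R * crep 0 2 R = 0" using crep_quadratic[of 0] by simp
  then have "crep 0 2 Ri * (crep 0 2 R * crep 0 2 R) * crep 0 2 Ri = 0" by simp
  then have "(crep 0 2 Ri * crep 0 2 R) * (crep 0 2 R * crep 0 2 Ri) = 0" by (simp only: mult.assoc)
  then show False by (simp add: crep_R_Ri crep_Ri_R)
qed

lemma crep_hecke: "crep s 2 R = crep s 2 Ri + (q - inverse q) \<cdot> 1"
proof -
  have "(crep s 2 R - q \<cdot> 1) * (crep s 2 R + inverse q \<cdot> 1) * crep s 2 Ri = 0"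
    unfolding crep_quadratic by simp
  moreover have "(crep s 2 R - q \<cdot> 1) * (crep s 2 R + inverse q \<cdot> 1) * crep s 2 Ri =
      (crep s 2 R - q \<cdot> 1) * (1 + inverse q \<cdot> crep s 2 Ri)"
    by (simp add: mult.assoc distrib_right crep_R_Ri sm_mult_left)
  moreover have "\<dots> = crep s 2 R + inverse q \<cdot> 1 - q \<cdot> 1 - crep s 2 Ri"
    using q_nz by (simp add: distrib_left left_diff_distrib crep_R_Ri sm_mult sm_diff)
  ultimately show ?thesis by (simp add: sm_diff_left algebra_simps)
qed

section \<open>The R-trace over one factor and its invariance\<close>

definition theta :: "nat \<Rightarrow> 'r \<Rightarrow> 'r" where
  "theta p X = tau p (crep p 1 (hd_DR N Psi) * X)"

lemma D_C: "p \<noteq> p' \<Longrightarrow> crep p 1 (hd_DR N Psi) \<in> C p'"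
  by (intro crep_C) auto

lemma theta_add: "theta p (X + Y) = theta p X + theta p Y"
  by (simp add: theta_def distrib_left tau_add)

lemma theta_sum: "theta p (\<Sum>i\<in>I. f i) = (\<Sum>i\<in>I. theta p (f i))"
  by (simp add: theta_def sum_distrib_left tau_sum)

lemma theta_left:
  assumes "X \<in> C p"
  shows "theta p (X * Y) = X * theta p Y"
proof -
  have "crep p 1 (hd_DR N Psi) * X = X * crep p 1 (hd_DR N Psi)"
    using assms by (intro crep_comm[symmetric]) (auto simp: less_Suc_eq_le)
  then have "crep p 1 (hd_DR N Psi) * (X * Y) = X * (crep p 1 (hd_DR N Psi) * Y)"
    by (metis mult.assoc)
  then show ?thesis unfolding theta_def by (simp only: tau_left[OF assms])
qed

lemma theta_right: "Y \<in> C p \<Longrightarrow> theta p (X * Y) = theta p X * Y"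
  unfolding theta_def by (simp add: tau_right flip: mult.assoc)

lemma theta_C: "theta p X \<in> C p"
  unfolding theta_def by (rule tau_C)

lemma theta_C': "X \<in> C p' \<Longrightarrow> theta p X \<in> C p'"
  using theta_C[of p X] D_C[of p p'] unfolding theta_def
  by (cases "p = p'") (auto intro!: tau_C' C_mult)

lemma theta_tau:
  assumes "p \<noteq> p'"
  shows "theta p (tau p' X) = tau p' (theta p X)"
  unfolding theta_def using tau_left[OF D_C[OF assms], of X] tau_comm[OF assms] by metis

lemma crep_2: "crep s 2 X = (\<Sum>a<N. \<Sum>b<N. \<Sum>c<N. \<Sum>d<N. X [a, b] [c, d] \<cdot> (E s a c * E (Suc s) b d))"
  by (simp add: crep_def rep_2 hd_cop_def sm_def)

lemma crep_1: "crep s 1 X = (\<Sum>x<N. \<Sum>y<N. X [x] [y] \<cdot> E s x y)"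
  unfolding crep_def rep_1 by (simp add: hd_cop_def sm_def)

lemma tau_sm: "tau p (c \<cdot> X) = c \<cdot> tau p X"
  unfolding sm_def by (intro tau_left C_emb)

lemma tau_E_crep_lower:
  assumes "x < N" "y < N"
  shows "tau p (E p x y * crep p 2 X) = (\<Sum>b<N. \<Sum>d<N. X [y, b] [x, d] \<cdot> E (Suc p) b d)"
proof -
  have "tau p (E p x y * crep p 2 X) =
     (\<Sum>a<N. \<Sum>b<N. \<Sum>c<N. \<Sum>d<N. X [a, b] [c, d] \<cdot> tau p (E p x y * E p a c * E (Suc p) b d))"
    by (simp add: crep_2 sum_distrib_left tau_sum tau_sm sm_mult mult.assoc)
  also have "\<dots> = (\<Sum>a<N. \<Sum>b<N. \<Sum>c<N. \<Sum>d<N. if y = a \<and> x = c then X [a, b] [c, d] \<cdot> E (Suc p) b d else 0)"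
    using assms by (intro sum.cong refl) (auto simp: E_mult tau_right C_E tau_E tau_0)
  also have "\<dots> = (\<Sum>b<N. \<Sum>d<N. X [y, b] [x, d] \<cdot> E (Suc p) b d)"
    using assms by (rule sum4_collapse)
  finally show ?thesis .
qed

lemma tau_E_crep_upper:
  assumes "x < N" "y < N"
  shows "tau (Suc p) (E (Suc p) x y * crep p 2 X) = (\<Sum>a<N. \<Sum>c<N. X [a, y] [c, x] \<cdot> E p a c)"
proof -
  have "tau (Suc p) (E (Suc p) x y * crep p 2 X) =
     (\<Sum>a<N. \<Sum>b<N. \<Sum>c<N. \<Sum>d<N. X [a, b] [c, d] \<cdot> tau (Suc p) (E p a c * (E (Suc p) x y * E (Suc p) b d)))"
  proof -
    have "E (Suc p) x y * (E p a c * E (Suc p) b d) = E p a c * (E (Suc p) x y * E (Suc p) b d)" for a b c d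
      by (metis E_comm mult.assoc n_not_Suc_n)
    then show ?thesis by (simp add: crep_2 sum_distrib_left tau_sum tau_sm sm_mult)
  qed
  also have "\<dots> = (\<Sum>a<N. \<Sum>b<N. \<Sum>c<N. \<Sum>d<N. if y = b \<and> x = d then X [a, b] [c, d] \<cdot> E p a c else 0)"
    using assms by (intro sum.cong refl) (auto simp: E_mult tau_left C_E tau_E tau_0)
  also have "\<dots> = (\<Sum>b<N. \<Sum>a<N. \<Sum>d<N. \<Sum>c<N. if y = b \<and> x = d then X [a, b] [c, d] \<cdot> E p a c else 0)"
    by (subst sum.swap) (intro sum.cong[OF refl] sum.swap)
  also have "\<dots> = (\<Sum>a<N. \<Sum>c<N. X [a, y] [c, x] \<cdot> E p a c)"
    using assms by (rule sum4_collapse)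
  finally show ?thesis .
qed

lemma skew1:
  assumes "a < N" "b < N" "c < N" "d < N"
  shows "(\<Sum>x<N. \<Sum>y<N. R [a, x] [b, y] * Psi [y, c] [x, d]) = (if a = d \<and> c = b then 1 else 0)"
proof -
  have "[a, c] \<in> hd_midx N 2" "[b, d] \<in> hd_midx N 2" using assms by (auto simp: hd_midx_def)
  then have "hd_ptr N 1 (hd_mul N 3 (hd_lift 0 2 R) (hd_lift 1 2 Psi)) [a, c] [b, d] = hd_flip 0 1 [a, c] [b, d]"
    using R_skew unfolding is_skew_inverse_def hd_op_eq_def by blast
  then show ?thesis using assms by (simp only: ptr_mul_lift) (simp add: hd_flip_def)
qed

lemma skew2:
  assumes "a < N" "b < N" "c < N" "d < N"
  shows "(\<Sum>x<N. \<Sum>y<N. Psi [a, x] [b, y] * R [y, c] [x, d]) = (if a = d \<and> c = b then 1 else 0)"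
proof -
  have "[a, c] \<in> hd_midx N 2" "[b, d] \<in> hd_midx N 2" using assms by (auto simp: hd_midx_def)
  then have "hd_ptr N 1 (hd_mul N 3 (hd_lift 0 2 Psi) (hd_lift 1 2 R)) [a, c] [b, d] = hd_flip 0 1 [a, c] [b, d]"
    using R_skew unfolding is_skew_inverse_def hd_op_eq_def by blast
  then show ?thesis using assms by (simp only: ptr_mul_lift) (simp add: hd_flip_def)
qed

text \<open>D is \<open>Psi\<close> traced over its second factor, so this is the contraction of R
  with \<open>Psi\<close> traced once more. By \<open>skew1\<close> the contraction is the flip, and
  the partial trace of the flip is the identity.\<close>

lemma theta_R: "theta (Suc p) (crep p 2 R) = 1"
proof -
  let ?D = "\<lambda>u v. \<Sum>x<N. Psi [u, x] [v, x]"
  have "theta (Suc p) (crep p 2 R) =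
      (\<Sum>u<N. \<Sum>v<N. ?D u v \<cdot> tau (Suc p) (E (Suc p) u v * crep p 2 R))"
    unfolding theta_def crep_1 hd_DR_def hd_ptr_def
    by (simp add: sum_distrib_right sm_mult tau_sum tau_sm)
  also have "\<dots> = (\<Sum>u<N. \<Sum>v<N. ?D u v \<cdot> (\<Sum>a<N. \<Sum>c<N. R [a, v] [c, u] \<cdot> E p a c))"
    by (intro sum.cong refl) (simp add: tau_E_crep_upper)
  also have "\<dots> = (\<Sum>u<N. \<Sum>v<N. \<Sum>a<N. \<Sum>c<N. (?D u v * R [a, v] [c, u]) \<cdot> E p a c)"
    by (simp add: sm_sum sm_sm)
  also have "\<dots> = (\<Sum>a<N. \<Sum>c<N. \<Sum>u<N. \<Sum>v<N. (?D u v * R [a, v] [c, u]) \<cdot> E p a c)"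
    by (rule sum4_swap)
  also have "\<dots> = (\<Sum>a<N. \<Sum>c<N. (if a = c then E p a a else 0))"
  proof (intro sum.cong refl)
    fix a c assume ac: "a \<in> {..<N}" "c \<in> {..<N}"
    have "(\<Sum>u<N. \<Sum>v<N. ?D u v * R [a, v] [c, u]) = (\<Sum>u<N. \<Sum>v<N. \<Sum>x<N. R [a, v] [c, u] * Psi [u, x] [v, x])"
      by (simp add: sum_distrib_left mult.commute)
    also have "\<dots> = (\<Sum>u<N. \<Sum>x<N. \<Sum>v<N. R [a, v] [c, u] * Psi [u, x] [v, x])"
      by (intro sum.cong[OF refl] sum.swap)
    also have "\<dots> = (\<Sum>x<N. \<Sum>u<N. \<Sum>v<N. R [a, v] [c, u] * Psi [u, x] [v, x])"
      by (rule sum.swap)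
    also have "\<dots> = (\<Sum>x<N. \<Sum>v<N. \<Sum>u<N. R [a, v] [c, u] * Psi [u, x] [v, x])"
      by (intro sum.cong[OF refl] sum.swap)
    also have "\<dots> = (\<Sum>x<N. if a = x then if a = c then 1 else 0 else 0)"
      using ac by (intro sum.cong refl) (auto simp: skew1)
    also have "\<dots> = (if a = c then 1 else 0)" using ac by simp
    finally show "(\<Sum>u<N. \<Sum>v<N. (?D u v * R [a, v] [c, u]) \<cdot> E p a c) = (if a = c then E p a a else 0)"
      by (simp flip: sm_sum_left)
  qed
  also have "\<dots> = 1" by (simp add: E_sum)
  finally show ?thesis .
qed

text \<open>Writing matrix units as partial traces against \<open>R\<close> reduces the invariance of the R-trace under
  conjugation to the braid relation.\<close>

lemma E_as_trace:
  assumes "x < N" "y < N"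
  shows "\<exists>Z. (\<forall>p'. p' \<noteq> p \<longrightarrow> Z \<in> C p') \<and> E (Suc p) x y = tau p (Z * crep p 2 R)"
proof -
  \<comment> \<open>By \<open>skew2\<close> the contraction of \<open>Psi\<close> with R is the
    flip; fixing two outer indices to y and x leaves a single matrix unit.\<close>
  define Z where "Z = (\<Sum>a<N. \<Sum>b<N. Psi [y, a] [x, b] \<cdot> E p a b)"
  have "tau p (Z * crep p 2 R) = (\<Sum>a<N. \<Sum>b<N. Psi [y, a] [x, b] \<cdot> (\<Sum>c<N. \<Sum>d<N. R [b, c] [a, d] \<cdot> E (Suc p) c d))"
    unfolding Z_def by (simp add: sum_distrib_right sm_mult tau_sum tau_sm tau_E_crep_lower)
  also have "\<dots> = (\<Sum>a<N. \<Sum>b<N. \<Sum>c<N. \<Sum>d<N. (Psi [y, a] [x, b] * R [b, c] [a, d]) \<cdot> E (Suc p) c d)"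
    by (simp add: sm_sum sm_sm)
  also have "\<dots> = (\<Sum>c<N. \<Sum>d<N. \<Sum>a<N. \<Sum>b<N. (Psi [y, a] [x, b] * R [b, c] [a, d]) \<cdot> E (Suc p) c d)"
    by (rule sum4_swap)
  also have "\<dots> = (\<Sum>c<N. \<Sum>d<N. (if y = d \<and> c = x then 1 else 0) \<cdot> E (Suc p) c d)"
    using assms by (intro sum.cong refl) (simp add: skew2 flip: sm_sum_left)
  also have "\<dots> = (\<Sum>c<N. if x = c then E (Suc p) x y else 0)"
  proof (intro sum.cong refl)
    fix c
    have "(if y = d \<and> c = x then 1 else 0) \<cdot> E (Suc p) c d = (if y = d then if x = c then E (Suc p) x y else 0 else 0)" for d
      by auto
    then show "(\<Sum>d<N. (if y = d \<and> c = x then 1 else 0) \<cdot> E (Suc p) c d) = (if x = c then E (Suc p) x y else 0)"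
      using assms by simp
  qed
  also have "\<dots> = E (Suc p) x y" using assms by simp
  finally have "E (Suc p) x y = tau p (Z * crep p 2 R)" by simp
  moreover have "Z \<in> C p'" if "p' \<noteq> p" for p'
    unfolding Z_def sm_def using that by (intro C_sum C_mult C_emb C_E) auto
  ultimately show ?thesis by blast
qed

text \<open>After \<open>E_as_trace\<close> the conjugation acts on R_p, and the braid relation
  turns it into a conjugation of R_(p+1) by R_p. The R-trace of R_(p+1) is 1, so the two outer
  factors cancel.\<close>

lemma theta_conj_E:
  assumes "x < N" "y < N"
  shows "theta (Suc (Suc p)) (crep (Suc p) 2 Ri * E (Suc p) x y * crep (Suc p) 2 R) = theta (Suc p) (E (Suc p) x y)"
proof -
  obtain Z where Z: "\<And>p'. p' \<noteq> p \<Longrightarrow> Z \<in> C p'" and EZ: "E (Suc p) x y = tau p (Z * crep p 2 R)"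
    using E_as_trace[OF assms] by blast
  let ?R = "crep p 2 R" and ?R' = "crep (Suc p) 2 R" and ?S = "crep p 2 Ri" and ?S' = "crep (Suc p) 2 Ri"
  have ZS: "Z * ?S' = ?S' * Z" by (intro crep_comm Z) auto
  have br: "?S' * ?R * ?R' = ?R * ?R' * ?S"
  proof -
    have "?S' * ?R * ?R' = ?S' * (?R * ?R' * ?R) * ?S" by (simp add: mult.assoc crep_R_Ri)
    also have "\<dots> = ?S' * ?R' * ?R * ?R' * ?S" unfolding crep_braid by (simp only: mult.assoc)
    finally show ?thesis by (simp add: crep_Ri_R)
  qed
  have "?S' * E (Suc p) x y * ?R' = tau p (?S' * (Z * ?R) * ?R')"
    unfolding EZ by (simp add: tau_left tau_right crep_C)
  also have "?S' * (Z * ?R) * ?R' = Z * (?R * ?R' * ?S)"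
    unfolding br[symmetric] by (simp only: ZS flip: mult.assoc)
  finally have "theta (Suc (Suc p)) (?S' * E (Suc p) x y * ?R') = tau p (theta (Suc (Suc p)) (Z * (?R * ?R' * ?S)))"
    by (simp add: theta_tau)
  also have "theta (Suc (Suc p)) (Z * (?R * ?R' * ?S)) = Z * (?R * theta (Suc (Suc p)) ?R' * ?S)"
    using Z by (simp add: theta_left theta_right crep_C mult.assoc)
  also have "\<dots> = Z" by (simp add: theta_R crep_R_Ri)
  also have "tau p Z = theta (Suc p) (E (Suc p) x y)"
    unfolding EZ using Z by (simp add: theta_tau theta_left theta_R)
  finally show ?thesis .
qed

text \<open>Each summand is X cut by two diagonal units. The coefficients commute with factor p,
  which extends statements about units to all elements.\<close>

lemma E_expand: "X = (\<Sum>x<N. \<Sum>y<N. tau p (X * E p y x) * E p x y)"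
proof -
  have "tau p (X * E p y x) * E p x y = E p x x * X * E p y y" if xy: "x < N" "y < N" for x y
  proof -
    have "tau p (X * E p y x) * E p x y = (\<Sum>u<N. \<Sum>v<N. if x = u then if x = v then E p x x * X * E p y y else 0 else 0)"
      unfolding tau_def sum_distrib_right
      by (intro sum.cong refl) (use xy in \<open>auto simp: E_mult mult.assoc\<close>)
    also have "\<dots> = (\<Sum>u<N. if x = u then \<Sum>v<N. if x = v then E p x x * X * E p y y else 0 else 0)"
      by (intro sum.cong refl) auto
    finally show ?thesis using xy by simp
  qed
  then have "(\<Sum>x<N. \<Sum>y<N. tau p (X * E p y x) * E p x y) = (\<Sum>x<N. E p x x) * X * (\<Sum>y<N. E p y y)"
    by (simp add: sum_distrib_left sum_distrib_right) (rule sum.swap)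
  then show ?thesis by (simp add: E_sum)
qed

lemma theta_conj:
  assumes "X \<in> C (Suc (Suc p))"
  shows "theta (Suc (Suc p)) (crep (Suc p) 2 Ri * X * crep (Suc p) 2 R) = theta (Suc p) X"
proof -
  let ?c = "\<lambda>x y. tau (Suc p) (X * E (Suc p) y x)"
  have c: "?c x y \<in> C (Suc p)" "?c x y \<in> C (Suc (Suc p))" for x y
    using assms by (auto intro!: tau_C tau_C' C_mult C_E)
  have cS: "crep (Suc p) 2 Ri * ?c x y = ?c x y * crep (Suc p) 2 Ri" for x y
    using c by (intro crep_comm[symmetric]) (auto simp: numeral_2_eq_2 less_Suc_eq le_Suc_eq)
  have "theta (Suc (Suc p)) (crep (Suc p) 2 Ri * X * crep (Suc p) 2 R) =
    theta (Suc (Suc p)) (\<Sum>x<N. \<Sum>y<N. ?c x y * (crep (Suc p) 2 Ri * E (Suc p) x y * crep (Suc p) 2 R))"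
    by (subst (1) E_expand[of X "Suc p"]) (simp add: sum_distrib_left sum_distrib_right cS flip: mult.assoc)
  also have "\<dots> = (\<Sum>x<N. \<Sum>y<N. ?c x y * theta (Suc p) (E (Suc p) x y))"
    using c by (simp add: theta_sum theta_left theta_conj_E)
  also have "\<dots> = theta (Suc p) (\<Sum>x<N. \<Sum>y<N. ?c x y * E (Suc p) x y)"
    using c by (simp add: theta_sum theta_left)
  finally show ?thesis using E_expand[of X "Suc p"] by simp
qed

text \<open>The shift by one keeps the auxiliary factor of \<open>E_as_trace\<close> to the left of all factors in use.\<close>

sublocale tower: hecke_tower "\<lambda>c. emb (sc c)" q n "\<lambda>i. crep (Suc i) 2 R" "\<lambda>i. crep (Suc i) 2 Ri"
  "\<lambda>p. C (Suc p)" "\<lambda>p. theta (Suc p)"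
proof unfold_locales
  show "qnum q i \<noteq> 0" if "2 \<le> i" "i \<le> n" for i
    using that R_GL unfolding GLq_type_def by blast
  show "crep (Suc i) 2 R = crep (Suc i) 2 Ri + emb (sc (q - inverse q))" for i
    using crep_hecke[of "Suc i"] by (simp add: sm_def)
  show "crep (Suc i) 2 R * crep (Suc j) 2 R = crep (Suc j) 2 R * crep (Suc i) 2 R" if "Suc i < j" for i j
    using that by (intro crep_comm crep_C) auto
qed (auto simp: q_nz crep_R_Ri crep_Ri_R crep_braid theta_add theta_left theta_right theta_C theta_C'
  theta_R theta_conj C_1 C_emb C_diff C_mult intro!: crep_C)

end

section \<open>Lagrange interpolation at commuting nodes\<close>

text \<open>In the application x is L, the nodes are q \<mu>_\<alpha> and d holds the inverse
  differences. They lie in a noncommutative ring, so commutativity is confined to a subset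
  B.\<close>

locale commuting_nodes =
  fixes B :: "'r::ring_1 set" and x :: 'r and y :: "nat \<Rightarrow> 'r" and d :: "nat \<Rightarrow> nat \<Rightarrow> 'r" and n :: nat
  assumes comm: "a \<in> B \<Longrightarrow> b \<in> B \<Longrightarrow> a * b = b * a"
    and B_1: "1 \<in> B"
    and B_diff: "a \<in> B \<Longrightarrow> b \<in> B \<Longrightarrow> a - b \<in> B"
    and B_mult: "a \<in> B \<Longrightarrow> b \<in> B \<Longrightarrow> a * b \<in> B"
    and x_B: "x \<in> B"
    and y_B: "\<alpha> < n \<Longrightarrow> y \<alpha> \<in> B"
    and d_B: "\<alpha> < n \<Longrightarrow> \<beta> < n \<Longrightarrow> \<alpha> \<noteq> \<beta> \<Longrightarrow> d \<alpha> \<beta> \<in> B"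
    and d_inv: "\<alpha> < n \<Longrightarrow> \<beta> < n \<Longrightarrow> \<alpha> \<noteq> \<beta> \<Longrightarrow> d \<alpha> \<beta> * (y \<alpha> - y \<beta>) = 1"
begin

definition P :: "nat \<Rightarrow> nat list \<Rightarrow> 'r" where
  "P \<alpha> xs = prod_list (map (\<lambda>\<beta>. (x - y \<beta>) * d \<alpha> \<beta>) (filter (\<lambda>\<beta>. \<beta> \<noteq> \<alpha>) xs))"

lemma P_Cons: "P \<alpha> (\<beta> # xs) = (if \<beta> = \<alpha> then P \<alpha> xs else (x - y \<beta>) * d \<alpha> \<beta> * P \<alpha> xs)"
  by (simp add: P_def)

lemma prod_list_B: "(\<And>i. i \<in> set xs \<Longrightarrow> f i \<in> B) \<Longrightarrow> prod_list (map f xs) \<in> B"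
  by (induction xs) (auto intro: B_1 B_mult)

lemma P_B: "\<alpha> < n \<Longrightarrow> set xs \<subseteq> {..<n} \<Longrightarrow> P \<alpha> xs \<in> B"
  unfolding P_def by (intro prod_list_B B_mult B_diff x_B y_B d_B) auto

lemma d_anti:
  assumes "\<alpha> < n" "\<beta> < n" "\<alpha> \<noteq> \<beta>"
  shows "d \<beta> \<alpha> = - d \<alpha> \<beta>"
proof -
  have "d \<beta> \<alpha> = d \<beta> \<alpha> * (d \<alpha> \<beta> * (y \<alpha> - y \<beta>))" using assms d_inv by simp
  also have "\<dots> = d \<beta> \<alpha> * ((y \<alpha> - y \<beta>) * d \<alpha> \<beta>)"
    using assms by (subst comm[of "d \<alpha> \<beta>"]) (auto intro: d_B y_B B_diff)
  also have "\<dots> = - (d \<beta> \<alpha> * (y \<beta> - y \<alpha>) * d \<alpha> \<beta>)" by (simp add: algebra_simps)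
  also have "\<dots> = - d \<alpha> \<beta>" using assms d_inv[of \<beta> \<alpha>] by simp
  finally show ?thesis .
qed

text \<open>The core is the partial fraction identity \<open>AA\<close> for the difference of two
  inverse differences.\<close>

lemma neville_term:
  assumes "a < n" "b < n" "\<alpha> < n" "a \<noteq> b" "\<alpha> \<noteq> a" "\<alpha> \<noteq> b"
  shows "d a b * ((x - y b) * ((x - y a) * d \<alpha> a) - (x - y a) * ((x - y b) * d \<alpha> b)) =
    (x - y a) * d \<alpha> a * ((x - y b) * d \<alpha> b)"
proof -
  define X Y D A A' where "X = x - y a" and "Y = x - y b" and "D = d a b" and "A = d \<alpha> a" and "A' = d \<alpha> b"
  have mem: "X \<in> B" "Y \<in> B" "D \<in> B" "A \<in> B" "A' \<in> B" "y a - y b \<in> B" "y \<alpha> - y a \<in> B" "y \<alpha> - y b \<in> B"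
    using assms unfolding X_def Y_def D_def A_def A'_def by (auto intro!: B_diff x_B y_B d_B)
  have AA: "A - A' = A * A' * (y a - y b)"
  proof -
    have "A * A' * (y \<alpha> - y a) = A' * (A * (y \<alpha> - y a))"
      using comm[OF mem(4,5)] by (simp only: mult.assoc[symmetric])
    also have "\<dots> = A'" using d_inv[of \<alpha> a] assms unfolding A_def by simp
    finally have "A * A' * (y a - y b) = A * (A' * (y \<alpha> - y b)) - A'"
      by (simp add: algebra_simps)
    also have "A' * (y \<alpha> - y b) = 1" using d_inv[of \<alpha> b] assms unfolding A'_def by simp
    finally show ?thesis by simp
  qed
  have "D * (Y * (X * A) - X * (Y * A')) = D * (X * Y * (A - A'))"
    using comm[OF mem(1,2)] by (simp add: algebra_simps) (metis mult.assoc)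
  also have "\<dots> = D * (X * Y * A * A') * (y a - y b)" unfolding AA by (simp only: mult.assoc)
  also have "D * (X * Y * A * A') = (X * Y * A * A') * D"
    using mem by (intro comm B_mult)
  also have "(X * Y * A * A') * D * (y a - y b) = X * (Y * A) * A'"
    using d_inv[of a b] assms unfolding D_def by (simp add: mult.assoc)
  also have "Y * A = A * Y" using mem by (intro comm)
  finally show ?thesis unfolding X_def Y_def D_def A_def A'_def by (simp only: mult.assoc)
qed

text \<open>By Neville's recursion on the first two nodes.\<close>

lemma sum_P: "distinct xs \<Longrightarrow> xs \<noteq> [] \<Longrightarrow> set xs \<subseteq> {..<n} \<Longrightarrow> (\<Sum>\<alpha>\<in>set xs. P \<alpha> xs) = 1"
proof (induction "length xs" arbitrary: xs rule: less_induct)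
  case less
  obtain a zs where xs: "xs = a # zs" using less.prems by (cases xs) auto
  show ?case
  proof (cases zs)
    case Nil
    then show ?thesis by (simp add: xs P_def)
  next
    case (Cons b ys)
    have ab: "a < n" "b < n" "a \<noteq> b" "a \<notin> set ys" "b \<notin> set ys" "set ys \<subseteq> {..<n}" "distinct ys"
      using less.prems by (auto simp: xs Cons)
    have 1: "P a (a # ys) + (\<Sum>\<alpha>\<in>set ys. P \<alpha> (a # ys)) = 1"
      using less.hyps[of "a # ys"] ab by (simp add: xs Cons)
    have 2: "P b (b # ys) + (\<Sum>\<alpha>\<in>set ys. P \<alpha> (b # ys)) = 1"
      using less.hyps[of "b # ys"] ab by (simp add: xs Cons)
    have mem: "d a b \<in> B" "x - y a \<in> B" "x - y b \<in> B" using ab by (auto intro!: d_B B_diff x_B y_B)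
    have ta: "P a xs = d a b * ((x - y b) * P a (a # ys))"
      using ab comm[OF mem(1,3)] by (simp add: xs Cons P_Cons mult.assoc[symmetric])
    have tb: "P b xs = - (d a b * ((x - y a) * P b (b # ys)))"
      using ab comm[OF mem(1,2)] d_anti[of a b] by (simp add: xs Cons P_Cons mult.assoc[symmetric])
    have t: "P \<alpha> xs = d a b * ((x - y b) * P \<alpha> (a # ys)) - d a b * ((x - y a) * P \<alpha> (b # ys))"
      if "\<alpha> \<in> set ys" for \<alpha>
    proof -
      have \<alpha>: "\<alpha> < n" "\<alpha> \<noteq> a" "\<alpha> \<noteq> b" using that ab by auto
      have "P \<alpha> xs = (x - y a) * d \<alpha> a * ((x - y b) * d \<alpha> b) * P \<alpha> ys"
        using \<alpha> by (simp add: xs Cons P_Cons mult.assoc)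
      also have "\<dots> = d a b * ((x - y b) * ((x - y a) * d \<alpha> a) - (x - y a) * ((x - y b) * d \<alpha> b)) * P \<alpha> ys"
        using neville_term[of a b \<alpha>] \<alpha> ab by simp
      also have "\<dots> = d a b * ((x - y b) * ((x - y a) * d \<alpha> a * P \<alpha> ys)) -
          d a b * ((x - y a) * ((x - y b) * d \<alpha> b * P \<alpha> ys))"
        by (simp only: right_diff_distrib[of "d a b"] left_diff_distrib[of _ _ "P \<alpha> ys"] mult.assoc)
      also have "\<dots> = d a b * ((x - y b) * P \<alpha> (a # ys)) - d a b * ((x - y a) * P \<alpha> (b # ys))"
        using \<alpha> by (simp only: P_Cons) simp
      finally show ?thesis .
    qed
    have "(\<Sum>\<alpha>\<in>set xs. P \<alpha> xs) = P a xs + (P b xs + (\<Sum>\<alpha>\<in>set ys. P \<alpha> xs))"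
      using ab by (simp add: xs Cons)
    \<comment> \<open>Both brackets are 1 by induction, and d_ab ((x - y_b) - (x - y_a)) = d_ab (y_a
      - y_b) = 1.\<close>
    also have "\<dots> = d a b * ((x - y b) * (P a (a # ys) + (\<Sum>\<alpha>\<in>set ys. P \<alpha> (a # ys)))) -
        d a b * ((x - y a) * (P b (b # ys) + (\<Sum>\<alpha>\<in>set ys. P \<alpha> (b # ys))))"
      by (simp add: ta tb t distrib_left sum_distrib_left sum_subtractf)
    also have "\<dots> = d a b * (y a - y b)"
      unfolding 1 2 by (simp add: algebra_simps)
    also have "\<dots> = 1" using ab by (intro d_inv) auto
    finally show ?thesis .
  qed
qed

lemma prod_split:
  assumes "\<And>i. i \<in> set xs \<Longrightarrow> f i \<in> B" "\<And>i. i \<in> set xs \<Longrightarrow> g i \<in> B"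
  shows "prod_list (map (\<lambda>i. f i * g i) xs) = prod_list (map g xs) * prod_list (map f xs)"
  using assms
proof (induction xs)
  case (Cons i xs)
  have G: "prod_list (map g xs) \<in> B" using Cons.prems by (intro prod_list_B) auto
  have "prod_list (map (\<lambda>i. f i * g i) (i # xs)) = f i * (g i * prod_list (map g xs)) * prod_list (map f xs)"
    using Cons by (simp add: mult.assoc)
  also have "f i * (g i * prod_list (map g xs)) = (g i * prod_list (map g xs)) * f i"
    using Cons.prems G by (intro comm B_mult) auto
  finally show ?case by (simp add: mult.assoc)
qed simp

lemma prod_remove:
  assumes "\<And>i. i \<in> set xs \<Longrightarrow> f i \<in> B" "distinct xs" "a \<in> set xs"
  shows "f a * prod_list (map f (filter (\<lambda>i. i \<noteq> a) xs)) = prod_list (map f xs)"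
  using assms
proof (induction xs)
  case (Cons i xs)
  show ?case
  proof (cases "i = a")
    case True
    then have "filter (\<lambda>i. i \<noteq> a) xs = xs" using Cons.prems by (intro filter_True) auto
    then show ?thesis using True by simp
  next
    case False
    then have IH: "f a * prod_list (map f (filter (\<lambda>i. i \<noteq> a) xs)) = prod_list (map f xs)"
      using Cons by auto
    have "f a * f i = f i * f a" using Cons.prems False by (intro comm) auto
    then show ?thesis using False IH by simp (metis mult.assoc)
  qed
qed simp

text \<open>Here \<open>\<tau>\<close> will be T. The product over all nodes is known to vanish only
  on it, so the P are orthogonal idempotents only when applied to it.\<close>

context
  fixes xs :: "nat list" and \<tau> :: 'r
  assumes xs: "distinct xs" "xs \<noteq> []" "set xs \<subseteq> {..<n}"
    and ch: "prod_list (map (\<lambda>\<beta>. x - y \<beta>) xs) * \<tau> = 0"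
begin

lemma node_B: "\<beta> \<in> set xs \<Longrightarrow> x - y \<beta> \<in> B"
  using xs by (auto intro!: B_diff x_B y_B)

lemma P_split:
  assumes "\<alpha> \<in> set xs"
  shows "\<exists>Z\<in>B. P \<alpha> xs = Z * prod_list (map (\<lambda>\<beta>. x - y \<beta>) (filter (\<lambda>\<beta>. \<beta> \<noteq> \<alpha>) xs))"
proof -
  let ?f = "filter (\<lambda>\<beta>. \<beta> \<noteq> \<alpha>) xs"
  have d: "d \<alpha> \<beta> \<in> B" if "\<beta> \<in> set ?f" for \<beta> using that assms xs by (intro d_B) auto
  have "P \<alpha> xs = prod_list (map (d \<alpha>) ?f) * prod_list (map (\<lambda>\<beta>. x - y \<beta>) ?f)"
    unfolding P_def by (rule prod_split) (use d node_B in auto)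
  moreover have "prod_list (map (d \<alpha>) ?f) \<in> B" using d by (rule prod_list_B)
  ultimately show ?thesis by blast
qed

lemma node_P:
  assumes "\<alpha> \<in> set xs"
  shows "(x - y \<alpha>) * (P \<alpha> xs * \<tau>) = 0"
proof -
  obtain Z where Z: "Z \<in> B" "P \<alpha> xs = Z * prod_list (map (\<lambda>\<beta>. x - y \<beta>) (filter (\<lambda>\<beta>. \<beta> \<noteq> \<alpha>) xs))"
    using P_split[OF assms] by blast
  have "(x - y \<alpha>) * (P \<alpha> xs * \<tau>) = ((x - y \<alpha>) * Z) * prod_list (map (\<lambda>\<beta>. x - y \<beta>) (filter (\<lambda>\<beta>. \<beta> \<noteq> \<alpha>) xs)) * \<tau>"
    unfolding Z(2) by (simp only: mult.assoc)
  also have "(x - y \<alpha>) * Z = Z * (x - y \<alpha>)" using Z(1) assms by (intro comm node_B)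
  also have "Z * (x - y \<alpha>) * prod_list (map (\<lambda>\<beta>. x - y \<beta>) (filter (\<lambda>\<beta>. \<beta> \<noteq> \<alpha>) xs)) * \<tau> =
      Z * (prod_list (map (\<lambda>\<beta>. x - y \<beta>) xs) * \<tau>)"
    by (simp only: mult.assoc prod_remove[of xs "\<lambda>\<beta>. x - y \<beta>", OF node_B xs(1) assms, symmetric])
  finally show ?thesis using ch by simp
qed

text \<open>\<open>P \<beta> xs\<close> contains the factor x - y_\<alpha>, which kills
  \<open>P \<alpha> xs * \<tau>\<close>. Idempotence then follows because the P add up to 1.\<close>

lemma P_orthogonal:
  assumes "\<alpha> \<in> set xs" "\<beta> \<in> set xs" "\<alpha> \<noteq> \<beta>"
  shows "P \<beta> xs * (P \<alpha> xs * \<tau>) = 0"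
proof -
  let ?f = "filter (\<lambda>i. i \<noteq> \<beta>) xs"
  let ?g = "\<lambda>i. x - y i"
  obtain Z where Z: "Z \<in> B" "P \<beta> xs = Z * prod_list (map ?g ?f)"
    using P_split[OF assms(2)] by blast
  let ?W = "prod_list (map ?g (filter (\<lambda>i. i \<noteq> \<alpha>) ?f))"
  have W: "?W \<in> B" by (intro prod_list_B node_B) auto
  have "prod_list (map ?g ?f) = ?g \<alpha> * ?W"
    using assms xs by (intro prod_remove[symmetric] node_B) auto
  also have "\<dots> = ?W * ?g \<alpha>" using W assms by (intro comm node_B)
  finally have "P \<beta> xs * (P \<alpha> xs * \<tau>) = Z * ?W * (?g \<alpha> * (P \<alpha> xs * \<tau>))"
    unfolding Z(2) by (simp only: mult.assoc)
  then show ?thesis using node_P[OF assms(1)] by simp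
qed

lemma P_idem:
  assumes "\<alpha> \<in> set xs"
  shows "P \<alpha> xs * (P \<alpha> xs * \<tau>) = P \<alpha> xs * \<tau>"
proof -
  have "P \<alpha> xs * \<tau> = (\<Sum>\<beta>\<in>set xs. P \<beta> xs) * (P \<alpha> xs * \<tau>)"
    using sum_P[OF xs] by simp
  also have "\<dots> = (\<Sum>\<beta>\<in>set xs. if \<beta> = \<alpha> then P \<alpha> xs * (P \<alpha> xs * \<tau>) else 0)"
    unfolding sum_distrib_right by (intro sum.cong refl) (use assms P_orthogonal in auto)
  also have "\<dots> = P \<alpha> xs * (P \<alpha> xs * \<tau>)" using assms by simp
  finally show ?thesis by simp
qed

end

end

section \<open>Recursion for the elementary symmetric polynomials\<close>

lemma esym_0: "esym n \<mu> 0 = 1"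
proof -
  have "{S. S \<subseteq> {..<n} \<and> card S = 0} = {{}}" by (auto dest: finite_subset)
  then show ?thesis by (simp add: esym_def)
qed

lemma esym_gt: "n < i \<Longrightarrow> esym n \<mu> i = 0"
proof -
  assume "n < i"
  then have "{S. S \<subseteq> {..<n} \<and> card S = i} = {}"
    by (metis (mono_tags, lifting) Collect_empty_eq card_lessThan card_mono finite_lessThan not_le)
  then show ?thesis unfolding esym_def by (simp only: sum.empty)
qed

text \<open>Subsets are split by membership of n, the largest index, which stands last in the sorted
  list; hence the new factor appears on the right.\<close>

lemma esym_Suc: "esym (Suc n) \<mu> (Suc i) = esym n \<mu> (Suc i) + esym n \<mu> i * \<mu> n"
proof -
  let ?F = "\<lambda>n i. {S. S \<subseteq> {..<n} \<and> card S = i}"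
  let ?p = "\<lambda>S. prod_list (map \<mu> (sorted_list_of_set S))"
  have fin: "finite S" "n \<notin> S" if "S \<subseteq> {..<n}" for S
    using that finite_subset by auto
  have F: "?F (Suc n) (Suc i) = ?F n (Suc i) \<union> insert n ` ?F n i"
  proof (intro equalityI subsetI)
    fix S assume S: "S \<in> ?F (Suc n) (Suc i)"
    show "S \<in> ?F n (Suc i) \<union> insert n ` ?F n i"
    proof (cases "n \<in> S")
      case True
      have "S - {n} \<in> ?F n i" using S True by (auto simp: less_Suc_eq)
      moreover have "S = insert n (S - {n})" using True by auto
      ultimately show ?thesis by blast
    next
      case False
      then show ?thesis using S by (auto simp: less_Suc_eq)
    qed
  next
    fix S assume "S \<in> ?F n (Suc i) \<union> insert n ` ?F n i"
    then show "S \<in> ?F (Suc n) (Suc i)" using fin by (auto simp: less_Suc_eq)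
  qed
  have inj: "inj_on (insert n) (?F n i)"
  proof (rule inj_onI)
    fix S S' assume "S \<in> ?F n i" "S' \<in> ?F n i" "insert n S = insert n S'"
    moreover from this have "n \<notin> S" "n \<notin> S'" using fin by auto
    ultimately show "S = S'" by (simp add: insert_ident)
  qed
  have p: "?p (insert n S) = ?p S * \<mu> n" if "S \<in> ?F n i" for S
  proof -
    have S: "finite S" "S \<subseteq> {..<n}" using that fin by auto
    have "sorted_list_of_set (insert n S) = sorted_list_of_set S @ [n]"
    proof -
      have "sorted (sorted_list_of_set S @ [n])" "distinct (sorted_list_of_set S @ [n])"
        "set (sorted_list_of_set S @ [n]) = insert n S"
        using S by (auto simp: sorted_append)
      then show ?thesis by (metis sorted_list_of_set.idem_if_sorted_distinct)
    qed
    then show ?thesis by simp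
  qed
  have finF: "finite (?F m k)" for m k :: nat
    by (rule finite_subset[of _ "Pow {..<m}"]) auto
  have "sum ?p (?F (Suc n) (Suc i)) = sum ?p (?F n (Suc i)) + sum ?p (insert n ` ?F n i)"
    unfolding F using fin finF by (intro sum.union_disjoint) auto
  also have "sum ?p (insert n ` ?F n i) = (\<Sum>S\<in>?F n i. ?p S * \<mu> n)"
    unfolding sum.reindex[OF inj] comp_def by (rule sum.cong[OF refl p])
  finally show ?thesis unfolding esym_def sum_distrib_right .
qed

section \<open>The Heisenberg double\<close>

context R_matrix_rep
begin

section \<open>The abstract objects of the tower are the given ones; its factor s is position s +
  1\<close>

lemma crep_asym: "crep (Suc s) k (asym N q R k) = tower.Asy s k"
proof (induction k rule: induct_nat_012)
  case (ge2 k)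
  then show ?case
    by (simp add: Let_def crep_scale crep_mul crep_sub crep_id crep_lift)
qed (simp_all add: crep_id)

lemma rep_Lbar:
  "Suc j \<le> k \<Longrightarrow> rep (Suc s) k (Lbar sc N R L k (Suc j)) = tower.Lb (rep (Suc s) 1 (hd_vop L)) s j"
proof (induction j)
  case 0
  then show ?case by (simp add: rep_lift)
next
  case (Suc j)
  then show ?case by (simp add: rep_mul rep_lift mult.assoc flip: crep_def)
qed

lemma rep_LL:
  "rep (Suc s) k (foldr (\<lambda>j acc. hd_mul N k (Lbar sc N R L k j) acc) [1..<Suc k] hd_id) =
    tower.LL (rep (Suc s) 1 (hd_vop L)) s k"
proof -
  have "m \<le> k \<Longrightarrow> prod_list (map (\<lambda>j. rep (Suc s) k (Lbar sc N R L k j)) [1..<Suc m]) =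
    tower.LL (rep (Suc s) 1 (hd_vop L)) s m" for m
  proof (induction m)
    case (Suc m)
    then show ?case using rep_Lbar[of m k s L] by simp
  qed simp
  then show ?thesis unfolding rep_foldr by blast
qed

text \<open>The copies of D in the earlier factors commute with the last one, so they pass its trace
  and can be collected into one product as in \<open>hd_Dprod\<close>.\<close>

lemma tower_Th:
  "tower.Th s c X = tau_upto (Suc s) c (prod_list (map (\<lambda>j. crep (Suc s + j) 1 (hd_DR N Psi)) [0..<c]) * X)"
proof (induction c arbitrary: X)
  case (Suc c)
  let ?D = "\<lambda>j. crep (Suc s + j) 1 (hd_DR N Psi)"
  have "prod_list (map ?D [0..<m]) \<in> C (Suc s + c)" if "m \<le> c" for m
    using that by (induction m) (auto intro!: C_1 C_mult crep_C)
  then have mem: "prod_list (map ?D [0..<c]) \<in> C (Suc s + c)" by simp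
  have step: "tower.Th s (Suc c) X = tau_upto (Suc s) c (prod_list (map ?D [0..<c]) * theta (Suc (s + c)) X)"
    using Suc[of "theta (Suc (s + c)) X"] by simp
  show ?case unfolding step using mem by (simp add: theta_def tau_left mult.assoc)
qed simp

lemma emb_rtrace: "emb (hd_rtrace sc N Psi k X) = tower.Th s k (rep (Suc s) k X)"
proof -
  have "crep (Suc s) k (hd_Dprod N Psi k) =
      prod_list (map (\<lambda>j. crep (Suc s) k (hd_lift j 1 (hd_DR N Psi))) [0..<k])"
    unfolding hd_Dprod_def by (rule crep_foldr)
  also have "map (\<lambda>j. crep (Suc s) k (hd_lift j 1 (hd_DR N Psi))) [0..<k] =
      map (\<lambda>j. crep (Suc s + j) 1 (hd_DR N Psi)) [0..<k]"
    by (intro map_cong refl crep_lift) auto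
  finally show ?thesis
    unfolding hd_rtrace_def emb_trace[of k _ "Suc s"] rep_mul tower_Th by (simp add: crep_def)
qed

text \<open>The offset s is free because a full trace carries no position; the cases s = 0 and s = 1
  yield the hypothesis of \<open>T_a\<close>.\<close>

lemma emb_acoef:
  "emb (acoef sc N q R Psi L k) =
    tower.Th s k (tower.Asy s k * tower.LL (rep (Suc s) 1 (hd_vop L)) s k)"
proof (cases "k = 0")
  case True
  then show ?thesis by (simp add: acoef_def emb_1)
next
  case False
  then show ?thesis
    using crep_asym[of s k] rep_LL[of s k L]
    by (simp add: acoef_def emb_rtrace[of k _ s] rep_mul crep_def del: upt_Suc)
qed

lemma heisenberg:
  assumes "HD_rel sc N R \<gamma> T L"
  shows "heisenberg_tower (\<lambda>c. emb (sc c)) q n (\<lambda>i. crep (Suc i) 2 R) (\<lambda>i. crep (Suc i) 2 Ri)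
    (\<lambda>p. C (Suc p)) (\<lambda>p. theta (Suc p)) (mat L) (rep 2 1 (hd_vop L)) (mat T) (\<gamma>\<^sup>2)"
proof unfold_locales
  let ?R = "hd_cop sc R" and ?T1 = "hd_lift 0 1 (hd_vop T)" and ?L1 = "hd_lift 0 1 (hd_vop L)"
    and ?L2 = "hd_lift 1 1 (hd_vop L)"
  have HD: "hd_op_eq N 2 (hd_mul N 2 ?L1 (hd_mul N 2 ?R (hd_mul N 2 ?L1 ?R)))
      (hd_mul N 2 ?R (hd_mul N 2 ?L1 (hd_mul N 2 ?R ?L1)))"
    "hd_op_eq N 2 (hd_scale (sc (\<gamma>^2)) (hd_mul N 2 ?T1 ?L2))
      (hd_mul N 2 ?R (hd_mul N 2 ?L1 (hd_mul N 2 ?R ?T1)))"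
    using assms unfolding HD_rel_def Let_def by auto
  have R: "rep 1 2 ?R = crep (Suc 0) 2 R" by (simp add: crep_def)
  have l: "rep 1 2 ?L1 = mat L" "rep 1 2 ?T1 = mat T" "rep 1 2 ?L2 = rep 2 1 (hd_vop L)"
    by (simp_all add: rep_lift mat_def numeral_2_eq_2)
  show "mat L * crep (Suc 0) 2 R * mat L * crep (Suc 0) 2 R = crep (Suc 0) 2 R * mat L * crep (Suc 0) 2 R * mat L"
    using rep_cong[OF HD(1), of 1] unfolding rep_mul l R by (simp only: mult.assoc)
  show "\<gamma>\<^sup>2 \<cdot> (mat T * rep 2 1 (hd_vop L)) = crep (Suc 0) 2 R * mat L * crep (Suc 0) 2 R * mat T"
    using rep_cong[OF HD(2), of 1] unfolding rep_mul rep_scale l R sm_def by (simp only: mult.assoc)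
  show "mat L \<in> C (Suc p)" "mat T \<in> C (Suc p)" if "1 \<le> p" for p
    using that unfolding mat_def by (auto intro!: rep_C)
  show "crep (Suc i) 2 R * mat L = mat L * crep (Suc i) 2 R" "crep (Suc i) 2 R * mat T = mat T * crep (Suc i) 2 R"
    if "1 \<le> i" for i
    using that unfolding mat_def by (auto intro!: crep_comm[symmetric] rep_C)
qed

lemma T_acoef:
  assumes HD: "HD_rel sc N R \<gamma> T L" and k: "k \<le> n"
  shows "\<gamma> ^ (2 * k) \<cdot> (mat T * emb (acoef sc N q R Psi L k)) =
    emb (acoef sc N q R Psi L k) * mat T - (q\<^sup>2 - 1) \<cdot>
      (\<Sum>m=1..k. inverse ((- q) ^ m) \<cdot> (emb (acoef sc N q R Psi L (k - m)) * mat L ^ m * mat T))"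
proof -
  interpret H: heisenberg_tower "\<lambda>c. emb (sc c)" q n "\<lambda>i. crep (Suc i) 2 R" "\<lambda>i. crep (Suc i) 2 Ri"
    "\<lambda>p. C (Suc p)" "\<lambda>p. theta (Suc p)" "mat L" "rep 2 1 (hd_vop L)" "mat T" "\<gamma>\<^sup>2"
    using HD by (rule heisenberg)
  have a: "H.a k = emb (acoef sc N q R Psi L k)" for k
    unfolding H.a_def emb_acoef[of L k 0] by (simp add: mat_def)
  have "tower.Th 1 k (tower.Asy 1 k * tower.LL (rep 2 1 (hd_vop L)) 1 k) = H.a k"
    unfolding a emb_acoef[of L k 1] by (simp add: numeral_2_eq_2)
  from H.T_a[OF k this] show ?thesis
    unfolding a by (simp add: power_mult)
qed

lemma mat_mpow: "mat (mpow N L m) = mat L ^ m"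
proof (induction m)
  case 0
  show ?case using mat_diag[of 1] by (simp add: mid_def emb_1)
qed (simp add: mat_mmul)

lemma T_acoef_entries:
  assumes "HD_rel sc N R \<gamma> T L" "k \<le> n" "i < N" "j < N"
  shows "sc (\<gamma>^(2*k)) * T i j * acoef sc N q R Psi L k =
         acoef sc N q R Psi L k * T i j - sc (q^2 - 1) *
           (\<Sum>m=1..k. sc (inverse ((-q)^m)) * acoef sc N q R Psi L (k - m) * mmul N (mpow N L m) T i j)"
proof -
  have "mat (\<lambda>i j. sc (\<gamma>^(2*k)) * T i j * acoef sc N q R Psi L k) =
     mat (\<lambda>i j. acoef sc N q R Psi L k * T i j - sc (q^2 - 1) *
       (\<Sum>m=1..k. sc (inverse ((-q)^m)) * acoef sc N q R Psi L (k - m) * mmul N (mpow N L m) T i j))"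
    using T_acoef[OF assms(1,2)]
    by (simp add: mat_right mat_left mat_diff mat_sum mat_mmul mat_mpow emb_mult sm_def mult.assoc)
  from mat_inj[OF this assms(3,4)] show ?thesis .
qed

text \<open>The product and \<open>esym_Suc\<close> both append \<mu>_m on the right, so in the
  induction it only has to pass powers of X.\<close>

lemma vieta:
  assumes "\<And>\<beta>. \<beta> < m \<Longrightarrow> emb (\<mu> \<beta>) * X = X * emb (\<mu> \<beta>)"
  shows "prod_list (map (\<lambda>\<beta>. X - emb (sc q * \<mu> \<beta>)) [0..<m]) =
    (\<Sum>i\<le>m. (- q) ^ i \<cdot> (emb (esym m \<mu> i) * X ^ (m - i)))"
  using assms
proof (induction m)
  case 0
  show ?case by (simp add: esym_0 emb_1)
next
  case (Suc m)
  let ?e = "\<lambda>i. emb (esym m \<mu> i)" and ?u = "emb (\<mu> m)"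
  have pow: "X ^ k * ?u = ?u * X ^ k" for k
    using power_commuting_commutes[of X ?u k] Suc.prems[of m] by simp
  have "prod_list (map (\<lambda>\<beta>. X - emb (sc q * \<mu> \<beta>)) [0..<Suc m]) =
      (\<Sum>i\<le>m. (- q) ^ i \<cdot> (?e i * X ^ (m - i))) * (X - q \<cdot> ?u)"
    using Suc by (simp add: emb_mult sm_def)
  also have "\<dots> = (\<Sum>i\<le>m. (- q) ^ i \<cdot> (?e i * X ^ (Suc m - i)) + (- q) ^ Suc i \<cdot> (?e i * ?u * X ^ (m - i)))"
    unfolding sum_distrib_right
  proof (intro sum.cong refl)
    fix i assume "i \<in> {..m}"
    then have "X ^ (Suc m - i) = X ^ (m - i) * X" by (simp add: Suc_diff_le power_commutes)
    then show "(- q) ^ i \<cdot> (?e i * X ^ (m - i)) * (X - q \<cdot> ?u) =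
      (- q) ^ i \<cdot> (?e i * X ^ (Suc m - i)) + (- q) ^ Suc i \<cdot> (?e i * ?u * X ^ (m - i))"
      by (simp add: right_diff_distrib sm_mult mult.assoc pow sm_minus_left mult.commute[of q])
  qed
  also have "\<dots> = (\<Sum>i\<le>Suc m. (- q) ^ i \<cdot> (?e i * X ^ (Suc m - i))) + (\<Sum>i\<le>m. (- q) ^ Suc i \<cdot> (?e i * ?u * X ^ (m - i)))"
    by (simp add: sum.distrib esym_gt emb_0)
  also have "\<dots> = (\<Sum>i\<le>Suc m. (- q) ^ i \<cdot> (emb (esym (Suc m) \<mu> i) * X ^ (Suc m - i)))"
    unfolding sum.atMost_Suc_shift
    by (simp add: esym_0 esym_Suc emb_add emb_mult distrib_right sm_add sum.distrib algebra_simps)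
  finally show ?case .
qed

lemma cayley_hamilton_T:
  assumes HD: "HD_rel sc N R \<gamma> T L"
    and ext: "(\<exists>dinv ainv. GL_ext sc N n q \<gamma> R Psi T L dinv ainv) \<or> SL_cond sc N n q \<gamma> R Psi T L"
    and comm: "\<And>\<beta>. \<beta> < n \<Longrightarrow> emb (\<mu> \<beta>) * mat L = mat L * emb (\<mu> \<beta>)"
    and a_e: "\<And>k. k \<le> n \<Longrightarrow> acoef sc N q R Psi L k = esym n \<mu> k"
    and q2: "q\<^sup>2 \<noteq> 1"
  shows "prod_list (map (\<lambda>\<beta>. mat L - emb (sc q * \<mu> \<beta>)) [0..<n]) * mat T = 0"
proof -
  let ?a = "\<lambda>k. emb (acoef sc N q R Psi L k)"
  \<comment> \<open>For GL the relation for the inverse of a_n is multiplied by a_n on both sides;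
    for SL a_n is the scalar 1/q and \<gamma>^(2n) = q^2.\<close>
  have an: "\<gamma> ^ (2 * n) \<cdot> (mat T * ?a n) = q\<^sup>2 \<cdot> (?a n * mat T)"
    using ext
  proof
    assume "\<exists>dinv ainv. GL_ext sc N n q \<gamma> R Psi T L dinv ainv"
    then obtain ainv where inv: "ainv * acoef sc N q R Psi L n = 1" "acoef sc N q R Psi L n * ainv = 1"
      and rel: "\<And>i j. i < N \<Longrightarrow> j < N \<Longrightarrow> sc (\<gamma> ^ (2 * n)) * ainv * T i j = sc (q\<^sup>2) * T i j * ainv"
      unfolding GL_ext_def Let_def by blast
    have b: "emb ainv * ?a n = 1" "?a n * emb ainv = 1" using inv by (simp_all flip: emb_mult add: emb_1)
    have "mat (\<lambda>i j. sc (\<gamma> ^ (2 * n)) * ainv * T i j) = mat (\<lambda>i j. sc (q\<^sup>2) * T i j * ainv)"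
      using rel by (rule mat_cong)
    then have "\<gamma> ^ (2 * n) \<cdot> (emb ainv * mat T) = q\<^sup>2 \<cdot> (mat T * emb ainv)"
      by (simp add: mat_left mat_right emb_mult sm_def mult.assoc)
    then have "?a n * (\<gamma> ^ (2 * n) \<cdot> (emb ainv * mat T)) * ?a n = ?a n * (q\<^sup>2 \<cdot> (mat T * emb ainv)) * ?a n"
      by simp
    then have "\<gamma> ^ (2 * n) \<cdot> ((?a n * emb ainv) * mat T * ?a n) = q\<^sup>2 \<cdot> (?a n * mat T * (emb ainv * ?a n))"
      by (simp only: sm_mult mult.assoc)
    then show ?thesis by (simp add: b)
  next
    assume "SL_cond sc N n q \<gamma> R Psi T L"
    then have "?a n = inverse q \<cdot> 1" and g: "\<gamma> ^ n = q"
      unfolding SL_cond_def by (simp_all add: sm_def)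
    moreover have "\<gamma> ^ (2 * n) = q\<^sup>2" using g by (simp add: power_mult mult.commute[of 2])
    ultimately show ?thesis by (simp add: sm_mult)
  qed
  let ?S = "\<Sum>m=1..n. inverse ((- q) ^ m) \<cdot> (?a (n - m) * mat L ^ m * mat T)"
  \<comment> \<open>The case k = n of \<open>T_acoef\<close> now has q^2 a_n T on its left
    side.\<close>
  have "(q\<^sup>2 - 1) \<cdot> (?a n * mat T + ?S) = 0"
    using T_acoef[OF HD order.refl] unfolding an by (simp add: sm_add sm_diff_left algebra_simps)
  then have S: "?a n * mat T + ?S = 0"
    using sm_cancel[of "q\<^sup>2 - 1" "?a n * mat T + ?S" 0] q2 by simp
  have "prod_list (map (\<lambda>\<beta>. mat L - emb (sc q * \<mu> \<beta>)) [0..<n]) * mat T =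
      (\<Sum>i\<le>n. (- q) ^ i \<cdot> (?a i * mat L ^ (n - i) * mat T))"
    by (subst vieta[OF comm]) (simp_all add: sum_distrib_right sm_mult a_e)
  also have "\<dots> = (\<Sum>m\<le>n. (- q) ^ (n - m) \<cdot> (?a (n - m) * mat L ^ m * mat T))"
    by (rule sum.reindex_bij_witness[of _ "\<lambda>i. n - i" "\<lambda>i. n - i"]) auto
  also have "\<dots> = (\<Sum>m\<le>n. (- q) ^ n \<cdot> inverse ((- q) ^ m) \<cdot> (?a (n - m) * mat L ^ m * mat T))"
    using q_nz by (intro sum.cong refl) (simp add: sm_sm power_diff divide_inverse)
  also have "\<dots> = (- q) ^ n \<cdot> (\<Sum>m\<le>n. inverse ((- q) ^ m) \<cdot> (?a (n - m) * mat L ^ m * mat T))"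
    by (simp only: sm_sum)
  also have "(\<Sum>m\<le>n. inverse ((- q) ^ m) \<cdot> (?a (n - m) * mat L ^ m * mat T)) = ?a n * mat T + ?S"
    by (simp add: atMost_atLeast0 sum.atLeast_Suc_atMost[of 0])
  finally show ?thesis by (simp only: S sm_0)
qed

lemma mat_eq_iff: "(\<forall>i<N. \<forall>j<N. X i j = Y i j) \<longleftrightarrow> mat X = mat Y"
  using mat_cong[of X Y] mat_inj[of X Y] by blast

lemma mat_foldr:
  "mat (foldr (\<lambda>\<beta> acc. mmul N (F \<beta>) acc) bs mid) = prod_list (map (\<lambda>\<beta>. mat (F \<beta>)) bs)"
proof (induction bs)
  case Nil
  show ?case using mat_diag[of 1] by (simp add: mid_def emb_1)
qed (simp add: mat_mmul)

lemma spectral_equivalence: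
  assumes HD: "HD_rel sc N R \<gamma> T L"
    and n: "1 \<le> n"
    and ext: "(\<exists>dinv ainv. GL_ext sc N n q \<gamma> R Psi T L dinv ainv) \<or> SL_cond sc N n q \<gamma> R Psi T L"
    and mu_comm: "\<And>\<alpha> \<beta>. \<alpha> < n \<Longrightarrow> \<beta> < n \<Longrightarrow> \<mu> \<alpha> * \<mu> \<beta> = \<mu> \<beta> * \<mu> \<alpha>"
    and mu_diff: "\<And>\<alpha> \<beta>. \<alpha> < n \<Longrightarrow> \<beta> < n \<Longrightarrow> \<alpha> \<noteq> \<beta> \<Longrightarrow> ring_invertible (\<mu> \<alpha> - \<mu> \<beta>)"
    and mu_L: "\<And>\<alpha> i j. \<alpha> < n \<Longrightarrow> i < N \<Longrightarrow> j < N \<Longrightarrow> \<mu> \<alpha> * L i j = L i j * \<mu> \<alpha>"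
    and a_e: "\<And>k. k \<le> n \<Longrightarrow> acoef sc N q R Psi L k = esym n \<mu> k"
  shows "(\<forall>\<alpha><n. \<forall>\<beta><n. \<forall>i<N. \<forall>j<N.
         sc (\<gamma>^2) * mmul N (Pproj sc N n q L \<mu> \<beta>) T i j * \<mu> \<alpha> =
         sc (if \<alpha> = \<beta> then q^2 else 1) * \<mu> \<alpha> * mmul N (Pproj sc N n q L \<mu> \<beta>) T i j)
      \<longleftrightarrow>
      (\<forall>\<alpha><n. \<forall>i<N. \<forall>j<N.
         sc (\<gamma>^2) * T i j * \<mu> \<alpha> =
         \<mu> \<alpha> * T i j + sc (q^2 - 1) * \<mu> \<alpha> * mmul N (Pproj sc N n q L \<mu> \<alpha>) T i j)"
    (is "?star \<longleftrightarrow> ?alt")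
proof -
  let ?d = "\<lambda>\<alpha> \<beta>. ring_inv (sc q * (\<mu> \<alpha> - \<mu> \<beta>))"
  define m where "m \<alpha> = emb (\<mu> \<alpha>)" for \<alpha>
  \<comment> \<open>The nodes carry the factor q, so that the denominators in \<open>Pproj\<close>
    are differences of nodes.\<close>
  define y where "y \<alpha> = emb (sc q * \<mu> \<alpha>)" for \<alpha>
  define d where "d \<alpha> \<beta> = emb (?d \<alpha> \<beta>)" for \<alpha> \<beta>
  have y: "y \<alpha> = q \<cdot> m \<alpha>" for \<alpha> by (simp add: y_def m_def emb_mult sm_def)
  have d_inv: "d \<alpha> \<beta> * (y \<alpha> - y \<beta>) = 1" "(y \<alpha> - y \<beta>) * d \<alpha> \<beta> = 1"
    if ab: "\<alpha> < n" "\<beta> < n" "\<alpha> \<noteq> \<beta>" for \<alpha> \<beta>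
  proof -
    let ?v = "\<mu> \<alpha> - \<mu> \<beta>"
    obtain w where w: "?v * w = 1" "w * ?v = 1"
      using mu_diff[OF ab] unfolding ring_invertible_def by blast
    have cen: "sc c * r = r * sc c" for c r using scal unfolding central_scalars_def by blast
    have qq: "sc q * sc (inverse q) = 1" using q_nz by (simp flip: sc_simps(4) add: sc_simps(2))
    \<comment> \<open>\<open>ring_inv\<close> is a choice; it yields an inverse once some two-sided
      inverse is exhibited.\<close>
    have "(sc q * ?v) * (sc (inverse q) * w) = (sc q * sc (inverse q)) * (?v * w)"
      by (metis cen mult.assoc)
    moreover have "(sc (inverse q) * w) * (sc q * ?v) = (sc q * sc (inverse q)) * (w * ?v)"
      by (metis cen mult.assoc)
    ultimately have "\<exists>z. (sc q * ?v) * z = 1 \<and> z * (sc q * ?v) = 1" using qq w by auto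
    then have "(sc q * ?v) * ?d \<alpha> \<beta> = 1 \<and> ?d \<alpha> \<beta> * (sc q * ?v) = 1"
      unfolding ring_inv_def by (rule someI_ex)
    then have "emb (sc q * ?v) * d \<alpha> \<beta> = 1" "d \<alpha> \<beta> * emb (sc q * ?v) = 1"
      unfolding d_def by (simp_all flip: emb_mult add: emb_1)
    moreover have "emb (sc q * ?v) = y \<alpha> - y \<beta>" by (simp add: y_def right_diff_distrib emb_diff)
    ultimately show "d \<alpha> \<beta> * (y \<alpha> - y \<beta>) = 1" "(y \<alpha> - y \<beta>) * d \<alpha> \<beta> = 1" by simp_all
  qed
  have mm: "m \<alpha> * m \<beta> = m \<beta> * m \<alpha>" if "\<alpha> < n" "\<beta> < n" for \<alpha> \<beta>
    using mu_comm[OF that] by (simp add: m_def flip: emb_mult)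
  have mL: "m \<alpha> * mat L = mat L * m \<alpha>" if "\<alpha> < n" for \<alpha>
    using mat_cong[of "\<lambda>i j. \<mu> \<alpha> * L i j" "\<lambda>i j. L i j * \<mu> \<alpha>"] mu_L[OF that]
    by (simp add: mat_left mat_right m_def)
  define G where "G = insert (mat L) (m ` {..<n})"
  \<comment> \<open>The double commutant is commutative and, unlike the generated subring, closed under inverses.\<close>
  define B where "B = {z. \<forall>c. (\<forall>g\<in>G. c * g = g * c) \<longrightarrow> z * c = c * z}"
  have GG: "a * b = b * a" if "a \<in> G" "b \<in> G" for a b
    using that mm mL unfolding G_def by auto
  have GB: "G \<subseteq> B" unfolding B_def by auto
  have B_comm: "a * b = b * a" if "a \<in> B" "b \<in> B" for a b
  proof -
    have "b * g = g * b" if "g \<in> G" for g using \<open>b \<in> B\<close> that GG unfolding B_def by blast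
    then show ?thesis using \<open>a \<in> B\<close> unfolding B_def by blast
  qed
  have B_diff: "a - b \<in> B" if "a \<in> B" "b \<in> B" for a b
    using that unfolding B_def by (simp add: algebra_simps)
  have B_mult: "a * b \<in> B" if "a \<in> B" "b \<in> B" for a b
    using that unfolding B_def by (simp add: mult.assoc) (simp flip: mult.assoc)
  have B_sm: "c \<cdot> a \<in> B" if "a \<in> B" for a c
    using that unfolding B_def by (simp add: sm_mult)
  have m_B: "m \<alpha> \<in> B" if "\<alpha> < n" for \<alpha> using that GB unfolding G_def by auto
  have d_B: "d \<alpha> \<beta> \<in> B" if "\<alpha> < n" "\<beta> < n" "\<alpha> \<noteq> \<beta>" for \<alpha> \<beta>
    unfolding B_def
  proof (clarify)
    fix c assume "\<forall>g\<in>G. c * g = g * c"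
    moreover have "y \<alpha> - y \<beta> \<in> B" unfolding y using that by (intro B_diff B_sm m_B)
    ultimately have u: "(y \<alpha> - y \<beta>) * c = c * (y \<alpha> - y \<beta>)" unfolding B_def by blast
    have "d \<alpha> \<beta> * c = d \<alpha> \<beta> * (c * (y \<alpha> - y \<beta>)) * d \<alpha> \<beta>"
      using d_inv(2)[OF that] by (simp add: mult.assoc)
    also have "\<dots> = (d \<alpha> \<beta> * (y \<alpha> - y \<beta>)) * c * d \<alpha> \<beta>"
      unfolding u[symmetric] by (simp only: mult.assoc)
    also have "\<dots> = c * d \<alpha> \<beta>" using d_inv(1)[OF that] by simp
    finally show "d \<alpha> \<beta> * c = c * d \<alpha> \<beta>" .
  qed
  interpret Q: commuting_nodes B "mat L" y d n
  proof
    show "1 \<in> B" unfolding B_def by simp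
    show "mat L \<in> B" using GB unfolding G_def by simp
    show "y \<alpha> \<in> B" if "\<alpha> < n" for \<alpha> unfolding y using that by (intro B_sm m_B)
  qed (fact B_comm B_diff B_mult d_B d_inv(1))+
  define p where "p \<alpha> = Q.P \<alpha> [0..<n]" for \<alpha>
  have p: "mat (Pproj sc N n q L \<mu> \<alpha>) = p \<alpha>" for \<alpha>
    unfolding Pproj_def p_def Q.P_def mat_foldr
    by (simp add: mat_right mat_diff mat_diag y_def d_def)
  have p_B: "p \<alpha> \<in> B" if "\<alpha> < n" for \<alpha>
    unfolding p_def using that by (intro Q.P_B) auto
  have pm: "p \<beta> * m \<alpha> = m \<alpha> * p \<beta>" if "\<alpha> < n" "\<beta> < n" for \<alpha> \<beta>
    using that by (intro B_comm p_B m_B)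
  have sum_p: "(\<Sum>\<beta><n. p \<beta>) = 1"
    using Q.sum_P[of "[0..<n]"] n unfolding p_def by (simp add: atLeast0LessThan)
  let ?\<tau> = "mat T"
  have star: "?star \<longleftrightarrow> (\<forall>\<alpha><n. \<forall>\<beta><n. \<gamma>\<^sup>2 \<cdot> (p \<beta> * ?\<tau> * m \<alpha>) =
      (if \<alpha> = \<beta> then q\<^sup>2 else 1) \<cdot> (m \<alpha> * (p \<beta> * ?\<tau>)))"
    unfolding mat_eq_iff by (simp add: mat_left mat_right mat_mmul emb_mult p m_def sm_def mult.assoc)
  have alt: "?alt \<longleftrightarrow> (\<forall>\<alpha><n. \<gamma>\<^sup>2 \<cdot> (?\<tau> * m \<alpha>) =
      m \<alpha> * ?\<tau> + (q\<^sup>2 - 1) \<cdot> (m \<alpha> * (p \<alpha> * ?\<tau>)))"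
    unfolding mat_eq_iff by (simp add: mat_left mat_right mat_add mat_mmul emb_mult p m_def sm_def mult.assoc)
  show ?thesis
    unfolding star alt
  proof (intro iffI allI impI)
    fix \<alpha>
    assume st: "\<forall>\<alpha><n. \<forall>\<beta><n. \<gamma>\<^sup>2 \<cdot> (p \<beta> * ?\<tau> * m \<alpha>) =
        (if \<alpha> = \<beta> then q\<^sup>2 else 1) \<cdot> (m \<alpha> * (p \<beta> * ?\<tau>))"
      and \<alpha>: "\<alpha> < n"
    \<comment> \<open>Inserting the sum of the projectors lets the relation act term by term; only
      \<beta> = \<alpha> deviates from the coefficient 1.\<close>
    have "\<gamma>\<^sup>2 \<cdot> (?\<tau> * m \<alpha>) = \<gamma>\<^sup>2 \<cdot> ((\<Sum>\<beta><n. p \<beta>) * ?\<tau> * m \<alpha>)"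
      by (simp add: sum_p)
    also have "\<dots> = (\<Sum>\<beta><n. \<gamma>\<^sup>2 \<cdot> (p \<beta> * ?\<tau> * m \<alpha>))"
      by (simp add: sum_distrib_right sm_sum)
    also have "\<dots> = (\<Sum>\<beta><n. m \<alpha> * (p \<beta> * ?\<tau>) + (if \<alpha> = \<beta> then (q\<^sup>2 - 1) \<cdot> (m \<alpha> * (p \<alpha> * ?\<tau>)) else 0))"
      using st \<alpha> by (intro sum.cong refl) (auto simp: sm_diff_left)
    also have "\<dots> = m \<alpha> * ((\<Sum>\<beta><n. p \<beta>) * ?\<tau>) + (q\<^sup>2 - 1) \<cdot> (m \<alpha> * (p \<alpha> * ?\<tau>))"
      using \<alpha> by (simp add: sum.distrib sum_distrib_left sum_distrib_right)
    finally show "\<gamma>\<^sup>2 \<cdot> (?\<tau> * m \<alpha>) = m \<alpha> * ?\<tau> + (q\<^sup>2 - 1) \<cdot> (m \<alpha> * (p \<alpha> * ?\<tau>))"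
      by (simp add: sum_p)
  next
    fix \<alpha> \<beta>
    assume al: "\<forall>\<alpha><n. \<gamma>\<^sup>2 \<cdot> (?\<tau> * m \<alpha>) = m \<alpha> * ?\<tau> + (q\<^sup>2 - 1) \<cdot> (m \<alpha> * (p \<alpha> * ?\<tau>))"
      and ab: "\<alpha> < n" "\<beta> < n"
    \<comment> \<open>Kept with the factor q^2 - 1: at q^2 = 1 both sides are 0, otherwise the
      Cayley-Hamilton identity on T is available.\<close>
    have orth: "(q\<^sup>2 - 1) \<cdot> (p \<beta> * (p \<alpha> * ?\<tau>)) = (q\<^sup>2 - 1) \<cdot> (if \<alpha> = \<beta> then p \<beta> * ?\<tau> else 0)"
    proof (cases "q\<^sup>2 = 1")
      case False
      have ch: "prod_list (map (\<lambda>\<beta>. mat L - y \<beta>) [0..<n]) * ?\<tau> = 0"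
        unfolding y_def using mL unfolding m_def
        by (intro cayley_hamilton_T[OF HD ext _ a_e False]) auto
      have xs: "distinct [0..<n]" "[0..<n] \<noteq> []" "set [0..<n] \<subseteq> {..<n}" using n by auto
      show ?thesis
        using Q.P_orthogonal[OF xs ch, of \<alpha> \<beta>] Q.P_idem[OF xs ch, of \<alpha>] ab unfolding p_def by auto
    qed simp
    have "\<gamma>\<^sup>2 \<cdot> (p \<beta> * ?\<tau> * m \<alpha>) = p \<beta> * (\<gamma>\<^sup>2 \<cdot> (?\<tau> * m \<alpha>))"
      by (simp add: sm_mult mult.assoc)
    also have "\<dots> = (p \<beta> * m \<alpha>) * ?\<tau> + (q\<^sup>2 - 1) \<cdot> ((p \<beta> * m \<alpha>) * (p \<alpha> * ?\<tau>))"
      using al ab by (simp add: distrib_left sm_mult mult.assoc)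
    also have "\<dots> = m \<alpha> * (p \<beta> * ?\<tau> + (q\<^sup>2 - 1) \<cdot> (p \<beta> * (p \<alpha> * ?\<tau>)))"
      unfolding pm[OF ab] by (simp add: distrib_left sm_mult mult.assoc)
    also have "\<dots> = (if \<alpha> = \<beta> then q\<^sup>2 else 1) \<cdot> (m \<alpha> * (p \<beta> * ?\<tau>))"
      unfolding orth by (simp add: distrib_left right_diff_distrib sm_mult sm_diff_left)
    finally show "\<gamma>\<^sup>2 \<cdot> (p \<beta> * ?\<tau> * m \<alpha>) = (if \<alpha> = \<beta> then q\<^sup>2 else 1) \<cdot> (m \<alpha> * (p \<beta> * ?\<tau>))" .
  qed
qed

end

theorem theorem3p27:
  fixes sc :: "complex \<Rightarrow> 'a::ring_1"
    and N n :: nat and q \<gamma> :: complex and R Psi :: "complex hd_op"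
    and T L :: "nat \<Rightarrow> nat \<Rightarrow> 'a" and \<mu> :: "nat \<Rightarrow> 'a"
  assumes n_pos: "1 \<le> n"
    and gamma_nz: "\<gamma> \<noteq> 0"
    and R_mat: "is_Rmatrix N R"
    and R_skew: "is_skew_inverse N R Psi"
    and R_GL: "GLq_type N n q R"
    and scal: "central_scalars sc"
    and HD: "HD_rel sc N R \<gamma> T L"
    and GL_or_SL: "(\<exists>dinv ainv. GL_ext sc N n q \<gamma> R Psi T L dinv ainv) \<or>
                   (SL_cond sc N n q \<gamma> R Psi T L \<and> prod_list (map \<mu> [0..<n]) = sc (inverse q))"
    and mu_comm: "\<forall>\<alpha><n. \<forall>\<beta><n. \<mu> \<alpha> * \<mu> \<beta> = \<mu> \<beta> * \<mu> \<alpha>"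
    and mu_inv: "\<forall>\<alpha><n. ring_invertible (\<mu> \<alpha>)"
    and mu_diff_inv: "\<forall>\<alpha><n. \<forall>\<beta><n. \<alpha> \<noteq> \<beta> \<longrightarrow> ring_invertible (\<mu> \<alpha> - \<mu> \<beta>)"
    and mu_L: "\<forall>\<alpha><n. \<forall>i<N. \<forall>j<N. \<mu> \<alpha> * L i j = L i j * \<mu> \<alpha>"
    and a_e: "\<forall>i. 1 \<le> i \<and> i \<le> n \<longrightarrow> acoef sc N q R Psi L i = esym n \<mu> i"
  shows
    "((\<forall>\<alpha><n. \<forall>\<beta><n. \<forall>i<N. \<forall>j<N.
         sc (\<gamma>^2) * mmul N (Pproj sc N n q L \<mu> \<beta>) T i j * \<mu> \<alpha> =
         sc (if \<alpha> = \<beta> then q^2 else 1) * \<mu> \<alpha> * mmul N (Pproj sc N n q L \<mu> \<beta>) T i j)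
      \<longleftrightarrow>
      (\<forall>\<alpha><n. \<forall>i<N. \<forall>j<N.
         sc (\<gamma>^2) * T i j * \<mu> \<alpha> =
         \<mu> \<alpha> * T i j + sc (q^2 - 1) * \<mu> \<alpha> * mmul N (Pproj sc N n q L \<mu> \<alpha>) T i j))
    \<and>
     ((\<forall>\<alpha><n. \<forall>\<beta><n. \<forall>i<N. \<forall>j<N.
         sc (\<gamma>^2) * mmul N (Pproj sc N n q L \<mu> \<beta>) T i j * \<mu> \<alpha> =
         sc (if \<alpha> = \<beta> then q^2 else 1) * \<mu> \<alpha> * mmul N (Pproj sc N n q L \<mu> \<beta>) T i j)
      \<longrightarrow>
      (\<forall>k\<le>n. \<forall>i<N. \<forall>j<N.
         sc (\<gamma>^(2*k)) * T i j * esym n \<mu> k =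
         esym n \<mu> k * T i j - sc (q^2 - 1) *
           (\<Sum>m=1..k. sc (inverse ((-q)^m)) * esym n \<mu> (k - m) * mmul N (mpow N L m) T i j)))
    \<and>
     (\<forall>k\<le>n. \<forall>i<N. \<forall>j<N.
         sc (\<gamma>^(2*k)) * T i j * acoef sc N q R Psi L k =
         acoef sc N q R Psi L k * T i j - sc (q^2 - 1) *
           (\<Sum>m=1..k. sc (inverse ((-q)^m)) * acoef sc N q R Psi L (k - m) * mmul N (mpow N L m) T i j))"
proof (cases "N = 0")
  case True
  \<comment> \<open>Without entries every claim is vacuous; the model by matrix units is built for
    positive N.\<close>
  then show ?thesis by simp
next
  case False
  let ?star = "\<forall>\<alpha><n. \<forall>\<beta><n. \<forall>i<N. \<forall>j<N.
    sc (\<gamma>^2) * mmul N (Pproj sc N n q L \<mu> \<beta>) T i j * \<mu> \<alpha> =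
    sc (if \<alpha> = \<beta> then q^2 else 1) * \<mu> \<alpha> * mmul N (Pproj sc N n q L \<mu> \<beta>) T i j"
  interpret matrix_units N "unit_endo N" "left_mult :: 'a \<Rightarrow> _"
    using False by (intro matrix_units_endo) simp
  interpret R_matrix_rep N "unit_endo N" "left_mult :: 'a \<Rightarrow> _" sc n q R Psi
  proof
    fix c and X :: "'a endo"
    show "left_mult (sc c) * X = X * left_mult (sc c)"
      using scal unfolding central_scalars_def by (intro left_mult_central) blast
  qed (fact scal R_mat R_skew R_GL)+
  have ext: "(\<exists>dinv ainv. GL_ext sc N n q \<gamma> R Psi T L dinv ainv) \<or> SL_cond sc N n q \<gamma> R Psi T L"
    using GL_or_SL by blast
  \<comment> \<open>Both sides are 1 at k = 0, so the identification also covers the summand m =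
    k.\<close>
  have a_e': "acoef sc N q R Psi L k = esym n \<mu> k" if "k \<le> n" for k
    using a_e that by (cases "k = 0") (simp_all add: acoef_def esym_0)
  have a_rel: "sc (\<gamma>^(2*k)) * T i j * acoef sc N q R Psi L k =
      acoef sc N q R Psi L k * T i j - sc (q^2 - 1) *
        (\<Sum>m=1..k. sc (inverse ((-q)^m)) * acoef sc N q R Psi L (k - m) * mmul N (mpow N L m) T i j)"
    if "k \<le> n" "i < N" "j < N" for k i j
    using HD that by (rule T_acoef_entries)
  have e_rel: "sc (\<gamma>^(2*k)) * T i j * esym n \<mu> k =
      esym n \<mu> k * T i j - sc (q^2 - 1) *
        (\<Sum>m=1..k. sc (inverse ((-q)^m)) * esym n \<mu> (k - m) * mmul N (mpow N L m) T i j)"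
    if "k \<le> n" "i < N" "j < N" for k i j
    using a_rel[OF that] that(1) by (simp add: a_e')
  have part_a: "?star \<longleftrightarrow> (\<forall>\<alpha><n. \<forall>i<N. \<forall>j<N. sc (\<gamma>^2) * T i j * \<mu> \<alpha> =
      \<mu> \<alpha> * T i j + sc (q^2 - 1) * \<mu> \<alpha> * mmul N (Pproj sc N n q L \<mu> \<alpha>) T i j)"
    by (rule spectral_equivalence[OF HD n_pos ext]) (use mu_comm mu_diff_inv mu_L a_e' in blast)+
  show ?thesis
    by (rule conjI[OF part_a conjI], intro impI allI, rule e_rel, assumption+)
      (intro impI allI, rule a_rel)
qed

end
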